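(* Let $\Lambda$ be a finitely aligned $k$-graph, let $\{s_\lambda:\lambda\in\Lambda\}$ be the universal Cuntz-Krieger $\Lambda$-family generating $C^*(\Lambda)$, and let $D=C^*(\{s_\mu s_\mu^*:\mu\in\Lambda\})\subset C^*(\Lambda)$. Then $D=\overline{\mathrm{span}}\{s_\mu s_\mu^*:\mu\in\Lambda\}$, and for each $x\in\partial\Lambda$ there exists a unique $h(x)\in\Delta(D)$ such that for all $\mu\in\Lambda$ $$h(x)(s_\mu s_\mu^* )=\begin{cases}1&\text{if } x=\mu\mu' \text{ for some } \mu'\in W_\Lambda\\0&\text{otherwise.}\end{cases}$$ Moreover, $x\mapsto h(x)$ is a homeomorphism $h:\partial\Lambda\to\Delta(D)$.
   Context: Conventions: $\mathbb N=\{0,1,2,\dots\}$; $(\mathbb N\cup\{\infty\})^k$ is ordered coordinatewise; $\vee$ is the coordinatewise maximum. A $k$-graph is a countable category $\Lambda$ with a functor $d:\Lambda\to\mathbb N^k$ (degree) satisfying the factorisation property: whenever $d(\lambda)=m+n$ there are unique $\mu,\nu$ with $\lambda=\mu\nu$, $d(\mu)=m$, $d(\nu)=n$. $\lambda\in\Lambda$ means $\lambda$ is a morphism (path), $r,s$ are codomain and domain ($\lambda\mu$ is defined iff $s(\lambda)=r(\mu)$). $\Lambda^n=d^{-1}(n)$; $\Lambda^0$ is identified with the objects (vertices); $v\Lambda=\{\lambda\in\Lambda:r(\lambda)=v\}$. A $k$-graph morphism is a degree-preserving functor. For $m\in(\mathbb N\cup\{\infty\})^k$, $\Omega_{k,m}$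 is the $k$-graph with objects $p\in\mathbb N^k$, $p\le m$, morphisms $(p,q)$ with $p\le q\le m$, $r(p,q)=p$, $s(p,q)=q$, $d(p,q)=q-p$, $(p,q)(q,t)=(p,t)$. $\Lambda^m$ also denotes the set of $k$-graph morphisms $x:\Omega_{k,m}\to\Lambda$, with $d(x):=m$, $x(n):=x(n,n)$, $r(x):=x(0)$; for $m\in\mathbb N^k$ these are identified with the paths of degree $m$ ($\lambda(p,q)$ being the unique middle factor $\lambda''$ of $\lambda=\lambda'\lambda''\lambda'''$ with $d(\lambda')=p$, $d(\lambda'')=q-p$). $W_\Lambda=\bigcup_m\Lambda^m$ is the path space. If $\lambda\in\Lambda$, $x\in W_\Lambda$, $r(x)=s(\lambda)$, then $\lambda x$ is the unique element of $W_\Lambda$ of degree $d(\lambda)+d(x)$ with $(\lambda x)(0,d(\lambda))=\lambda$ and $(\lambda x)(d(\lambda),d(\lambda)+n)=x(0,n)$ for $n\le d(x)$. $\Lambda^{\min}(\mu,\nu)=\{(\alpha,\beta):\mu\alpha=\nu\beta,\ d(\mu\alpha)=d(\mu)\vee d(\nu)\}$; $\Lambda$ is finitely aligned if all these sets are finite (possibly empty). $E\subset v\Lambda$ is exhaustive if for every $\mu\in v\Lambda$ there is $\lambda\in E$ with $\Lambda^{\min}(\lambda,\mu)\neq\emptyset$; $v\mathcal{FE}(\Lambda)$ is the set of finite exhaustive subsets of $v\Lambda$. $x\in W_\Lambda$ is a boundary path if for all $n\in\mathbb N^k$ with $n\le d(x)$ and all $E\in x(n)\mathcal{FE}(\Lambda)$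 there is $m\in\mathbb N^k$ ($n\le m\le d(x)$) with $x(n,m)\in E$. $\partial\Lambda$ is the set of boundary paths. Topology: $\mathcal Z(\mu)=\{x\in W_\Lambda:d(x)\ge d(\mu),x(0,d(\mu))=\mu\}$, and for finite $G\subset s(\mu)\Lambda$, $\mathcal Z(\mu\setminus G)=\mathcal Z(\mu)\setminus\bigcup_{\nu\in G}\mathcal Z(\mu\nu)$; the sets $\mathcal Z(\mu\setminus G)$ form a base for the topology on $W_\Lambda$, and $\partial\Lambda$ carries the relative topology. A Cuntz-Krieger $\Lambda$-family in a $C^*$-algebra is a collection $\{s_\lambda:\lambda\in\Lambda\}$ of partial isometries such that: (CK1) $\{s_v:v\in\Lambda^0\}$ are mutually orthogonal projections; (CK2) $s_\mu s_\nu=s_{\mu\nu}$ whenever $s(\mu)=r(\nu)$; (CK3) $s_\mu^*s_\nu=\sum_{(\alpha,\beta)\in\Lambda^{\min}(\mu,\nu)}s_\alpha s_\beta^*$ for all $\mu,\nu$; (CK4) $\prod_{\mu\in E}(s_v-s_\mu s_\mu^* )=0$ for all $v\in\Lambda^0$ and $E\in v\mathcal{FE}(\Lambda)$. $C^*(\Lambda)$ is the universal $C^*$-algebra generated by a Cuntz-Krieger $\Lambda$-family. $\Delta(D)$ is the spectrum of the commutative $C^*$-algebra $D$ (nonzero homomorphisms $D\to\mathbb C$, topology of pointwise convergence). *)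

theory Defs
  imports
    "HOL-Analysis.Analysis"
    "HOL-Algebra.Module"
    "HOL-Library.Function_Algebras"
    "HOL-Library.Extended_Nat"
begin

section \<open>Degrees\<close>

text \<open>
  A tuple indexed by \<open>{0..<k}\<close> is a function on \<open>nat\<close> vanishing from \<open>k\<close> on. The order, \<open>sup\<close>,
  \<open>+\<close> and \<open>-\<close> on functions are pointwise, so they are the coordinatewise ones.
\<close>

definition tuples :: "nat \<Rightarrow> (nat \<Rightarrow> nat) set" where
  "tuples k = {n. \<forall>i\<ge>k. n i = 0}"

definition etuples :: "nat \<Rightarrow> (nat \<Rightarrow> enat) set" where
  "etuples k = {m. \<forall>i\<ge>k. m i = 0}"

definition emb :: "(nat \<Rightarrow> nat) \<Rightarrow> nat \<Rightarrow> enat" where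
  "emb n = (\<lambda>i. enat (n i))"


section \<open>Higher-rank graphs\<close>

text \<open>
  Categories are presented by their morphisms alone; an object is identified with its identity
  morphism, so \<open>rng\<close> (codomain) and \<open>src\<close> (domain) take values in the identity morphisms.
  The composite \<open>comp \<mu> \<nu>\<close> is meaningful when \<open>src \<mu> = rng \<nu>\<close>.
\<close>

record 'a kgraph =
  paths :: "'a set"
  rng :: "'a \<Rightarrow> 'a"
  src :: "'a \<Rightarrow> 'a"
  comp :: "'a \<Rightarrow> 'a \<Rightarrow> 'a"
  deg :: "'a \<Rightarrow> nat \<Rightarrow> nat"

locale k_graph =
  fixes k :: nat and \<Lambda> :: "'a kgraph"
  assumes countable_paths: "countable (paths \<Lambda>)"
    and rng_closed: "\<xi> \<in> paths \<Lambda> \<Longrightarrow> rng \<Lambda> \<xi> \<in> paths \<Lambda>"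
    and src_closed: "\<xi> \<in> paths \<Lambda> \<Longrightarrow> src \<Lambda> \<xi> \<in> paths \<Lambda>"
    and rng_rng: "\<xi> \<in> paths \<Lambda> \<Longrightarrow> rng \<Lambda> (rng \<Lambda> \<xi>) = rng \<Lambda> \<xi>"
    and src_rng: "\<xi> \<in> paths \<Lambda> \<Longrightarrow> src \<Lambda> (rng \<Lambda> \<xi>) = rng \<Lambda> \<xi>"
    and rng_src: "\<xi> \<in> paths \<Lambda> \<Longrightarrow> rng \<Lambda> (src \<Lambda> \<xi>) = src \<Lambda> \<xi>"
    and src_src: "\<xi> \<in> paths \<Lambda> \<Longrightarrow> src \<Lambda> (src \<Lambda> \<xi>) = src \<Lambda> \<xi>"
    and comp_closed: "\<mu> \<in> paths \<Lambda> \<Longrightarrow> \<nu> \<in> paths \<Lambda> \<Longrightarrow> src \<Lambda> \<mu> = rng \<Lambda> \<nu> \<Longrightarrow>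
          comp \<Lambda> \<mu> \<nu> \<in> paths \<Lambda>"
    and rng_comp: "\<mu> \<in> paths \<Lambda> \<Longrightarrow> \<nu> \<in> paths \<Lambda> \<Longrightarrow> src \<Lambda> \<mu> = rng \<Lambda> \<nu> \<Longrightarrow>
          rng \<Lambda> (comp \<Lambda> \<mu> \<nu>) = rng \<Lambda> \<mu>"
    and src_comp: "\<mu> \<in> paths \<Lambda> \<Longrightarrow> \<nu> \<in> paths \<Lambda> \<Longrightarrow> src \<Lambda> \<mu> = rng \<Lambda> \<nu> \<Longrightarrow>
          src \<Lambda> (comp \<Lambda> \<mu> \<nu>) = src \<Lambda> \<nu>"
    and comp_assoc: "\<xi> \<in> paths \<Lambda> \<Longrightarrow> \<mu> \<in> paths \<Lambda> \<Longrightarrow> \<nu> \<in> paths \<Lambda> \<Longrightarrow>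
          src \<Lambda> \<xi> = rng \<Lambda> \<mu> \<Longrightarrow> src \<Lambda> \<mu> = rng \<Lambda> \<nu> \<Longrightarrow>
          comp \<Lambda> (comp \<Lambda> \<xi> \<mu>) \<nu> = comp \<Lambda> \<xi> (comp \<Lambda> \<mu> \<nu>)"
    and comp_rng: "\<xi> \<in> paths \<Lambda> \<Longrightarrow> comp \<Lambda> (rng \<Lambda> \<xi>) \<xi> = \<xi>"
    and comp_src: "\<xi> \<in> paths \<Lambda> \<Longrightarrow> comp \<Lambda> \<xi> (src \<Lambda> \<xi>) = \<xi>"
    and deg_tuple: "\<xi> \<in> paths \<Lambda> \<Longrightarrow> deg \<Lambda> \<xi> \<in> tuples k"
    and deg_rng: "\<xi> \<in> paths \<Lambda> \<Longrightarrow> deg \<Lambda> (rng \<Lambda> \<xi>) = 0"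
    and deg_comp: "\<mu> \<in> paths \<Lambda> \<Longrightarrow> \<nu> \<in> paths \<Lambda> \<Longrightarrow> src \<Lambda> \<mu> = rng \<Lambda> \<nu> \<Longrightarrow>
          deg \<Lambda> (comp \<Lambda> \<mu> \<nu>) = deg \<Lambda> \<mu> + deg \<Lambda> \<nu>"
    and factorisation: "\<xi> \<in> paths \<Lambda> \<Longrightarrow> m \<in> tuples k \<Longrightarrow> n \<in> tuples k \<Longrightarrow>
          deg \<Lambda> \<xi> = m + n \<Longrightarrow>
          \<exists>!p. fst p \<in> paths \<Lambda> \<and> snd p \<in> paths \<Lambda> \<and> src \<Lambda> (fst p) = rng \<Lambda> (snd p) \<and>
               \<xi> = comp \<Lambda> (fst p) (snd p) \<and> deg \<Lambda> (fst p) = m \<and> deg \<Lambda> (snd p) = n"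

definition vertices :: "'a kgraph \<Rightarrow> 'a set" where
  "vertices \<Lambda> = {v \<in> paths \<Lambda>. deg \<Lambda> v = 0}"

definition paths_from :: "'a kgraph \<Rightarrow> 'a \<Rightarrow> 'a set" where
  "paths_from \<Lambda> v = {\<xi> \<in> paths \<Lambda>. rng \<Lambda> \<xi> = v}"

definition kgraph_morphism :: "'a kgraph \<Rightarrow> 'b kgraph \<Rightarrow> ('a \<Rightarrow> 'b) \<Rightarrow> bool" where
  "kgraph_morphism \<Gamma> \<Lambda> f \<longleftrightarrow>
     (\<forall>\<xi>\<in>paths \<Gamma>. f \<xi> \<in> paths \<Lambda> \<and> rng \<Lambda> (f \<xi>) = f (rng \<Gamma> \<xi>) \<and> src \<Lambda> (f \<xi>) = f (src \<Gamma> \<xi>) \<and>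
        deg \<Lambda> (f \<xi>) = deg \<Gamma> \<xi>) \<and>
     (\<forall>\<mu>\<in>paths \<Gamma>. \<forall>\<nu>\<in>paths \<Gamma>. src \<Gamma> \<mu> = rng \<Gamma> \<nu> \<longrightarrow>
        f (comp \<Gamma> \<mu> \<nu>) = comp \<Lambda> (f \<mu>) (f \<nu>))"

definition min_ext :: "'a kgraph \<Rightarrow> 'a \<Rightarrow> 'a \<Rightarrow> ('a \<times> 'a) set" where
  "min_ext \<Lambda> \<mu> \<nu> = {(\<alpha>, \<beta>). \<alpha> \<in> paths \<Lambda> \<and> \<beta> \<in> paths \<Lambda> \<and>
     src \<Lambda> \<mu> = rng \<Lambda> \<alpha> \<and> src \<Lambda> \<nu> = rng \<Lambda> \<beta> \<and>
     comp \<Lambda> \<mu> \<alpha> = comp \<Lambda> \<nu> \<beta> \<and> deg \<Lambda> (comp \<Lambda> \<mu> \<alpha>) = sup (deg \<Lambda> \<mu>) (deg \<Lambda> \<nu>)}"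

definition finitely_aligned :: "'a kgraph \<Rightarrow> bool" where
  "finitely_aligned \<Lambda> \<longleftrightarrow> (\<forall>\<mu>\<in>paths \<Lambda>. \<forall>\<nu>\<in>paths \<Lambda>. finite (min_ext \<Lambda> \<mu> \<nu>))"

definition exhaustive :: "'a kgraph \<Rightarrow> 'a \<Rightarrow> 'a set \<Rightarrow> bool" where
  "exhaustive \<Lambda> v E \<longleftrightarrow> E \<subseteq> paths_from \<Lambda> v \<and>
     (\<forall>\<mu>\<in>paths_from \<Lambda> v. \<exists>\<xi>\<in>E. min_ext \<Lambda> \<xi> \<mu> \<noteq> {})"

definition finite_exhaustive :: "'a kgraph \<Rightarrow> 'a \<Rightarrow> 'a set set" where
  "finite_exhaustive \<Lambda> v = {E. finite E \<and> exhaustive \<Lambda> v E}"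


section \<open>The path space and its boundary\<close>

text \<open>
  The object \<open>p\<close> of \<open>\<Omega>\<^bsub>k,m\<^esub>\<close> is the identity \<open>(p, p)\<close>. The parameter \<open>k\<close> is not needed: for
  \<open>m \<in> etuples k\<close>, every \<open>q\<close> with \<open>emb q \<le> m\<close> lies in \<open>tuples k\<close>.
\<close>

definition Omega :: "(nat \<Rightarrow> enat) \<Rightarrow> ((nat \<Rightarrow> nat) \<times> (nat \<Rightarrow> nat)) kgraph" where
  "Omega m = \<lparr>paths = {(p, q). p \<le> q \<and> emb q \<le> m},
              rng = (\<lambda>(p, q). (p, p)),
              src = (\<lambda>(p, q). (q, q)),
              comp = (\<lambda>(p, q) (q', t). (p, t)),
              deg = (\<lambda>(p, q). q - p)\<rparr>"

text \<open>
  A morphism \<open>x : \<Omega>\<^bsub>k,m\<^esub> \<rightarrow> \<Lambda>\<close> is stored together with its degree \<open>m\<close>, as a function that is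
  \<open>undefined\<close> off the morphisms of \<open>\<Omega>\<^bsub>k,m\<^esub>\<close>, so that equality is equality of functors.
\<close>

type_synonym 'a gpath = "(nat \<Rightarrow> enat) \<times> ((nat \<Rightarrow> nat) \<times> (nat \<Rightarrow> nat) \<Rightarrow> 'a)"

definition path_space :: "nat \<Rightarrow> 'a kgraph \<Rightarrow> 'a gpath set" where
  "path_space k \<Lambda> = {(m, x). m \<in> etuples k \<and> x \<in> extensional (paths (Omega m)) \<and>
     kgraph_morphism (Omega m) \<Lambda> x}"

abbreviation pdeg :: "'a gpath \<Rightarrow> nat \<Rightarrow> enat" where
  "pdeg x \<equiv> fst x"

definition seg :: "'a gpath \<Rightarrow> (nat \<Rightarrow> nat) \<Rightarrow> (nat \<Rightarrow> nat) \<Rightarrow> 'a" where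
  "seg x p q = snd x (p, q)"

definition prng :: "'a gpath \<Rightarrow> 'a" where
  "prng x = seg x 0 0"

definition prepend :: "nat \<Rightarrow> 'a kgraph \<Rightarrow> 'a \<Rightarrow> 'a gpath \<Rightarrow> 'a gpath" where
  "prepend k \<Lambda> \<xi> x = (THE y. y \<in> path_space k \<Lambda> \<and> pdeg y = emb (deg \<Lambda> \<xi>) + pdeg x \<and>
     seg y 0 (deg \<Lambda> \<xi>) = \<xi> \<and>
     (\<forall>n. emb n \<le> pdeg x \<longrightarrow> seg y (deg \<Lambda> \<xi>) (deg \<Lambda> \<xi> + n) = seg x 0 n))"

definition boundary_paths :: "nat \<Rightarrow> 'a kgraph \<Rightarrow> 'a gpath set" where
  "boundary_paths k \<Lambda> = {x \<in> path_space k \<Lambda>.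
     \<forall>n. emb n \<le> pdeg x \<longrightarrow> (\<forall>E\<in>finite_exhaustive \<Lambda> (seg x n n).
       \<exists>m. n \<le> m \<and> emb m \<le> pdeg x \<and> seg x n m \<in> E)}"

definition cylinder :: "nat \<Rightarrow> 'a kgraph \<Rightarrow> 'a \<Rightarrow> 'a gpath set" where
  "cylinder k \<Lambda> \<mu> = {x \<in> path_space k \<Lambda>. emb (deg \<Lambda> \<mu>) \<le> pdeg x \<and> seg x 0 (deg \<Lambda> \<mu>) = \<mu>}"

definition path_topology :: "nat \<Rightarrow> 'a kgraph \<Rightarrow> 'a gpath topology" where
  "path_topology k \<Lambda> = topology_generated_by
     {cylinder k \<Lambda> \<mu> - (\<Union>\<nu>\<in>G. cylinder k \<Lambda> (comp \<Lambda> \<mu> \<nu>)) | \<mu> G.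
        \<mu> \<in> paths \<Lambda> \<and> finite G \<and> G \<subseteq> paths_from \<Lambda> (src \<Lambda> \<mu>)}"

definition boundary_topology :: "nat \<Rightarrow> 'a kgraph \<Rightarrow> 'a gpath topology" where
  "boundary_topology k \<Lambda> = subtopology (path_topology k \<Lambda>) (boundary_paths k \<Lambda>)"


section \<open>C*-algebras\<close>

definition complex_ring :: "complex ring" where
  "complex_ring = \<lparr>carrier = UNIV, mult = (*), one = 1, zero = 0, add = (+)\<rparr>"

text \<open>
  The field \<open>one\<close> inherited from the record \<open>ring\<close> is not used: C*-algebras need not be unital.
\<close>

record 'b cstar = "(complex, 'b) module" +
  adj :: "'b \<Rightarrow> 'b"
  nrm :: "'b \<Rightarrow> real"

definition cdist :: "'b cstar \<Rightarrow> 'b \<Rightarrow> 'b \<Rightarrow> real" where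
  "cdist A x y = (if x \<in> carrier A \<and> y \<in> carrier A then nrm A (x \<ominus>\<^bsub>A\<^esub> y) else 0)"

locale cstar_algebra =
  fixes A :: "'b cstar" (structure)
  assumes vector_space: "Module.module complex_ring A"
    and mult_closed: "x \<in> carrier A \<Longrightarrow> y \<in> carrier A \<Longrightarrow> x \<otimes> y \<in> carrier A"
    and mult_assoc: "x \<in> carrier A \<Longrightarrow> y \<in> carrier A \<Longrightarrow> z \<in> carrier A \<Longrightarrow>
          (x \<otimes> y) \<otimes> z = x \<otimes> (y \<otimes> z)"
    and mult_add_left: "x \<in> carrier A \<Longrightarrow> y \<in> carrier A \<Longrightarrow> z \<in> carrier A \<Longrightarrow>
          (x \<oplus> y) \<otimes> z = (x \<otimes> z) \<oplus> (y \<otimes> z)"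
    and mult_add_right: "x \<in> carrier A \<Longrightarrow> y \<in> carrier A \<Longrightarrow> z \<in> carrier A \<Longrightarrow>
          x \<otimes> (y \<oplus> z) = (x \<otimes> y) \<oplus> (x \<otimes> z)"
    and smult_mult_left: "x \<in> carrier A \<Longrightarrow> y \<in> carrier A \<Longrightarrow> (c \<odot> x) \<otimes> y = c \<odot> (x \<otimes> y)"
    and smult_mult_right: "x \<in> carrier A \<Longrightarrow> y \<in> carrier A \<Longrightarrow> x \<otimes> (c \<odot> y) = c \<odot> (x \<otimes> y)"
    and adj_closed: "x \<in> carrier A \<Longrightarrow> adj A x \<in> carrier A"
    and adj_adj: "x \<in> carrier A \<Longrightarrow> adj A (adj A x) = x"
    and adj_add: "x \<in> carrier A \<Longrightarrow> y \<in> carrier A \<Longrightarrow> adj A (x \<oplus> y) = adj A x \<oplus> adj A y"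
    and adj_smult: "x \<in> carrier A \<Longrightarrow> adj A (c \<odot> x) = cnj c \<odot> adj A x"
    and adj_mult: "x \<in> carrier A \<Longrightarrow> y \<in> carrier A \<Longrightarrow> adj A (x \<otimes> y) = adj A y \<otimes> adj A x"
    and nrm_nonneg: "x \<in> carrier A \<Longrightarrow> 0 \<le> nrm A x"
    and nrm_eq_0: "x \<in> carrier A \<Longrightarrow> nrm A x = 0 \<longleftrightarrow> x = \<zero>"
    and nrm_triangle: "x \<in> carrier A \<Longrightarrow> y \<in> carrier A \<Longrightarrow> nrm A (x \<oplus> y) \<le> nrm A x + nrm A y"
    and nrm_smult: "x \<in> carrier A \<Longrightarrow> nrm A (c \<odot> x) = cmod c * nrm A x"
    and nrm_mult: "x \<in> carrier A \<Longrightarrow> y \<in> carrier A \<Longrightarrow> nrm A (x \<otimes> y) \<le> nrm A x * nrm A y"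
    and cstar_identity: "x \<in> carrier A \<Longrightarrow> nrm A (adj A x \<otimes> x) = (nrm A x)\<^sup>2"
    and complete: "Metric_space.mcomplete (carrier A) (cdist A)"

abbreviation norm_topology :: "'b cstar \<Rightarrow> 'b topology" where
  "norm_topology A \<equiv> Metric_space.mtopology (carrier A) (cdist A)"

definition star_hom :: "'b cstar \<Rightarrow> 'c cstar \<Rightarrow> ('b \<Rightarrow> 'c) \<Rightarrow> bool" where
  "star_hom A B \<pi> \<longleftrightarrow>
     (\<forall>x\<in>carrier A. \<pi> x \<in> carrier B \<and> \<pi> (adj A x) = adj B (\<pi> x) \<and>
        (\<forall>c. \<pi> (c \<odot>\<^bsub>A\<^esub> x) = c \<odot>\<^bsub>B\<^esub> \<pi> x)) \<and>
     (\<forall>x\<in>carrier A. \<forall>y\<in>carrier A.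
        \<pi> (x \<oplus>\<^bsub>A\<^esub> y) = \<pi> x \<oplus>\<^bsub>B\<^esub> \<pi> y \<and> \<pi> (x \<otimes>\<^bsub>A\<^esub> y) = \<pi> x \<otimes>\<^bsub>B\<^esub> \<pi> y)"

definition subspace_of :: "'b cstar \<Rightarrow> 'b set \<Rightarrow> bool" where
  "subspace_of A V \<longleftrightarrow> V \<subseteq> carrier A \<and> \<zero>\<^bsub>A\<^esub> \<in> V \<and>
     (\<forall>x\<in>V. \<forall>y\<in>V. x \<oplus>\<^bsub>A\<^esub> y \<in> V) \<and> (\<forall>c. \<forall>x\<in>V. c \<odot>\<^bsub>A\<^esub> x \<in> V)"

definition cstar_subalgebra_of :: "'b cstar \<Rightarrow> 'b set \<Rightarrow> bool" where
  "cstar_subalgebra_of A B \<longleftrightarrow> subspace_of A B \<and> (\<forall>x\<in>B. \<forall>y\<in>B. x \<otimes>\<^bsub>A\<^esub> y \<in> B) \<and>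
     (\<forall>x\<in>B. adj A x \<in> B) \<and> closedin (norm_topology A) B"

definition closed_span :: "'b cstar \<Rightarrow> 'b set \<Rightarrow> 'b set" where
  "closed_span A S = norm_topology A closure_of (subspace_of A hull S)"

definition generated_cstar :: "'b cstar \<Rightarrow> 'b set \<Rightarrow> 'b cstar" where
  "generated_cstar A S = A\<lparr>carrier := cstar_subalgebra_of A hull S\<rparr>"

definition spectrum :: "'b cstar \<Rightarrow> ('b \<Rightarrow> complex) set" where
  "spectrum D = {\<phi> \<in> extensional (carrier D).
     (\<forall>x\<in>carrier D. \<forall>y\<in>carrier D.
        \<phi> (x \<oplus>\<^bsub>D\<^esub> y) = \<phi> x + \<phi> y \<and> \<phi> (x \<otimes>\<^bsub>D\<^esub> y) = \<phi> x * \<phi> y) \<and>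
     (\<forall>c. \<forall>x\<in>carrier D. \<phi> (c \<odot>\<^bsub>D\<^esub> x) = c * \<phi> x) \<and>
     (\<exists>x\<in>carrier D. \<phi> x \<noteq> 0)}"

definition spectrum_topology :: "'b cstar \<Rightarrow> ('b \<Rightarrow> complex) topology" where
  "spectrum_topology D = subtopology (product_topology (\<lambda>_. euclidean) (carrier D)) (spectrum D)"


section \<open>Cuntz-Krieger families\<close>

text \<open>
  In (CK4) the product over \<open>E\<close> is taken along an arbitrary enumeration \<open>Es\<close> of \<open>E\<close> and is followed
  by a factor \<open>s v\<close>, which is a unit for each \<open>s v - s \<mu> (s \<mu>)\<^sup>*\<close>; this avoids a unit of \<open>A\<close>.
\<close>

locale ck_family = cstar_algebra A for A :: "'b cstar" (structure) +
  fixes \<Lambda> :: "'a kgraph" and s :: "'a \<Rightarrow> 'b"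
  assumes in_carrier: "\<xi> \<in> paths \<Lambda> \<Longrightarrow> s \<xi> \<in> carrier A"
    and partial_isometry: "\<xi> \<in> paths \<Lambda> \<Longrightarrow> s \<xi> \<otimes> adj A (s \<xi>) \<otimes> s \<xi> = s \<xi>"
    and CK1_projection: "v \<in> vertices \<Lambda> \<Longrightarrow> s v \<otimes> s v = s v \<and> adj A (s v) = s v"
    and CK1_orthogonal: "v \<in> vertices \<Lambda> \<Longrightarrow> w \<in> vertices \<Lambda> \<Longrightarrow> v \<noteq> w \<Longrightarrow> s v \<otimes> s w = \<zero>"
    and CK2: "\<mu> \<in> paths \<Lambda> \<Longrightarrow> \<nu> \<in> paths \<Lambda> \<Longrightarrow> src \<Lambda> \<mu> = rng \<Lambda> \<nu> \<Longrightarrow>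
          s \<mu> \<otimes> s \<nu> = s (comp \<Lambda> \<mu> \<nu>)"
    and CK3: "\<mu> \<in> paths \<Lambda> \<Longrightarrow> \<nu> \<in> paths \<Lambda> \<Longrightarrow>
          adj A (s \<mu>) \<otimes> s \<nu> = (\<Oplus>p\<in>min_ext \<Lambda> \<mu> \<nu>. s (fst p) \<otimes> adj A (s (snd p)))"
    and CK4: "v \<in> vertices \<Lambda> \<Longrightarrow> E \<in> finite_exhaustive \<Lambda> v \<Longrightarrow> distinct Es \<Longrightarrow> set Es = E \<Longrightarrow>
          foldr (\<lambda>\<mu> a. (s v \<ominus> s \<mu> \<otimes> adj A (s \<mu>)) \<otimes> a) Es (s v) = \<zero>"

text \<open>
  HOL cannot quantify over all types inside a formula, so the targets \<open>B\<close> of the universal property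
  are the C*-algebras whose elements lie in one fixed type. This loses nothing: as \<open>\<Lambda>\<close> is countable,
  a C*-algebra generated by a Cuntz-Krieger family is separable, hence has at most continuum many
  elements and is isomorphic to a C*-algebra carried by a subset of \<open>universe\<close>.
\<close>

type_synonym universe = "(nat \<Rightarrow> complex) \<Rightarrow> (nat \<Rightarrow> complex)"

definition universal_ck_family :: "'b cstar \<Rightarrow> 'a kgraph \<Rightarrow> ('a \<Rightarrow> 'b) \<Rightarrow> bool" where
  "universal_ck_family A \<Lambda> s \<longleftrightarrow> ck_family A \<Lambda> s \<and>
     carrier (generated_cstar A (s ` paths \<Lambda>)) = carrier A \<and>
     (\<forall>(B :: universe cstar) t. ck_family B \<Lambda> t \<longrightarrow>
        (\<exists>\<pi>. star_hom A B \<pi> \<and> (\<forall>\<xi>\<in>paths \<Lambda>. \<pi> (s \<xi>) = t \<xi>)))"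

definition range_projections :: "'b cstar \<Rightarrow> 'a kgraph \<Rightarrow> ('a \<Rightarrow> 'b) \<Rightarrow> 'b set" where
  "range_projections A \<Lambda> s = {s \<mu> \<otimes>\<^bsub>A\<^esub> adj A (s \<mu>) | \<mu>. \<mu> \<in> paths \<Lambda>}"

definition diagonal :: "'b cstar \<Rightarrow> 'a kgraph \<Rightarrow> ('a \<Rightarrow> 'b) \<Rightarrow> 'b cstar" where
  "diagonal A \<Lambda> s = generated_cstar A (range_projections A \<Lambda> s)"

definition is_path_character ::
  "nat \<Rightarrow> 'a kgraph \<Rightarrow> 'b cstar \<Rightarrow> ('a \<Rightarrow> 'b) \<Rightarrow> 'a gpath \<Rightarrow> ('b \<Rightarrow> complex) \<Rightarrow> bool" where
  "is_path_character k \<Lambda> A s x \<phi> \<longleftrightarrow> \<phi> \<in> spectrum (diagonal A \<Lambda> s) \<and>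
     (\<forall>\<mu>\<in>paths \<Lambda>. \<phi> (s \<mu> \<otimes>\<^bsub>A\<^esub> adj A (s \<mu>)) =
        (if \<exists>\<mu>'\<in>path_space k \<Lambda>. prng \<mu>' = src \<Lambda> \<mu> \<and> x = prepend k \<Lambda> \<mu> \<mu>' then 1 else 0))"

end

theory Submission
  imports Defs
begin

text \<open>
  An infinite path is determined by the set of its finite initial segments, a filter for the prefix
  order; boundary paths correspond to the filters that meet every finite exhaustive set. A character
  \<open>\<phi>\<close> of the diagonal is contractive, hence determined by the set of \<open>\<mu>\<close> with \<open>\<phi> (s \<mu> (s \<mu>)\<^sup>*) = 1\<close>.
  By (CK3) this set is a filter, and by (CK4) it is a boundary filter.

  Conversely, given a boundary path \<open>x\<close>, the paths act by prepending on \<open>\<ell>\<^sup>2\<close> of the countable orbit of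
  \<open>x\<close> under the shifts. This is a Cuntz-Krieger family, and the universal property yields a
  representation \<open>\<pi>\<close> of the C*-algebra. It is contractive, so \<open>\<pi> a\<close> has the basis vector at \<open>x\<close> as
  an eigenvector for every \<open>a\<close> in the diagonal; the eigenvalue is the required character.
\<close>

section \<open>Prefixes and filters of finite paths\<close>

text \<open>The obstacle is the existence of h(x). Prescribing values on the range projections
  leaves open whether they extend: (CK3) and (CK4) impose relations among the projections, and the
  norm on their span is known only through the universal property. A matrix coefficient of a
  representation is linear and bounded from the start. The universal property tests only algebras
  carried by \<open>universe\<close>, so the operators on one separable Hilbert space are coded into
  that type. This is why the orbit has to be countable; it is closed under prepending as well as
  shifting, the moves by which the generators and their adjoints act. The norm bounds rest on two
  fixed-point equations written without a unit: b = a + a b bounds characters, and 2 b = a^* a + b^2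
  bounds representations. Continuity is checked directly in both directions: cylinders are open and
  closed, and a character takes only the values 0 and 1 on range projections, so both values are
  open conditions.\<close>

context k_graph
begin

abbreviation cmp :: "'a \<Rightarrow> 'a \<Rightarrow> 'a" (infixl \<open>\<cdot>\<close> 75) where
  "\<mu> \<cdot> \<nu> \<equiv> comp \<Lambda> \<mu> \<nu>"

section \<open>The prefix order and unique factorisation\<close>

definition prefix :: "'a \<Rightarrow> 'a \<Rightarrow> bool" where
  "prefix \<mu> \<xi> \<longleftrightarrow> \<mu> \<in> paths \<Lambda> \<and> (\<exists>\<alpha>\<in>paths \<Lambda>. src \<Lambda> \<mu> = rng \<Lambda> \<alpha> \<and> \<xi> = \<mu> \<cdot> \<alpha>)"

lemma prefixI: "\<mu> \<in> paths \<Lambda> \<Longrightarrow> \<alpha> \<in> paths \<Lambda> \<Longrightarrow> src \<Lambda> \<mu> = rng \<Lambda> \<alpha> \<Longrightarrow> prefix \<mu> (\<mu> \<cdot> \<alpha>)"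
  unfolding prefix_def by blast

lemma prefix_in_paths: "prefix \<mu> \<xi> \<Longrightarrow> \<mu> \<in> paths \<Lambda>" "prefix \<mu> \<xi> \<Longrightarrow> \<xi> \<in> paths \<Lambda>"
  unfolding prefix_def using comp_closed by auto

lemma prefix_rng: "prefix \<mu> \<xi> \<Longrightarrow> rng \<Lambda> \<mu> = rng \<Lambda> \<xi>"
  unfolding prefix_def using rng_comp by auto

lemma prefix_refl: "\<mu> \<in> paths \<Lambda> \<Longrightarrow> prefix \<mu> \<mu>"
  unfolding prefix_def using comp_src src_closed rng_src by metis

lemma prefix_trans:
  assumes "prefix \<mu> \<nu>" "prefix \<nu> \<xi>"
  shows "prefix \<mu> \<xi>"
  using assms unfolding prefix_def
  by (metis comp_assoc comp_closed rng_comp src_comp)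

lemma deg_prefix: "prefix \<mu> \<xi> \<Longrightarrow> deg \<Lambda> \<mu> \<le> deg \<Lambda> \<xi>"
  unfolding prefix_def using deg_comp by (auto simp: le_fun_def)

text \<open>Equal total degree and equal first degree force equal second degree, so both pairs are
  the factorisation of one path at one pair of degrees.\<close>

lemma comp_eq_imp:
  assumes "\<mu> \<in> paths \<Lambda>" "\<nu> \<in> paths \<Lambda>" "\<alpha> \<in> paths \<Lambda>" "\<beta> \<in> paths \<Lambda>"
    "src \<Lambda> \<mu> = rng \<Lambda> \<alpha>" "src \<Lambda> \<nu> = rng \<Lambda> \<beta>" "\<mu> \<cdot> \<alpha> = \<nu> \<cdot> \<beta>" "deg \<Lambda> \<mu> = deg \<Lambda> \<nu>"
  shows "\<mu> = \<nu>" "\<alpha> = \<beta>"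
proof -
  have d: "deg \<Lambda> \<mu> + deg \<Lambda> \<alpha> = deg \<Lambda> \<nu> + deg \<Lambda> \<beta>"
    using assms deg_comp by metis
  have "deg \<Lambda> \<alpha> = deg \<Lambda> \<beta>"
    using d assms(8) by (metis add_left_imp_eq)
  moreover have "\<exists>!p. fst p \<in> paths \<Lambda> \<and> snd p \<in> paths \<Lambda> \<and> src \<Lambda> (fst p) = rng \<Lambda> (snd p) \<and>
      \<mu> \<cdot> \<alpha> = fst p \<cdot> snd p \<and> deg \<Lambda> (fst p) = deg \<Lambda> \<mu> \<and> deg \<Lambda> (snd p) = deg \<Lambda> \<alpha>"
    by (rule factorisation) (use assms(1-6) deg_tuple deg_comp comp_closed in blast)+
  ultimately have "(\<mu>, \<alpha>) = (\<nu>, \<beta>)"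
    using assms by (metis fst_conv snd_conv)
  then show "\<mu> = \<nu>" "\<alpha> = \<beta>" by auto
qed

lemma comp_cancel:
  assumes "\<mu> \<in> paths \<Lambda>" "\<alpha> \<in> paths \<Lambda>" "\<beta> \<in> paths \<Lambda>"
    "src \<Lambda> \<mu> = rng \<Lambda> \<alpha>" "src \<Lambda> \<mu> = rng \<Lambda> \<beta>" "\<mu> \<cdot> \<alpha> = \<mu> \<cdot> \<beta>"
  shows "\<alpha> = \<beta>"
  using comp_eq_imp assms by metis

lemma prefix_unique:
  assumes "prefix \<mu> \<xi>" "prefix \<nu> \<xi>" "deg \<Lambda> \<mu> = deg \<Lambda> \<nu>"
  shows "\<mu> = \<nu>"
  using assms unfolding prefix_def using comp_eq_imp(1) by metis

lemma le_tuple: "n \<in> tuples k \<Longrightarrow> m \<le> n \<Longrightarrow> m \<in> tuples k" for m n :: "nat \<Rightarrow> nat"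
  unfolding tuples_def le_fun_def by (auto intro: antisym) (metis le_zero_eq)

lemma ex_prefix_deg:
  assumes "\<xi> \<in> paths \<Lambda>" "m \<le> deg \<Lambda> \<xi>"
  obtains \<mu> where "prefix \<mu> \<xi>" "deg \<Lambda> \<mu> = m"
proof -
  let ?n = "deg \<Lambda> \<xi> - m"
  have "deg \<Lambda> \<xi> = m + ?n" using assms(2) by (auto simp: le_fun_def fun_eq_iff)
  moreover have "m \<in> tuples k" "?n \<in> tuples k"
    using le_tuple[OF deg_tuple[OF assms(1)]] assms(2) by (auto simp: le_fun_def)
  ultimately show ?thesis
    using factorisation[OF assms(1)] that unfolding prefix_def by (metis (no_types, lifting))
qed

text \<open>Cut \<nu> at the degree of \<mu>: the result is a prefix of \<xi> with the degree of
  \<mu>, hence is \<mu>. Among prefixes of one path, the prefix order is therefore read off from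
  degrees.\<close>

lemma prefix_le:
  assumes "prefix \<mu> \<xi>" "prefix \<nu> \<xi>" "deg \<Lambda> \<mu> \<le> deg \<Lambda> \<nu>"
  shows "prefix \<mu> \<nu>"
proof -
  obtain \<mu>' where "prefix \<mu>' \<nu>" "deg \<Lambda> \<mu>' = deg \<Lambda> \<mu>"
    using ex_prefix_deg assms prefix_in_paths by metis
  then show ?thesis using prefix_trans prefix_unique assms by metis
qed

lemma prefix_comp_cancel:
  assumes "\<mu> \<in> paths \<Lambda>" "\<alpha> \<in> paths \<Lambda>" "\<beta> \<in> paths \<Lambda>"
    "src \<Lambda> \<mu> = rng \<Lambda> \<alpha>" "src \<Lambda> \<mu> = rng \<Lambda> \<beta>" "prefix (\<mu> \<cdot> \<alpha>) (\<mu> \<cdot> \<beta>)"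
  shows "prefix \<alpha> \<beta>"
proof -
  obtain \<gamma> where g: "\<gamma> \<in> paths \<Lambda>" "src \<Lambda> (\<mu> \<cdot> \<alpha>) = rng \<Lambda> \<gamma>" "\<mu> \<cdot> \<beta> = \<mu> \<cdot> \<alpha> \<cdot> \<gamma>"
    using assms(6) unfolding prefix_def by blast
  have s: "src \<Lambda> \<alpha> = rng \<Lambda> \<gamma>" using g(2) assms src_comp by metis
  then have "\<mu> \<cdot> \<beta> = \<mu> \<cdot> (\<alpha> \<cdot> \<gamma>)" using g comp_assoc assms by metis
  then have "\<beta> = \<alpha> \<cdot> \<gamma>" using comp_cancel assms g s comp_closed rng_comp by metis
  then show ?thesis using prefixI assms g s by metis
qed

lemma prefix_comp_mono:
  assumes "\<mu> \<in> paths \<Lambda>" "prefix \<alpha> \<beta>" "src \<Lambda> \<mu> = rng \<Lambda> \<alpha>"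
  shows "prefix (\<mu> \<cdot> \<alpha>) (\<mu> \<cdot> \<beta>)"
  using assms unfolding prefix_def by (metis comp_assoc comp_closed src_comp)

lemma deg_src: "\<xi> \<in> paths \<Lambda> \<Longrightarrow> deg \<Lambda> (src \<Lambda> \<xi>) = 0"
  by (metis deg_rng rng_src src_closed)

lemma src_vertex: "\<xi> \<in> paths \<Lambda> \<Longrightarrow> src \<Lambda> \<xi> \<in> vertices \<Lambda>"
  unfolding vertices_def using src_closed deg_src by auto

text \<open>\<open>vertices\<close> is defined by degree 0, whereas the category axioms speak of
  identities. The two trivial factorisations of v, by its source and by its range, have the same
  degrees and hence coincide.\<close>

lemma vertex_rng_src:
  assumes "v \<in> vertices \<Lambda>"
  shows "v \<in> paths \<Lambda>" "rng \<Lambda> v = v" "src \<Lambda> v = v"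
proof -
  show p: "v \<in> paths \<Lambda>" using assms unfolding vertices_def by auto
  have "v \<cdot> src \<Lambda> v = rng \<Lambda> v \<cdot> v" using p comp_rng comp_src by auto
  moreover have "deg \<Lambda> v = deg \<Lambda> (rng \<Lambda> v)" using assms deg_rng p unfolding vertices_def by auto
  ultimately show "rng \<Lambda> v = v" "src \<Lambda> v = v"
    using comp_eq_imp[of v "rng \<Lambda> v" "src \<Lambda> v" v] p rng_closed src_closed rng_src src_rng
    by metis+
qed

lemma prefix_rng_self: "\<xi> \<in> paths \<Lambda> \<Longrightarrow> prefix (rng \<Lambda> \<xi>) \<xi>"
  unfolding prefix_def using comp_rng rng_closed src_rng by metis

section \<open>Minimal common extensions\<close>

lemma sup_le_deg:
  assumes "prefix \<mu> \<xi>" "prefix \<nu> \<xi>"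
  shows "sup (deg \<Lambda> \<mu>) (deg \<Lambda> \<nu>) \<le> deg \<Lambda> \<xi>"
  using assms deg_prefix by (simp add: le_supI)

text \<open>Cut \<xi> at the coordinatewise maximum of the two degrees; both paths are prefixes of
  the result, and the two remainders form the minimal extension.\<close>

lemma ex_common_prefix:
  assumes "prefix \<mu> \<xi>" "prefix \<nu> \<xi>"
  obtains \<alpha> \<beta> where "(\<alpha>, \<beta>) \<in> min_ext \<Lambda> \<mu> \<nu>" "prefix (\<mu> \<cdot> \<alpha>) \<xi>"
proof -
  obtain \<kappa> where k: "prefix \<kappa> \<xi>" "deg \<Lambda> \<kappa> = sup (deg \<Lambda> \<mu>) (deg \<Lambda> \<nu>)"
    using ex_prefix_deg sup_le_deg[OF assms] assms prefix_in_paths by metis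
  have "prefix \<mu> \<kappa>" "prefix \<nu> \<kappa>"
    using prefix_le k assms by (metis sup_ge1, metis prefix_le k assms sup_ge2)
  then obtain \<alpha> \<beta> where "\<alpha> \<in> paths \<Lambda>" "src \<Lambda> \<mu> = rng \<Lambda> \<alpha>" "\<kappa> = \<mu> \<cdot> \<alpha>"
      "\<beta> \<in> paths \<Lambda>" "src \<Lambda> \<nu> = rng \<Lambda> \<beta>" "\<kappa> = \<nu> \<cdot> \<beta>"
    unfolding prefix_def by auto
  then show ?thesis using that[of \<alpha> \<beta>] k unfolding min_ext_def by auto
qed

lemma min_ext_prefix:
  assumes "(\<alpha>, \<beta>) \<in> min_ext \<Lambda> \<mu> \<nu>" "\<mu> \<in> paths \<Lambda>" "\<nu> \<in> paths \<Lambda>"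
  shows "prefix \<mu> (\<mu> \<cdot> \<alpha>)" "prefix \<nu> (\<mu> \<cdot> \<alpha>)"
  using assms unfolding min_ext_def prefix_def by auto

lemma min_ext_nonempty_iff:
  assumes "\<mu> \<in> paths \<Lambda>" "\<nu> \<in> paths \<Lambda>"
  shows "min_ext \<Lambda> \<mu> \<nu> \<noteq> {} \<longleftrightarrow> (\<exists>\<xi>. prefix \<mu> \<xi> \<and> prefix \<nu> \<xi>)"
  using ex_common_prefix min_ext_prefix[OF _ assms] by (metis all_not_in_conv surj_pair)

text \<open>Turns (CK3) at equal indices into the formula for s_mu^* s_mu. A remainder of degree 0
  is a vertex, hence the source.\<close>

lemma min_ext_self:
  assumes "\<mu> \<in> paths \<Lambda>"
  shows "min_ext \<Lambda> \<mu> \<mu> = {(src \<Lambda> \<mu>, src \<Lambda> \<mu>)}"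
proof
  show "{(src \<Lambda> \<mu>, src \<Lambda> \<mu>)} \<subseteq> min_ext \<Lambda> \<mu> \<mu>"
    unfolding min_ext_def using assms src_closed rng_src comp_src by auto
  show "min_ext \<Lambda> \<mu> \<mu> \<subseteq> {(src \<Lambda> \<mu>, src \<Lambda> \<mu>)}"
  proof clarify
    fix \<alpha> \<beta> assume m: "(\<alpha>, \<beta>) \<in> min_ext \<Lambda> \<mu> \<mu>"
    then have a: "\<alpha> \<in> paths \<Lambda>" "\<beta> \<in> paths \<Lambda>" "src \<Lambda> \<mu> = rng \<Lambda> \<alpha>" "src \<Lambda> \<mu> = rng \<Lambda> \<beta>"
      "\<mu> \<cdot> \<alpha> = \<mu> \<cdot> \<beta>" "deg \<Lambda> (\<mu> \<cdot> \<alpha>) = deg \<Lambda> \<mu>"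
      unfolding min_ext_def by auto
    then have "deg \<Lambda> \<mu> + deg \<Lambda> \<alpha> = deg \<Lambda> \<mu>" using deg_comp assms by metis
    then have "\<alpha> \<in> vertices \<Lambda>" unfolding vertices_def using a(1)
      by (simp add: fun_eq_iff)
    then have "\<alpha> = src \<Lambda> \<mu>" using a(3) vertex_rng_src by metis
    then show "\<alpha> = src \<Lambda> \<mu> \<and> \<beta> = src \<Lambda> \<mu>" using comp_cancel a assms by metis
  qed
qed

section \<open>Filters, shifts, prepending and the boundary condition\<close>

definition path_filter :: "'a set \<Rightarrow> bool" where
  "path_filter S \<longleftrightarrow> S \<subseteq> paths \<Lambda> \<and> S \<noteq> {} \<and> (\<forall>\<mu> \<xi>. prefix \<mu> \<xi> \<longrightarrow> \<xi> \<in> S \<longrightarrow> \<mu> \<in> S) \<and>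
     (\<forall>\<mu>\<in>S. \<forall>\<nu>\<in>S. \<exists>\<xi>\<in>S. prefix \<mu> \<xi> \<and> prefix \<nu> \<xi>)"

definition boundary_filter :: "'a set \<Rightarrow> bool" where
  "boundary_filter S \<longleftrightarrow> path_filter S \<and>
     (\<forall>\<xi>\<in>S. \<forall>E\<in>finite_exhaustive \<Lambda> (src \<Lambda> \<xi>). \<exists>\<nu>\<in>E. \<xi> \<cdot> \<nu> \<in> S)"

text \<open>If S consists of the initial segments of a path x beginning with \<xi>, these are the
  initial segments of the rest of x after \<xi>.\<close>

definition shift_filter :: "'a \<Rightarrow> 'a set \<Rightarrow> 'a set" where
  "shift_filter \<xi> S = {\<alpha> \<in> paths \<Lambda>. src \<Lambda> \<xi> = rng \<Lambda> \<alpha> \<and> \<xi> \<cdot> \<alpha> \<in> S}"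

text \<open>The initial segments of \<xi> followed by the path of S. The products \<xi> \<cdot>
  \<alpha> omit segments such as the proper prefixes of \<xi>, so the set is closed under
  prefixes.\<close>

definition prepend_filter :: "'a \<Rightarrow> 'a set \<Rightarrow> 'a set" where
  "prepend_filter \<xi> S = {\<mu>. \<exists>\<alpha>\<in>S. src \<Lambda> \<xi> = rng \<Lambda> \<alpha> \<and> prefix \<mu> (\<xi> \<cdot> \<alpha>)}"

lemma path_filterD:
  assumes "path_filter S"
  shows "\<mu> \<in> S \<Longrightarrow> \<mu> \<in> paths \<Lambda>" "prefix \<mu> \<xi> \<Longrightarrow> \<xi> \<in> S \<Longrightarrow> \<mu> \<in> S"
    "\<mu> \<in> S \<Longrightarrow> \<nu> \<in> S \<Longrightarrow> \<exists>\<xi>\<in>S. prefix \<mu> \<xi> \<and> prefix \<nu> \<xi>"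
  using assms unfolding path_filter_def by blast+

lemma filter_deg_unique:
  assumes "path_filter S" "\<mu> \<in> S" "\<nu> \<in> S" "deg \<Lambda> \<mu> = deg \<Lambda> \<nu>"
  shows "\<mu> = \<nu>"
  using path_filterD(3)[OF assms(1-3)] assms(4) prefix_unique by blast

lemma filter_rng_unique:
  assumes "path_filter S" "\<mu> \<in> S" "\<nu> \<in> S"
  shows "rng \<Lambda> \<mu> = rng \<Lambda> \<nu>"
  using path_filterD(3)[OF assms] prefix_rng by metis

lemma filter_rng_in: "path_filter S \<Longrightarrow> \<mu> \<in> S \<Longrightarrow> rng \<Lambda> \<mu> \<in> S"
  using path_filterD prefix_rng_self by metis

text \<open>The range of a member is again in the filter, and all members share their range, so a
  filter contains a single vertex.\<close>

lemma filter_mem_vertex_iff: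
  assumes "path_filter S" "\<mu> \<in> S" "v \<in> vertices \<Lambda>"
  shows "v \<in> S \<longleftrightarrow> rng \<Lambda> \<mu> = v"
  using filter_rng_unique[OF assms(1)] filter_rng_in[OF assms(1,2)] vertex_rng_src[OF assms(3)] assms(2) by metis

text \<open>Directedness gives a common extension and with it a minimal one. Two minimal ones in S
  have the same degree, so they coincide, and cancellation identifies the pairs. On a single path,
  (CK3) thus has one surviving term.\<close>

lemma filter_min_ext:
  assumes "path_filter S" "\<mu> \<in> S" "\<nu> \<in> S"
  shows "\<exists>!p. p \<in> min_ext \<Lambda> \<mu> \<nu> \<and> \<mu> \<cdot> fst p \<in> S"
proof -
  obtain \<xi> where x: "\<xi> \<in> S" "prefix \<mu> \<xi>" "prefix \<nu> \<xi>" using path_filterD(3)[OF assms] by blast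
  obtain \<alpha> \<beta> where ab: "(\<alpha>, \<beta>) \<in> min_ext \<Lambda> \<mu> \<nu>" "prefix (\<mu> \<cdot> \<alpha>) \<xi>"
    using ex_common_prefix x by metis
  show ?thesis
  proof (rule ex1I)
    show "(\<alpha>, \<beta>) \<in> min_ext \<Lambda> \<mu> \<nu> \<and> \<mu> \<cdot> fst (\<alpha>, \<beta>) \<in> S"
      using ab x path_filterD(2)[OF assms(1)] by auto
    fix p assume p: "p \<in> min_ext \<Lambda> \<mu> \<nu> \<and> \<mu> \<cdot> fst p \<in> S"
    obtain \<gamma> \<delta> where q: "p = (\<gamma>, \<delta>)" by fastforce
    have "\<mu> \<cdot> \<gamma> = \<mu> \<cdot> \<alpha>"
    proof (rule filter_deg_unique[OF assms(1)])
      show "\<mu> \<cdot> \<gamma> \<in> S" "\<mu> \<cdot> \<alpha> \<in> S" using p q ab x path_filterD(2)[OF assms(1)] by auto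
      show "deg \<Lambda> (\<mu> \<cdot> \<gamma>) = deg \<Lambda> (\<mu> \<cdot> \<alpha>)" using p q ab unfolding min_ext_def by auto
    qed
    then show "p = (\<alpha>, \<beta>)"
      using p q ab assms path_filterD(1)[OF assms(1)] comp_cancel[of \<mu> \<gamma> \<alpha>] comp_cancel[of \<nu> \<delta> \<beta>]
      unfolding min_ext_def by auto
  qed
qed

lemma shift_path_filter:
  assumes S: "path_filter S" and x: "\<xi> \<in> S"
  shows "path_filter (shift_filter \<xi> S)"
proof -
  note D = path_filterD[OF S]
  have xp: "\<xi> \<in> paths \<Lambda>" using D x by auto
  have "src \<Lambda> \<xi> \<in> shift_filter \<xi> S"
    unfolding shift_filter_def using xp x src_closed rng_src comp_src by auto
  moreover have "\<mu> \<in> shift_filter \<xi> S" if "prefix \<mu> \<alpha>" "\<alpha> \<in> shift_filter \<xi> S" for \<mu> \<alpha>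
    using that D(2) prefix_comp_mono[OF xp that(1)] prefix_rng[OF that(1)] prefix_in_paths
    unfolding shift_filter_def by auto
  moreover have "\<exists>\<gamma>\<in>shift_filter \<xi> S. prefix \<alpha> \<gamma> \<and> prefix \<beta> \<gamma>"
    if "\<alpha> \<in> shift_filter \<xi> S" "\<beta> \<in> shift_filter \<xi> S" for \<alpha> \<beta>
  proof -
    have ab: "\<alpha> \<in> paths \<Lambda>" "src \<Lambda> \<xi> = rng \<Lambda> \<alpha>" "\<xi> \<cdot> \<alpha> \<in> S"
      "\<beta> \<in> paths \<Lambda>" "src \<Lambda> \<xi> = rng \<Lambda> \<beta>" "\<xi> \<cdot> \<beta> \<in> S"
      using that unfolding shift_filter_def by auto
    obtain \<kappa> where k: "\<kappa> \<in> S" "prefix (\<xi> \<cdot> \<alpha>) \<kappa>" "prefix (\<xi> \<cdot> \<beta>) \<kappa>"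
      using D(3) ab by blast
    \<comment> \<open>As \<kappa> starts with \<xi>, the common extension found in S can be shifted
      back by cancelling \<xi>.\<close>
    have "prefix \<xi> \<kappa>" using prefix_trans prefixI k ab xp by metis
    then obtain \<gamma> where g: "\<gamma> \<in> paths \<Lambda>" "src \<Lambda> \<xi> = rng \<Lambda> \<gamma>" "\<kappa> = \<xi> \<cdot> \<gamma>"
      unfolding prefix_def by auto
    then have "prefix \<alpha> \<gamma>" "prefix \<beta> \<gamma>" using prefix_comp_cancel k ab xp by metis+
    then show ?thesis using g k unfolding shift_filter_def by auto
  qed
  ultimately show ?thesis unfolding path_filter_def shift_filter_def by blast
qed

text \<open>The sources of \<mu> and \<xi> \<cdot> \<mu> agree, so an exhaustive set at the source
  of \<mu> can be tested in S at \<xi> \<cdot> \<mu>.\<close>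

lemma shift_boundary_filter:
  assumes S: "boundary_filter S" and x: "\<xi> \<in> S"
  shows "boundary_filter (shift_filter \<xi> S)"
proof -
  have pf: "path_filter S" using S unfolding boundary_filter_def by auto
  have "\<exists>\<nu>\<in>E. \<mu> \<cdot> \<nu> \<in> shift_filter \<xi> S"
    if "\<mu> \<in> shift_filter \<xi> S" "E \<in> finite_exhaustive \<Lambda> (src \<Lambda> \<mu>)" for \<mu> E
  proof -
    note E = that(2)
    have m: "\<mu> \<in> paths \<Lambda>" "src \<Lambda> \<xi> = rng \<Lambda> \<mu>" "\<xi> \<cdot> \<mu> \<in> S" "\<xi> \<in> paths \<Lambda>"
      using that(1) path_filterD(1)[OF pf x] unfolding shift_filter_def by auto
    then have "src \<Lambda> (\<xi> \<cdot> \<mu>) = src \<Lambda> \<mu>" using src_comp by auto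
    then obtain \<nu> where n: "\<nu> \<in> E" "\<xi> \<cdot> \<mu> \<cdot> \<nu> \<in> S"
      using S E m(3) unfolding boundary_filter_def by metis
    then have np: "\<nu> \<in> paths \<Lambda>" "rng \<Lambda> \<nu> = src \<Lambda> \<mu>"
      using E unfolding finite_exhaustive_def exhaustive_def paths_from_def by auto
    then have "\<mu> \<cdot> \<nu> \<in> shift_filter \<xi> S"
      using n m comp_assoc[of \<xi> \<mu> \<nu>] comp_closed rng_comp unfolding shift_filter_def by auto
    then show ?thesis using n(1) by blast
  qed
  then show ?thesis
    using shift_path_filter[OF pf x] unfolding boundary_filter_def by blast
qed

lemma prepend_path_filter:
  assumes S: "path_filter S" and x: "\<xi> \<in> paths \<Lambda>" "src \<Lambda> \<xi> \<in> S"
  shows "path_filter (prepend_filter \<xi> S)" "\<xi> \<in> prepend_filter \<xi> S"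
proof -
  note D = path_filterD[OF S]
  have r: "rng \<Lambda> \<alpha> = src \<Lambda> \<xi>" if "\<alpha> \<in> S" for \<alpha>
    using filter_rng_unique[OF S that x(2)] rng_src x by auto
  show xx: "\<xi> \<in> prepend_filter \<xi> S"
    unfolding prepend_filter_def using x rng_src comp_src prefix_refl by force
  moreover have "\<exists>\<gamma>\<in>prepend_filter \<xi> S. prefix \<mu> \<gamma> \<and> prefix \<nu> \<gamma>"
    if mn: "\<mu> \<in> prepend_filter \<xi> S" "\<nu> \<in> prepend_filter \<xi> S" for \<mu> \<nu>
  proof -
    obtain \<alpha> \<beta> where ab: "\<alpha> \<in> S" "\<beta> \<in> S" "prefix \<mu> (\<xi> \<cdot> \<alpha>)" "prefix \<nu> (\<xi> \<cdot> \<beta>)"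
      using mn unfolding prepend_filter_def by blast
    obtain \<gamma> where g: "\<gamma> \<in> S" "prefix \<alpha> \<gamma>" "prefix \<beta> \<gamma>" using D(3) ab by blast
    then have "prefix \<mu> (\<xi> \<cdot> \<gamma>)" "prefix \<nu> (\<xi> \<cdot> \<gamma>)"
      using ab prefix_comp_mono[OF x(1)] r prefix_trans by metis+
    moreover have "\<xi> \<cdot> \<gamma> \<in> prepend_filter \<xi> S"
      using g(1) r[OF g(1)] prefix_refl prefix_in_paths(2)[OF \<open>prefix \<mu> (\<xi> \<cdot> \<gamma>)\<close>]
      unfolding prepend_filter_def by (auto intro!: bexI[of _ \<gamma>])
    ultimately show ?thesis using \<open>prefix \<mu> (\<xi> \<cdot> \<gamma>)\<close> \<open>prefix \<nu> (\<xi> \<cdot> \<gamma>)\<close> by blast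
  qed
  ultimately show "path_filter (prepend_filter \<xi> S)"
    unfolding path_filter_def
    using prefix_in_paths(1) prefix_trans unfolding prepend_filter_def
    by (intro conjI) (blast+)
qed

lemma comp_mem_prepend_filter:
  assumes "path_filter S" "\<xi> \<in> paths \<Lambda>" "src \<Lambda> \<xi> \<in> S" "\<alpha> \<in> S"
  shows "\<xi> \<cdot> \<alpha> \<in> prepend_filter \<xi> S" "src \<Lambda> \<xi> = rng \<Lambda> \<alpha>"
proof -
  show r: "src \<Lambda> \<xi> = rng \<Lambda> \<alpha>"
    using filter_rng_unique[OF assms(1) assms(3,4)] rng_src assms by auto
  have "\<alpha> \<in> paths \<Lambda>" using assms path_filterD by auto
  then show "\<xi> \<cdot> \<alpha> \<in> prepend_filter \<xi> S"
    using assms r prefix_refl comp_closed unfolding prepend_filter_def by blast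
qed

lemma shift_prepend:
  assumes "path_filter S" "\<xi> \<in> paths \<Lambda>" "src \<Lambda> \<xi> \<in> S"
  shows "shift_filter \<xi> (prepend_filter \<xi> S) = S"
proof
  show "shift_filter \<xi> (prepend_filter \<xi> S) \<subseteq> S"
    unfolding shift_filter_def prepend_filter_def
    using prefix_comp_cancel path_filterD[OF assms(1)] assms(2) by blast
  show "S \<subseteq> shift_filter \<xi> (prepend_filter \<xi> S)"
    using comp_mem_prepend_filter[OF assms] path_filterD(1)[OF assms(1)]
    unfolding shift_filter_def by blast
qed

text \<open>A member \<mu> of S need not be comparable with \<xi>; a common extension of the two in
  S starts with \<xi> and has \<mu> as a prefix.\<close>

lemma prepend_shift:
  assumes "path_filter S" "\<xi> \<in> S"
  shows "prepend_filter \<xi> (shift_filter \<xi> S) = S"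
proof
  show "prepend_filter \<xi> (shift_filter \<xi> S) \<subseteq> S"
    unfolding shift_filter_def prepend_filter_def using path_filterD(2)[OF assms(1)] by blast
  show "S \<subseteq> prepend_filter \<xi> (shift_filter \<xi> S)"
  proof
    fix \<mu> assume "\<mu> \<in> S"
    then obtain \<kappa> where k: "\<kappa> \<in> S" "prefix \<mu> \<kappa>" "prefix \<xi> \<kappa>"
      using path_filterD(3)[OF assms(1)] assms(2) by blast
    then obtain \<alpha> where "\<alpha> \<in> paths \<Lambda>" "src \<Lambda> \<xi> = rng \<Lambda> \<alpha>" "\<kappa> = \<xi> \<cdot> \<alpha>"
      unfolding prefix_def by blast
    then show "\<mu> \<in> prepend_filter \<xi> (shift_filter \<xi> S)"
      using k unfolding shift_filter_def prepend_filter_def by auto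
  qed
qed

lemma src_mem_shift:
  assumes "path_filter S" "\<xi> \<in> S"
  shows "src \<Lambda> \<xi> \<in> shift_filter \<xi> S"
  using assms path_filterD(1) src_closed rng_src comp_src unfolding shift_filter_def by auto

lemma prepend_inj:
  assumes "path_filter S" "path_filter T" "\<xi> \<in> paths \<Lambda>" "src \<Lambda> \<xi> \<in> S" "src \<Lambda> \<xi> \<in> T"
    "prepend_filter \<xi> S = prepend_filter \<xi> T"
  shows "S = T"
  using shift_prepend assms by metis

lemma prepend_comp:
  assumes S: "path_filter S" and p: "\<mu> \<in> paths \<Lambda>" "\<nu> \<in> paths \<Lambda>" "src \<Lambda> \<mu> = rng \<Lambda> \<nu>" "src \<Lambda> \<nu> \<in> S"
  shows "prepend_filter \<mu> (prepend_filter \<nu> S) = prepend_filter (\<mu> \<cdot> \<nu>) S"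
proof -
  have r: "rng \<Lambda> \<alpha> = src \<Lambda> \<nu>" "\<alpha> \<in> paths \<Lambda>" if "\<alpha> \<in> S" for \<alpha>
    using filter_rng_unique[OF S that p(4)] rng_src p path_filterD(1)[OF S that] by auto
  show ?thesis
  proof (intro equalityI subsetI)
    fix \<xi> assume "\<xi> \<in> prepend_filter \<mu> (prepend_filter \<nu> S)"
    then obtain \<beta> \<alpha> where b: "src \<Lambda> \<mu> = rng \<Lambda> \<beta>" "prefix \<xi> (\<mu> \<cdot> \<beta>)" "\<alpha> \<in> S" "prefix \<beta> (\<nu> \<cdot> \<alpha>)"
      unfolding prepend_filter_def by auto
    have "prefix \<xi> (\<mu> \<cdot> (\<nu> \<cdot> \<alpha>))" using prefix_trans[OF b(2)] prefix_comp_mono b p by metis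
    then show "\<xi> \<in> prepend_filter (\<mu> \<cdot> \<nu>) S"
      using r[OF b(3)] b(3) p comp_assoc[of \<mu> \<nu> \<alpha>] src_comp
      unfolding prepend_filter_def by (auto intro!: bexI[of _ \<alpha>])
  next
    fix \<xi> assume "\<xi> \<in> prepend_filter (\<mu> \<cdot> \<nu>) S"
    then obtain \<alpha> where a: "\<alpha> \<in> S" "prefix \<xi> (\<mu> \<cdot> \<nu> \<cdot> \<alpha>)"
      unfolding prepend_filter_def by auto
    then have "prefix \<xi> (\<mu> \<cdot> (\<nu> \<cdot> \<alpha>))" using r p comp_assoc by metis
    moreover have "\<nu> \<cdot> \<alpha> \<in> prepend_filter \<nu> S" "src \<Lambda> \<mu> = rng \<Lambda> (\<nu> \<cdot> \<alpha>)"
      using comp_mem_prepend_filter[OF S p(2,4)] a r p rng_comp by auto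
    ultimately show "\<xi> \<in> prepend_filter \<mu> (prepend_filter \<nu> S)"
      unfolding prepend_filter_def by blast
  qed
qed

text \<open>Transports an exhaustive set along \<beta>. Given \<tau>, some \<nu> in E has a common
  extension with \<beta> \<cdot> \<tau>; the minimal extension of \<beta> and \<nu> inside it yields
  a \<gamma> compatible with \<tau>. Finite alignment keeps the set finite.\<close>

lemma finite_exhaustive_ext:
  assumes fa: "finitely_aligned \<Lambda>" and b: "\<beta> \<in> paths_from \<Lambda> v" and E: "E \<in> finite_exhaustive \<Lambda> v"
  shows "(\<Union>\<nu>\<in>E. fst ` min_ext \<Lambda> \<beta> \<nu>) \<in> finite_exhaustive \<Lambda> (src \<Lambda> \<beta>)"
proof -
  have Ep: "\<nu> \<in> paths \<Lambda>" "rng \<Lambda> \<nu> = v" if "\<nu> \<in> E" for \<nu>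
    using that E unfolding finite_exhaustive_def exhaustive_def paths_from_def by auto
  have bp: "\<beta> \<in> paths \<Lambda>" "rng \<Lambda> \<beta> = v" using b unfolding paths_from_def by auto
  have "finite (\<Union>\<nu>\<in>E. fst ` min_ext \<Lambda> \<beta> \<nu>)"
    using fa E bp Ep unfolding finitely_aligned_def finite_exhaustive_def by auto
  moreover have "(\<Union>\<nu>\<in>E. fst ` min_ext \<Lambda> \<beta> \<nu>) \<subseteq> paths_from \<Lambda> (src \<Lambda> \<beta>)"
    unfolding min_ext_def paths_from_def by auto
  moreover have "\<exists>\<gamma>\<in>(\<Union>\<nu>\<in>E. fst ` min_ext \<Lambda> \<beta> \<nu>). min_ext \<Lambda> \<gamma> \<tau> \<noteq> {}"
    if "\<tau> \<in> paths_from \<Lambda> (src \<Lambda> \<beta>)" for \<tau>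
  proof -
    have t: "\<tau> \<in> paths \<Lambda>" "src \<Lambda> \<beta> = rng \<Lambda> \<tau>" using that unfolding paths_from_def by auto
    have bt: "\<beta> \<cdot> \<tau> \<in> paths \<Lambda>" "rng \<Lambda> (\<beta> \<cdot> \<tau>) = v" using t bp comp_closed rng_comp by auto
    then obtain \<nu> where n: "\<nu> \<in> E" "min_ext \<Lambda> \<nu> (\<beta> \<cdot> \<tau>) \<noteq> {}"
      using E unfolding finite_exhaustive_def exhaustive_def paths_from_def by blast
    then obtain \<xi> where x: "prefix \<nu> \<xi>" "prefix (\<beta> \<cdot> \<tau>) \<xi>"
      using min_ext_nonempty_iff Ep bt by metis
    then have "prefix \<beta> \<xi>" using prefix_trans prefixI t bp by metis
    then obtain \<gamma> \<delta> where g: "(\<gamma>, \<delta>) \<in> min_ext \<Lambda> \<beta> \<nu>" "prefix (\<beta> \<cdot> \<gamma>) \<xi>"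
      using ex_common_prefix x by metis
    obtain \<zeta> where z: "\<zeta> \<in> paths \<Lambda>" "src \<Lambda> \<beta> = rng \<Lambda> \<zeta>" "\<xi> = \<beta> \<cdot> \<zeta>"
      using \<open>prefix \<beta> \<xi>\<close> unfolding prefix_def by blast
    have gp: "\<gamma> \<in> paths \<Lambda>" "src \<Lambda> \<beta> = rng \<Lambda> \<gamma>" using g unfolding min_ext_def by auto
    then have "prefix \<gamma> \<zeta>" "prefix \<tau> \<zeta>"
      using prefix_comp_cancel g x z t bp by metis+
    then have "min_ext \<Lambda> \<gamma> \<tau> \<noteq> {}" using min_ext_nonempty_iff gp t by metis
    then show ?thesis using n(1) g(1) by force
  qed
  ultimately show ?thesis unfolding finite_exhaustive_def exhaustive_def by blast
qed

text \<open>A member \<mu> of the new filter may be shorter than \<xi> or incomparable with it, so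
  the boundary condition of S does not apply to E directly. Writing \<xi> \<cdot> \<alpha> = \<mu>
  \<cdot> \<beta> with \<alpha> in S, E is transported along \<beta> to the source of \<alpha>,
  where it does apply.\<close>

lemma prepend_boundary_filter:
  assumes fa: "finitely_aligned \<Lambda>" and S: "boundary_filter S" and x: "\<xi> \<in> paths \<Lambda>" "src \<Lambda> \<xi> \<in> S"
  shows "boundary_filter (prepend_filter \<xi> S)"
proof -
  have pf: "path_filter S" using S unfolding boundary_filter_def by auto
  note PF = prepend_path_filter[OF pf x]
  note D = path_filterD[OF PF(1)]
  have "\<exists>\<nu>\<in>E. \<mu> \<cdot> \<nu> \<in> prepend_filter \<xi> S"
    if m: "\<mu> \<in> prepend_filter \<xi> S" and E: "E \<in> finite_exhaustive \<Lambda> (src \<Lambda> \<mu>)" for \<mu> E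
  proof -
    obtain \<alpha> where a: "\<alpha> \<in> S" "prefix \<mu> (\<xi> \<cdot> \<alpha>)" "src \<Lambda> \<xi> = rng \<Lambda> \<alpha>"
      using m unfolding prepend_filter_def by auto
    have ap: "\<alpha> \<in> paths \<Lambda>" using a pf path_filterD by auto
    obtain \<beta> where b: "\<mu> \<in> paths \<Lambda>" "\<beta> \<in> paths \<Lambda>" "src \<Lambda> \<mu> = rng \<Lambda> \<beta>" "\<xi> \<cdot> \<alpha> = \<mu> \<cdot> \<beta>"
      using a(2) unfolding prefix_def by blast
    have "src \<Lambda> \<alpha> = src \<Lambda> \<beta>" using src_comp a b ap x by metis
    moreover have "\<beta> \<in> paths_from \<Lambda> (src \<Lambda> \<mu>)" using b unfolding paths_from_def by auto
    ultimately obtain \<gamma> where g: "\<gamma> \<in> (\<Union>\<nu>\<in>E. fst ` min_ext \<Lambda> \<beta> \<nu>)" "\<alpha> \<cdot> \<gamma> \<in> S"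
      using finite_exhaustive_ext[OF fa _ E] S a(1) unfolding boundary_filter_def by metis
    then obtain \<nu> \<delta> where nd: "\<nu> \<in> E" "(\<gamma>, \<delta>) \<in> min_ext \<Lambda> \<beta> \<nu>" by auto
    then have gd: "\<gamma> \<in> paths \<Lambda>" "\<delta> \<in> paths \<Lambda>" "src \<Lambda> \<beta> = rng \<Lambda> \<gamma>" "src \<Lambda> \<nu> = rng \<Lambda> \<delta>" "\<beta> \<cdot> \<gamma> = \<nu> \<cdot> \<delta>"
      unfolding min_ext_def by auto
    have np: "\<nu> \<in> paths \<Lambda>" "src \<Lambda> \<mu> = rng \<Lambda> \<nu>"
      using nd(1) E unfolding finite_exhaustive_def exhaustive_def paths_from_def by auto
    have "\<xi> \<cdot> (\<alpha> \<cdot> \<gamma>) = \<mu> \<cdot> \<beta> \<cdot> \<gamma>"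
      using comp_assoc[of \<xi> \<alpha> \<gamma>] x ap gd a b \<open>src \<Lambda> \<alpha> = src \<Lambda> \<beta>\<close> by auto
    also have "\<dots> = \<mu> \<cdot> \<nu> \<cdot> \<delta>"
      using comp_assoc[of \<mu> \<beta> \<gamma>] comp_assoc[of \<mu> \<nu> \<delta>] b gd np by auto
    finally have "prefix (\<mu> \<cdot> \<nu>) (\<xi> \<cdot> (\<alpha> \<cdot> \<gamma>))"
      using prefixI[of "\<mu> \<cdot> \<nu>" \<delta>] comp_closed src_comp b np gd by metis
    then show ?thesis
      using D(2) comp_mem_prepend_filter(1)[OF pf x g(2)] nd(1) by blast
  qed
  then show ?thesis using PF unfolding boundary_filter_def by blast
qed

end

section \<open>Infinite paths as filters\<close>

lemma emb_sup: "emb (sup m n) = sup (emb m) (emb n)"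
  unfolding emb_def by (auto simp: fun_eq_iff sup_max max_def)

lemma emb_mono: "emb m \<le> emb n \<longleftrightarrow> m \<le> n"
  unfolding emb_def le_fun_def by auto

lemma emb_le_trans: "m \<le> n \<Longrightarrow> emb n \<le> e \<Longrightarrow> emb m \<le> e"
  using emb_mono order_trans by blast

lemma emb_0_le: "emb 0 \<le> e"
  unfolding emb_def le_fun_def by (auto simp: zero_enat_def[symmetric])

lemma emb_le_tuple: "e \<in> etuples k \<Longrightarrow> emb n \<le> e \<Longrightarrow> n \<in> tuples k"
proof -
  assume "e \<in> etuples k" "emb n \<le> e"
  then have "enat (n i) \<le> 0" if "i \<ge> k" for i
    using that le_funD[of "emb n" e i] unfolding etuples_def emb_def by auto
  then show "n \<in> tuples k" unfolding tuples_def by (simp add: zero_enat_def)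
qed

lemma enat_eqI: "(\<And>j. enat j \<le> a \<longleftrightarrow> enat j \<le> b) \<Longrightarrow> a = b"
proof (cases a; cases b)
  fix m n assume h: "\<And>j. enat j \<le> a \<longleftrightarrow> enat j \<le> b" "a = enat m" "b = enat n"
  show "a = b" using h(1)[of m] h(1)[of n] h(2,3) by auto
next
  fix m assume h: "\<And>j. enat j \<le> a \<longleftrightarrow> enat j \<le> b" "a = enat m" "b = \<infinity>"
  show "a = b" using h(1)[of "Suc m"] h(2,3) by auto
next
  fix n assume h: "\<And>j. enat j \<le> a \<longleftrightarrow> enat j \<le> b" "a = \<infinity>" "b = enat n"
  show "a = b" using h(1)[of "Suc n"] h(2,3) by auto
qed auto

text \<open>Tuples supported at a single coordinate test each entry separately; their other entries
  are 0 and impose no condition.\<close>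

lemma emb_le_iff_imp_eq:
  assumes "\<And>n. emb n \<le> d \<longleftrightarrow> emb n \<le> e"
  shows "d = e"
proof
  fix i
  have "enat j \<le> d i \<longleftrightarrow> enat j \<le> e i" for j
    using assms[of "\<lambda>l. if l = i then j else 0"]
    unfolding emb_def le_fun_def by (auto simp: zero_enat_def[symmetric] split: if_splits)
  then show "d i = e i" by (rule enat_eqI)
qed

text \<open>\<open>sup n d - d\<close> is the part of n beyond d. In a path prepended by a segment
  of degree d it is the tail index whose segment covers degree n.\<close>

lemma emb_le_add_iff: "emb n \<le> emb d + e \<longleftrightarrow> emb (sup n d - d) \<le> e"
proof -
  have "enat a \<le> enat b + c \<longleftrightarrow> enat (sup a b - b) \<le> c" for a b :: nat and c
    by (cases c) (auto simp: sup_max)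
  then show ?thesis unfolding emb_def le_fun_def by auto
qed

lemma paths_Omega: "(p, q) \<in> paths (Omega m) \<longleftrightarrow> p \<le> q \<and> emb q \<le> m"
  unfolding Omega_def by auto

context k_graph
begin

section \<open>Correspondence between paths and filters\<close>

lemma path_space_seg:
  assumes x: "x \<in> path_space k \<Lambda>" and le: "p \<le> q" "q \<le> t" "emb t \<le> pdeg x"
  shows "seg x p q \<in> paths \<Lambda>" "rng \<Lambda> (seg x p q) = seg x p p" "src \<Lambda> (seg x p q) = seg x q q"
    "deg \<Lambda> (seg x p q) = q - p" "seg x p t = seg x p q \<cdot> seg x q t"
proof -
  have km: "kgraph_morphism (Omega (pdeg x)) \<Lambda> (snd x)"
    using x unfolding path_space_def by auto
  have q: "emb q \<le> pdeg x" using le emb_le_trans by blast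
  have *: "(p, q) \<in> paths (Omega (pdeg x))" "(q, t) \<in> paths (Omega (pdeg x))"
    unfolding paths_Omega using le q by auto
  let ?O = "Omega (pdeg x)"
  have 1: "snd x \<xi> \<in> paths \<Lambda> \<and> rng \<Lambda> (snd x \<xi>) = snd x (rng ?O \<xi>) \<and>
      src \<Lambda> (snd x \<xi>) = snd x (src ?O \<xi>) \<and> deg \<Lambda> (snd x \<xi>) = deg ?O \<xi>" if "\<xi> \<in> paths ?O" for \<xi>
    using km that unfolding kgraph_morphism_def by blast
  have 2: "src ?O \<mu> = rng ?O \<nu> \<longrightarrow> snd x (comp ?O \<mu> \<nu>) = snd x \<mu> \<cdot> snd x \<nu>"
    if "\<mu> \<in> paths ?O" "\<nu> \<in> paths ?O" for \<mu> \<nu>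
    using km that unfolding kgraph_morphism_def by blast
  show "seg x p q \<in> paths \<Lambda>" "rng \<Lambda> (seg x p q) = seg x p p" "src \<Lambda> (seg x p q) = seg x q q"
    "deg \<Lambda> (seg x p q) = q - p" "seg x p t = seg x p q \<cdot> seg x q t"
    using 1[OF *(1)] 2[OF *] unfolding seg_def by (simp_all add: Omega_def)
qed

lemmas path_space_seg' = path_space_seg[OF _ _ order_refl]

definition initial :: "'a gpath \<Rightarrow> 'a set" where
  "initial x = {seg x 0 n | n. emb n \<le> pdeg x}"

lemma seg_mem_initial: "emb n \<le> pdeg x \<Longrightarrow> seg x 0 n \<in> initial x"
  unfolding initial_def by blast

lemma zero_le_fun: "0 \<le> n" for n :: "nat \<Rightarrow> nat"
  by (simp add: le_fun_def)

lemma initial_deg: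
  assumes "x \<in> path_space k \<Lambda>" "emb n \<le> pdeg x"
  shows "deg \<Lambda> (seg x 0 n) = n" "seg x 0 n \<in> paths \<Lambda>" "src \<Lambda> (seg x 0 n) = seg x n n"
  using path_space_seg'[OF assms(1) zero_le_fun assms(2)] by (auto simp: fun_eq_iff)

lemma mem_initial_iff:
  assumes "x \<in> path_space k \<Lambda>"
  shows "\<mu> \<in> initial x \<longleftrightarrow> emb (deg \<Lambda> \<mu>) \<le> pdeg x \<and> seg x 0 (deg \<Lambda> \<mu>) = \<mu>"
proof
  assume "\<mu> \<in> initial x"
  then show "emb (deg \<Lambda> \<mu>) \<le> pdeg x \<and> seg x 0 (deg \<Lambda> \<mu>) = \<mu>"
    unfolding initial_def using initial_deg[OF assms] by auto
next
  assume "emb (deg \<Lambda> \<mu>) \<le> pdeg x \<and> seg x 0 (deg \<Lambda> \<mu>) = \<mu>"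
  then show "\<mu> \<in> initial x" using seg_mem_initial by metis
qed

lemma cylinder_eq: "cylinder k \<Lambda> \<mu> = {x \<in> path_space k \<Lambda>. \<mu> \<in> initial x}"
  unfolding cylinder_def using mem_initial_iff by auto

lemma initial_prefix:
  assumes x: "x \<in> path_space k \<Lambda>" and "m \<le> n" "emb n \<le> pdeg x"
  shows "prefix (seg x 0 m) (seg x 0 n)" "seg x 0 n = seg x 0 m \<cdot> seg x m n"
    "seg x m n \<in> paths \<Lambda>" "rng \<Lambda> (seg x m n) = src \<Lambda> (seg x 0 m)"
proof -
  have m: "emb m \<le> pdeg x" using assms emb_le_trans by blast
  show *: "seg x 0 n = seg x 0 m \<cdot> seg x m n"
    "seg x m n \<in> paths \<Lambda>" "rng \<Lambda> (seg x m n) = src \<Lambda> (seg x 0 m)"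
    using path_space_seg[OF x zero_le_fun assms(2,3)] path_space_seg'[OF x assms(2,3)] by auto
  show "prefix (seg x 0 m) (seg x 0 n)"
    using prefixI[of "seg x 0 m" "seg x m n"] * initial_deg[OF x m] by auto
qed

text \<open>Two initial segments are prefixes of the one at the maximum of their degrees, and that
  maximum still lies below the degree of x.\<close>

lemma path_filter_initial:
  assumes x: "x \<in> path_space k \<Lambda>"
  shows "path_filter (initial x)"
proof -
  have "\<exists>\<xi>\<in>initial x. prefix \<mu> \<xi> \<and> prefix \<nu> \<xi>" if mn: "\<mu> \<in> initial x" "\<nu> \<in> initial x" for \<mu> \<nu>
  proof -
    obtain m n where "emb m \<le> pdeg x" "emb n \<le> pdeg x" and eq: "\<mu> = seg x 0 m" "\<nu> = seg x 0 n"
      using mn unfolding initial_def by auto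
    then have s: "emb (sup m n) \<le> pdeg x" by (simp add: emb_sup)
    have "prefix \<mu> (seg x 0 (sup m n))" "prefix \<nu> (seg x 0 (sup m n))"
      using initial_prefix(1)[OF x _ s] eq by auto
    then show ?thesis using s unfolding initial_def by auto
  qed
  moreover have "\<mu> \<in> initial x" if "prefix \<mu> \<xi>" and x': "\<xi> \<in> initial x" for \<mu> \<xi>
  proof -
    obtain n where n: "emb n \<le> pdeg x" "\<xi> = seg x 0 n"
      using x' unfolding initial_def by auto
    have d: "deg \<Lambda> \<mu> \<le> n" using deg_prefix[OF that(1)] n initial_deg[OF x] by auto
    then have e: "emb (deg \<Lambda> \<mu>) \<le> pdeg x" using n emb_le_trans by blast
    have "seg x 0 (deg \<Lambda> \<mu>) = \<mu>"
      by (rule prefix_unique[OF _ that(1)])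
        (use initial_prefix(1)[OF x d n(1)] n(2) initial_deg[OF x e] in auto)
    then show ?thesis using e mem_initial_iff[OF x] by auto
  qed
  moreover have "seg x 0 0 \<in> initial x" unfolding initial_def using emb_0_le by auto
  moreover have "initial x \<subseteq> paths \<Lambda>" unfolding initial_def using initial_deg[OF x] by auto
  ultimately show ?thesis unfolding path_filter_def by blast
qed

lemma prng_mem_initial:
  assumes "x \<in> path_space k \<Lambda>" "v \<in> vertices \<Lambda>"
  shows "prng x = v \<longleftrightarrow> v \<in> initial x"
  using mem_initial_iff[OF assms(1), of v] assms(2) emb_0_le
  unfolding prng_def vertices_def by auto

lemma initial_degs:
  assumes "x \<in> path_space k \<Lambda>"
  shows "emb n \<le> pdeg x \<longleftrightarrow> n \<in> deg \<Lambda> ` initial x"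
  unfolding initial_def using initial_deg[OF assms] by force

text \<open>The degrees occurring in the filter fix \<open>pdeg\<close>, its members fix the
  segments starting at 0, and cancellation then fixes all other segments.\<close>

lemma initial_inj:
  assumes x: "x \<in> path_space k \<Lambda>" and y: "y \<in> path_space k \<Lambda>" and eq: "initial x = initial y"
  shows "x = y"
proof -
  have d: "pdeg x = pdeg y"
    by (rule emb_le_iff_imp_eq) (use initial_degs x y eq in auto)
  have s0: "seg x 0 n = seg y 0 n" if "emb n \<le> pdeg x" for n
  proof -
    have "seg x 0 n \<in> initial y" using that eq unfolding initial_def by auto
    then show ?thesis using mem_initial_iff[OF y] initial_deg[OF x that] by auto
  qed
  have "snd x (p, q) = snd y (p, q)" if "p \<le> q" "emb q \<le> pdeg x" for p q
  proof -
    have "seg x p q = seg y p q"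
      using comp_cancel[of "seg x 0 p" "seg x p q" "seg y p q"]
        initial_prefix[OF x that] initial_prefix[OF y that(1)] s0 d that emb_le_trans initial_deg[OF x]
      by metis
    then show ?thesis unfolding seg_def .
  qed
  moreover have "snd x \<in> extensional (paths (Omega (pdeg x)))" "snd y \<in> extensional (paths (Omega (pdeg x)))"
    using x y d unfolding path_space_def by auto
  ultimately have "snd x = snd y"
    using extensionalityI[of "snd x" "paths (Omega (pdeg x))" "snd y"] paths_Omega by auto
  then show ?thesis using d by (simp add: prod_eq_iff)
qed

text \<open>Each coordinate of n may be reached by a different member. Directedness merges these
  bounds one coordinate at a time, and k steps are enough because n vanishes from k on. The prefix
  of degree n of the resulting member then lies in S.\<close>

lemma filter_sup_bound:
  assumes S: "path_filter S" and n: "n \<in> tuples k" and b: "\<And>i. \<exists>\<mu>\<in>S. n i \<le> deg \<Lambda> \<mu> i"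
  obtains \<mu> where "\<mu> \<in> S" "deg \<Lambda> \<mu> = n"
proof -
  have "\<exists>\<xi>\<in>S. \<forall>i<j. n i \<le> deg \<Lambda> \<xi> i" for j
  proof (induction j)
    case 0
    then show ?case using S unfolding path_filter_def by auto
  next
    case (Suc j)
    then obtain \<mu> where m: "\<mu> \<in> S" "\<forall>i<j. n i \<le> deg \<Lambda> \<mu> i" by blast
    obtain \<nu> where n: "\<nu> \<in> S" "n j \<le> deg \<Lambda> \<nu> j" using b by blast
    obtain \<xi> where x: "\<xi> \<in> S" "prefix \<mu> \<xi>" "prefix \<nu> \<xi>" using path_filterD(3)[OF S] m n by blast
    have "deg \<Lambda> \<mu> i \<le> deg \<Lambda> \<xi> i" "deg \<Lambda> \<nu> i \<le> deg \<Lambda> \<xi> i" for i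
      using deg_prefix x by (auto simp: le_fun_def)
    then have "\<forall>i<Suc j. n i \<le> deg \<Lambda> \<xi> i" using m n less_Suc_eq order_trans by metis
    then show ?case using x by blast
  qed
  then obtain \<xi> where x: "\<xi> \<in> S" "\<forall>i<k. n i \<le> deg \<Lambda> \<xi> i" by blast
  have "n i \<le> deg \<Lambda> \<xi> i" for i
    using x(2) n unfolding tuples_def by (cases "i < k") auto
  then have "n \<le> deg \<Lambda> \<xi>" unfolding le_fun_def by blast
  then show ?thesis using ex_prefix_deg path_filterD[OF S] x that by metis
qed

text \<open>The degree of x is the supremum of the degrees in S, possibly infinite in some
  coordinates. Every finite n below it is the degree of exactly one member, and x(p, q) is what
  remains of the member of degree q after that of degree p.\<close>

lemma ex_path_initial:
  assumes S: "path_filter S"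
  obtains x where "x \<in> path_space k \<Lambda>" "initial x = S"
proof -
  define m where "m i = (SUP \<mu>\<in>S. enat (deg \<Lambda> \<mu> i))" for i
  note D = path_filterD[OF S]
  have mS: "emb (deg \<Lambda> \<mu>) \<le> m" if "\<mu> \<in> S" for \<mu>
    unfolding emb_def le_fun_def m_def using that by (auto intro: SUP_upper)
  have me: "m \<in> etuples k"
  proof -
    have "m i = 0" if "i \<ge> k" for i
    proof -
      have "\<forall>\<mu>\<in>S. deg \<Lambda> \<mu> i = 0" using D(1) deg_tuple that unfolding tuples_def by auto
      moreover have "S \<noteq> {}" using S unfolding path_filter_def by auto
      ultimately show ?thesis unfolding m_def by (simp add: zero_enat_def[symmetric])
    qed
    then show ?thesis unfolding etuples_def by auto
  qed
  have ex: "\<exists>\<mu>\<in>S. deg \<Lambda> \<mu> = n" if n: "emb n \<le> m" for n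
  proof -
    have "\<exists>\<mu>\<in>S. n i \<le> deg \<Lambda> \<mu> i" for i
    proof (rule ccontr)
      assume "\<not> ?thesis"
      \<comment> \<open>If all members stay below n i, the supremum is at most n i - 1. S has a
        member, so n i is positive and the subtraction is not truncated.\<close>
      then have "\<forall>\<mu>\<in>S. enat (deg \<Lambda> \<mu> i) \<le> enat (n i - 1) \<and> n i > 0" by (auto simp: not_le)
      moreover have "S \<noteq> {}" using S unfolding path_filter_def by auto
      ultimately have "m i \<le> enat (n i - 1)" "n i > 0" unfolding m_def by (auto intro: SUP_least)
      moreover have "enat (n i) \<le> m i" using n unfolding emb_def le_fun_def by auto
      ultimately have "enat (n i) \<le> enat (n i - 1)" by order
      then show False using \<open>n i > 0\<close> by simp
    qed
    then show ?thesis using filter_sup_bound[OF S emb_le_tuple[OF me n]] by metis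
  qed
  define pt where "pt n = (THE \<mu>. \<mu> \<in> S \<and> deg \<Lambda> \<mu> = n)" for n
  have pt: "pt n \<in> S" "deg \<Lambda> (pt n) = n" if n: "emb n \<le> m" for n
  proof -
    obtain \<mu> where "\<mu> \<in> S \<and> deg \<Lambda> \<mu> = n" using ex[OF n] by blast
    then have "pt n \<in> S \<and> deg \<Lambda> (pt n) = n"
      unfolding pt_def by (rule theI) (use filter_deg_unique[OF S] \<open>\<mu> \<in> S \<and> deg \<Lambda> \<mu> = n\<close> in auto)
    then show "pt n \<in> S" "deg \<Lambda> (pt n) = n" by auto
  qed
  define sg where "sg p q = (THE \<alpha>. \<alpha> \<in> paths \<Lambda> \<and> src \<Lambda> (pt p) = rng \<Lambda> \<alpha> \<and> pt q = pt p \<cdot> \<alpha>)" for p q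
  have sg: "sg p q \<in> paths \<Lambda>" "src \<Lambda> (pt p) = rng \<Lambda> (sg p q)" "pt q = pt p \<cdot> sg p q"
    if pq: "p \<le> q" "emb q \<le> m" for p q
  proof -
    have p: "emb p \<le> m" using pq emb_le_trans by blast
    obtain \<xi> where "\<xi> \<in> S" "prefix (pt p) \<xi>" "prefix (pt q) \<xi>" using D(3) pt p pq by blast
    then have "prefix (pt p) (pt q)" using prefix_le pt p pq by metis
    then obtain \<alpha> where a: "\<alpha> \<in> paths \<Lambda> \<and> src \<Lambda> (pt p) = rng \<Lambda> \<alpha> \<and> pt q = pt p \<cdot> \<alpha>"
      unfolding prefix_def by blast
    then have "sg p q \<in> paths \<Lambda> \<and> src \<Lambda> (pt p) = rng \<Lambda> (sg p q) \<and> pt q = pt p \<cdot> sg p q"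
      unfolding sg_def
      by (rule theI) (use comp_cancel[of "pt p"] a D(1)[OF pt(1)[OF p]] in metis)
    then show "sg p q \<in> paths \<Lambda>" "src \<Lambda> (pt p) = rng \<Lambda> (sg p q)" "pt q = pt p \<cdot> sg p q" by auto
  qed
  have ptp: "pt p \<in> paths \<Lambda>" if "emb p \<le> m" for p using pt(1)[OF that] D(1) by auto
  have sgI: "sg p q = \<alpha>"
    if "p \<le> q" "emb q \<le> m" "\<alpha> \<in> paths \<Lambda>" "src \<Lambda> (pt p) = rng \<Lambda> \<alpha>" "pt q = pt p \<cdot> \<alpha>" for p q \<alpha>
    using comp_cancel[of "pt p" "sg p q" \<alpha>] sg[OF that(1,2)] that ptp emb_le_trans by metis
  have sgs: "src \<Lambda> (sg p q) = src \<Lambda> (pt q)" if "p \<le> q" "emb q \<le> m" for p q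
    using sg[OF that] src_comp ptp emb_le_trans[OF that] by metis
  have sg0: "sg p p = src \<Lambda> (pt p)" if "emb p \<le> m" for p
    using sgI[of p p "src \<Lambda> (pt p)"] that ptp comp_src rng_src src_closed by simp
  have sgd: "deg \<Lambda> (sg p q) = q - p" if "p \<le> q" "emb q \<le> m" for p q
  proof -
    have "deg \<Lambda> (pt q) = deg \<Lambda> (pt p) + deg \<Lambda> (sg p q)"
      using deg_comp[of "pt p" "sg p q"] sg[OF that] ptp emb_le_trans[OF that] by metis
    then show ?thesis using pt(2) that emb_le_trans[OF that] by (auto simp: fun_eq_iff)
  qed
  have sgc: "sg p t = sg p q \<cdot> sg q t" if "p \<le> q" "q \<le> t" "emb t \<le> m" for p q t
  proof (rule sgI)
    have q: "emb q \<le> m" and p: "emb p \<le> m" using that emb_le_trans by blast+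
    have s: "src \<Lambda> (sg p q) = rng \<Lambda> (sg q t)" using sgs[OF that(1) q] sg[OF that(2,3)] by auto
    show "p \<le> t" "emb t \<le> m" using that by auto
    show "sg p q \<cdot> sg q t \<in> paths \<Lambda>" using comp_closed sg that q s by auto
    show "src \<Lambda> (pt p) = rng \<Lambda> (sg p q \<cdot> sg q t)"
      using rng_comp sg[OF that(1) q] sg[OF that(2,3)] s by auto
    show "pt t = pt p \<cdot> (sg p q \<cdot> sg q t)"
      using comp_assoc[of "pt p" "sg p q" "sg q t"] ptp[OF p] sg[OF that(1) q] sg[OF that(2,3)] s by auto
  qed
  define x where "x = (m, restrict (\<lambda>(p, q). sg p q) (paths (Omega m)))"
  have sx: "seg x p q = sg p q" if "p \<le> q" "emb q \<le> m" for p q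
    unfolding x_def seg_def using that by (simp add: paths_Omega)
  have xp: "x \<in> path_space k \<Lambda>"
  proof -
    have "kgraph_morphism (Omega m) \<Lambda> (snd x)"
      unfolding kgraph_morphism_def
    proof (intro conjI ballI impI)
      fix \<xi> assume "\<xi> \<in> paths (Omega m)"
      then obtain p q where pq: "\<xi> = (p, q)" "p \<le> q" "emb q \<le> m" unfolding Omega_def by auto
      have p: "emb p \<le> m" using pq emb_le_trans by blast
      show "snd x \<xi> \<in> paths \<Lambda>" "rng \<Lambda> (snd x \<xi>) = snd x (rng (Omega m) \<xi>)"
        "src \<Lambda> (snd x \<xi>) = snd x (src (Omega m) \<xi>)" "deg \<Lambda> (snd x \<xi>) = deg (Omega m) \<xi>"
        using sx[OF pq(2,3)] sx[OF order_refl p] sx[OF order_refl pq(3)] sg[OF pq(2,3)] sgs[OF pq(2,3)]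
          sg0[OF p] sg0[OF pq(3)] sgd[OF pq(2,3)] pq(1)
        unfolding seg_def by (auto simp: Omega_def)
    next
      fix \<mu> \<nu> assume "\<mu> \<in> paths (Omega m)" "\<nu> \<in> paths (Omega m)" "src (Omega m) \<mu> = rng (Omega m) \<nu>"
      then obtain p q t where pq: "\<mu> = (p, q)" "\<nu> = (q, t)" "p \<le> q" "q \<le> t" "emb t \<le> m"
        unfolding Omega_def by auto
      have q: "emb q \<le> m" using pq emb_le_trans by blast
      show "snd x (comp (Omega m) \<mu> \<nu>) = snd x \<mu> \<cdot> snd x \<nu>"
        using sx[OF pq(3) q] sx[OF pq(4,5)] sx[OF order_trans[OF pq(3,4)] pq(5)] sgc[OF pq(3-5)] pq(1,2)
        unfolding seg_def by (auto simp: Omega_def)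
    qed
    then show ?thesis using me unfolding path_space_def x_def by auto
  qed
  have x0: "seg x 0 n = pt n" if "emb n \<le> m" for n
  proof -
    \<comment> \<open>Degree 0 makes \<open>pt 0\<close> a vertex, so the remainder after it is the
      whole segment.\<close>
    have "pt 0 \<in> vertices \<Lambda>" using pt[OF emb_0_le] ptp[OF emb_0_le] unfolding vertices_def by auto
    then have "pt 0 = rng \<Lambda> (sg 0 n)" using sg(2)[OF zero_le_fun that] vertex_rng_src by auto
    then have "pt n = sg 0 n" using sg[OF zero_le_fun that] comp_rng by auto
    then show ?thesis using sx[OF zero_le_fun that] by auto
  qed
  have "initial x = S"
  proof (intro equalityI subsetI)
    fix \<mu> assume "\<mu> \<in> initial x"
    then show "\<mu> \<in> S" unfolding initial_def using x0 pt x_def by auto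
  next
    fix \<mu> assume "\<mu> \<in> S"
    then have "seg x 0 (deg \<Lambda> \<mu>) = \<mu>"
      using x0[OF mS] pt[OF mS] filter_deg_unique[OF S] by metis
    then show "\<mu> \<in> initial x" using mem_initial_iff[OF xp] mS \<open>\<mu> \<in> S\<close> x_def by auto
  qed
  then show ?thesis using that xp by blast
qed

text \<open>A path \<nu> in E determines the endpoint m as n plus the degree of \<nu>. So x(n, m) =
  \<nu> for some m means that x(0, n) followed by \<nu> is an initial segment of x.\<close>

lemma boundary_paths_eq:
  "boundary_paths k \<Lambda> = {x \<in> path_space k \<Lambda>. boundary_filter (initial x)}"
proof -
  have "(\<exists>m. n \<le> m \<and> emb m \<le> pdeg x \<and> seg x n m \<in> E) \<longleftrightarrow> (\<exists>\<nu>\<in>E. seg x 0 n \<cdot> \<nu> \<in> initial x)"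
    if x: "x \<in> path_space k \<Lambda>" and n: "emb n \<le> pdeg x"
      and E: "E \<in> finite_exhaustive \<Lambda> (seg x n n)" for x n E
  proof
    assume "\<exists>m. n \<le> m \<and> emb m \<le> pdeg x \<and> seg x n m \<in> E"
    then obtain m where m: "n \<le> m" "emb m \<le> pdeg x" "seg x n m \<in> E" by blast
    then have "seg x 0 n \<cdot> seg x n m \<in> initial x"
      using initial_prefix(2)[OF x m(1,2)] seg_mem_initial[OF m(2)] by simp
    then show "\<exists>\<nu>\<in>E. seg x 0 n \<cdot> \<nu> \<in> initial x" using m by blast
  next
    assume "\<exists>\<nu>\<in>E. seg x 0 n \<cdot> \<nu> \<in> initial x"
    then obtain \<nu> where nu: "\<nu> \<in> E" "seg x 0 n \<cdot> \<nu> \<in> initial x" by blast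
    have np: "\<nu> \<in> paths \<Lambda>" "rng \<Lambda> \<nu> = seg x n n"
      using nu E unfolding finite_exhaustive_def exhaustive_def paths_from_def by auto
    let ?m = "n + deg \<Lambda> \<nu>"
    have d: "deg \<Lambda> (seg x 0 n \<cdot> \<nu>) = ?m" using deg_comp np initial_deg[OF x n] by auto
    then have m: "emb ?m \<le> pdeg x" "seg x 0 ?m = seg x 0 n \<cdot> \<nu>" using nu mem_initial_iff[OF x] by auto
    have nm: "n \<le> ?m" by (auto simp: le_fun_def)
    have "seg x n ?m = \<nu>"
      by (rule comp_cancel[of "seg x 0 n"])
        (use initial_prefix[OF x nm m(1)] m(2) np initial_deg[OF x n] in auto)
    then show "\<exists>m. n \<le> m \<and> emb m \<le> pdeg x \<and> seg x n m \<in> E" using nm m nu by auto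
  qed
  then have *: "(\<forall>E\<in>finite_exhaustive \<Lambda> (seg x n n). \<exists>m. n \<le> m \<and> emb m \<le> pdeg x \<and> seg x n m \<in> E) \<longleftrightarrow>
      (\<forall>E\<in>finite_exhaustive \<Lambda> (src \<Lambda> (seg x 0 n)). \<exists>\<nu>\<in>E. seg x 0 n \<cdot> \<nu> \<in> initial x)"
    if "x \<in> path_space k \<Lambda>" "emb n \<le> pdeg x" for x n
    unfolding initial_deg(3)[OF that] using that by blast
  have "x \<in> boundary_paths k \<Lambda> \<longleftrightarrow> (x \<in> path_space k \<Lambda> \<and> (\<forall>n. emb n \<le> pdeg x \<longrightarrow>
      (\<forall>E\<in>finite_exhaustive \<Lambda> (src \<Lambda> (seg x 0 n)). \<exists>\<nu>\<in>E. seg x 0 n \<cdot> \<nu> \<in> initial x)))" for x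
    unfolding boundary_paths_def mem_Collect_eq using *[of x]
    by (intro conj_cong refl all_cong1 imp_cong)
  moreover have "(\<forall>n. emb n \<le> pdeg x \<longrightarrow> (\<forall>E\<in>finite_exhaustive \<Lambda> (src \<Lambda> (seg x 0 n)).
      \<exists>\<nu>\<in>E. seg x 0 n \<cdot> \<nu> \<in> initial x)) \<longleftrightarrow> (\<forall>\<xi>\<in>initial x. \<forall>E\<in>finite_exhaustive \<Lambda> (src \<Lambda> \<xi>).
      \<exists>\<nu>\<in>E. \<xi> \<cdot> \<nu> \<in> initial x)" for x
    unfolding initial_def by blast
  ultimately have "x \<in> boundary_paths k \<Lambda> \<longleftrightarrow>
      (x \<in> path_space k \<Lambda> \<and> boundary_filter (initial x))" for x
    by (cases "x \<in> path_space k \<Lambda>") (simp_all add: boundary_filter_def path_filter_initial)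
  then show ?thesis by blast
qed

text \<open>The conditions in \<open>prepend\<close> prescribe the segment of y up to the degree of
  \<mu> and the segments starting there. The filter equation determines all initial segments of y,
  so it settles both existence and uniqueness for the definite description.\<close>

lemma is_prepend_iff:
  assumes x: "x \<in> path_space k \<Lambda>" and m: "\<mu> \<in> paths \<Lambda>" "prng x = src \<Lambda> \<mu>" and y: "y \<in> path_space k \<Lambda>"
  shows "pdeg y = emb (deg \<Lambda> \<mu>) + pdeg x \<and> seg y 0 (deg \<Lambda> \<mu>) = \<mu> \<and>
     (\<forall>n. emb n \<le> pdeg x \<longrightarrow> seg y (deg \<Lambda> \<mu>) (deg \<Lambda> \<mu> + n) = seg x 0 n) \<longleftrightarrow>
     initial y = prepend_filter \<mu> (initial x)" (is "?L \<longleftrightarrow> ?R")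
proof -
  let ?d = "deg \<Lambda> \<mu>"
  have sx: "src \<Lambda> \<mu> \<in> initial x" using prng_mem_initial[OF x src_vertex[OF m(1)]] m(2) by auto
  note pf = path_filter_initial[OF x]
  note PF = prepend_path_filter[OF pf m(1) sx]
  have r: "seg x 0 n \<in> paths \<Lambda>" "src \<Lambda> \<mu> = rng \<Lambda> (seg x 0 n)" "\<mu> \<cdot> seg x 0 n \<in> prepend_filter \<mu> (initial x)"
    "deg \<Lambda> (\<mu> \<cdot> seg x 0 n) = ?d + n"
    if n: "emb n \<le> pdeg x" for n
  proof -
    have "seg x 0 n \<in> initial x" using n unfolding initial_def by auto
    then show *: "seg x 0 n \<in> paths \<Lambda>" "src \<Lambda> \<mu> = rng \<Lambda> (seg x 0 n)" "\<mu> \<cdot> seg x 0 n \<in> prepend_filter \<mu> (initial x)"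
      using comp_mem_prepend_filter[OF pf m(1) sx] path_filterD(1)[OF pf] by auto
    show "deg \<Lambda> (\<mu> \<cdot> seg x 0 n) = ?d + n" using deg_comp m(1) * initial_deg[OF x n] by auto
  qed
  have dle: "?d \<le> ?d + n" for n by (auto simp: le_fun_def)
  have embd: "emb (?d + n) \<le> emb ?d + pdeg x" if "emb n \<le> pdeg x" for n
    using that by (simp add: emb_le_add_iff sup_fun_def sup_max fun_diff_def)
  show ?thesis
  proof
    assume L: ?L
    have *: "seg y 0 (?d + n) = \<mu> \<cdot> seg x 0 n" "emb (?d + n) \<le> pdeg y" if n: "emb n \<le> pdeg x" for n
    proof -
      show "emb (?d + n) \<le> pdeg y" using L embd[OF n] by auto
      then show "seg y 0 (?d + n) = \<mu> \<cdot> seg x 0 n"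
        using initial_prefix(2)[OF y dle] L n by auto
    qed
    show ?R
    proof (intro equalityI subsetI)
      fix \<xi> assume "\<xi> \<in> initial y"
      then obtain t where t: "emb t \<le> pdeg y" "\<xi> = seg y 0 t" unfolding initial_def by auto
      \<comment> \<open>The smallest tail index for which the segment of y up to ?d + ?n reaches
        degree t.\<close>
      let ?n = "sup t ?d - ?d"
      have n: "emb ?n \<le> pdeg x" using t L emb_le_add_iff by auto
      have "t \<le> ?d + ?n" by (auto simp: le_fun_def)
      then have "prefix \<xi> (\<mu> \<cdot> seg x 0 ?n)"
        using initial_prefix(1)[OF y _ *(2)[OF n]] *(1)[OF n] t by auto
      then show "\<xi> \<in> prepend_filter \<mu> (initial x)" using path_filterD(2)[OF PF(1)] r(3)[OF n] by blast
    next
      fix \<xi> assume "\<xi> \<in> prepend_filter \<mu> (initial x)"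
      then obtain n where n: "emb n \<le> pdeg x" "prefix \<xi> (\<mu> \<cdot> seg x 0 n)"
        unfolding prepend_filter_def initial_def by auto
      have "seg y 0 (?d + n) \<in> initial y" using seg_mem_initial *(2)[OF n(1)] by blast
      then show "\<xi> \<in> initial y"
        using n(2) *[OF n(1)] path_filterD(2)[OF path_filter_initial[OF y]] by auto
    qed
  next
    assume R: ?R
    have py: "pdeg y = emb ?d + pdeg x"
    proof (rule emb_le_iff_imp_eq)
      fix t
      show "emb t \<le> pdeg y \<longleftrightarrow> emb t \<le> emb ?d + pdeg x"
      proof
        assume "emb t \<le> pdeg y"
        then obtain \<xi> where "\<xi> \<in> initial y" "deg \<Lambda> \<xi> = t" using initial_degs[OF y] by auto
        then obtain n where n: "emb n \<le> pdeg x" "prefix \<xi> (\<mu> \<cdot> seg x 0 n)"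
          using R unfolding prepend_filter_def initial_def by auto
        then have "t \<le> ?d + n" using deg_prefix[OF n(2)] r(4)[OF n(1)] \<open>deg \<Lambda> \<xi> = t\<close> by auto
        then show "emb t \<le> emb ?d + pdeg x" using embd[OF n(1)] emb_le_trans by blast
      next
        assume "emb t \<le> emb ?d + pdeg x"
        then have n: "emb (sup t ?d - ?d) \<le> pdeg x" (is "emb ?n \<le> _") using emb_le_add_iff by auto
        have "t \<le> ?d + ?n" by (auto simp: le_fun_def)
        moreover have "emb (?d + ?n) \<le> pdeg y"
          using r(3,4)[OF n] R initial_degs[OF y] by (metis image_eqI)
        ultimately show "emb t \<le> pdeg y" using emb_le_trans by blast
      qed
    qed
    moreover have my: "seg y 0 ?d = \<mu>" using PF(2) R mem_initial_iff[OF y] by auto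
    moreover have "seg y ?d (?d + n) = seg x 0 n" if n: "emb n \<le> pdeg x" for n
    proof -
      have e: "emb (?d + n) \<le> pdeg y" using py embd[OF n] by auto
      have "seg y 0 (?d + n) = \<mu> \<cdot> seg x 0 n"
        using r(3,4)[OF n] R mem_initial_iff[OF y] by auto
      then show ?thesis
        using comp_cancel[of \<mu> "seg y ?d (?d + n)" "seg x 0 n"] initial_prefix[OF y dle e] my r[OF n] m by auto
    qed
    ultimately show ?L by blast
  qed
qed

lemma initial_prepend:
  assumes x: "x \<in> path_space k \<Lambda>" and m: "\<mu> \<in> paths \<Lambda>" "prng x = src \<Lambda> \<mu>"
  shows "prepend k \<Lambda> \<mu> x \<in> path_space k \<Lambda>" "initial (prepend k \<Lambda> \<mu> x) = prepend_filter \<mu> (initial x)"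
proof -
  have sx: "src \<Lambda> \<mu> \<in> initial x" using prng_mem_initial[OF x src_vertex[OF m(1)]] m(2) by auto
  obtain y where y: "y \<in> path_space k \<Lambda>" "initial y = prepend_filter \<mu> (initial x)"
    using ex_path_initial prepend_path_filter[OF path_filter_initial[OF x] m(1) sx] by metis
  have "prepend k \<Lambda> \<mu> x = y"
    unfolding prepend_def
    using is_prepend_iff[OF x m] y initial_inj by (intro the_equality) (blast, metis)
  then show "prepend k \<Lambda> \<mu> x \<in> path_space k \<Lambda>" "initial (prepend k \<Lambda> \<mu> x) = prepend_filter \<mu> (initial x)"
    using y by auto
qed

text \<open>The complementary path is the one whose filter is the shift by \<mu> of the filter of
  x.\<close>

lemma ex_prepend_iff:
  assumes x: "x \<in> path_space k \<Lambda>" and m: "\<mu> \<in> paths \<Lambda>"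
  shows "(\<exists>y\<in>path_space k \<Lambda>. prng y = src \<Lambda> \<mu> \<and> x = prepend k \<Lambda> \<mu> y) \<longleftrightarrow> \<mu> \<in> initial x"
proof
  assume "\<exists>y\<in>path_space k \<Lambda>. prng y = src \<Lambda> \<mu> \<and> x = prepend k \<Lambda> \<mu> y"
  then obtain y where y: "y \<in> path_space k \<Lambda>" "prng y = src \<Lambda> \<mu>" "x = prepend k \<Lambda> \<mu> y" by blast
  have "src \<Lambda> \<mu> \<in> initial y" using prng_mem_initial[OF y(1) src_vertex[OF m]] y(2) by auto
  then show "\<mu> \<in> initial x"
    using prepend_path_filter(2)[OF path_filter_initial[OF y(1)] m] initial_prepend[OF y(1) m y(2)] y(3) by auto
next
  assume mx: "\<mu> \<in> initial x"
  note pf = path_filter_initial[OF x]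
  obtain y where y: "y \<in> path_space k \<Lambda>" "initial y = shift_filter \<mu> (initial x)"
    using ex_path_initial shift_path_filter[OF pf mx] by metis
  have p: "prng y = src \<Lambda> \<mu>"
    using src_mem_shift[OF pf mx] y prng_mem_initial[OF y(1) src_vertex[OF m]] by auto
  have "initial (prepend k \<Lambda> \<mu> y) = initial x"
    using initial_prepend[OF y(1) m p] y(2) prepend_shift[OF pf mx] by auto
  then have "x = prepend k \<Lambda> \<mu> y" using initial_inj x initial_prepend[OF y(1) m p] by metis
  then show "\<exists>y\<in>path_space k \<Lambda>. prng y = src \<Lambda> \<mu> \<and> x = prepend k \<Lambda> \<mu> y" using y p by blast
qed

end

section \<open>C*-algebras: spans, characters and square roots\<close>

context cstar_algebra
begin

section \<open>Algebraic consequences of the axioms\<close>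

sublocale M: module complex_ring A
  by (rule vector_space)

lemma smult_closed: "x \<in> carrier A \<Longrightarrow> c \<odot> x \<in> carrier A"
  using M.smult_closed[of c x] by (simp add: complex_ring_def)

lemma smult_add_left: "x \<in> carrier A \<Longrightarrow> (c + d) \<odot> x = c \<odot> x \<oplus> d \<odot> x"
  using M.smult_l_distr[of c d x] by (simp add: complex_ring_def)

lemma smult_add_right: "x \<in> carrier A \<Longrightarrow> y \<in> carrier A \<Longrightarrow> c \<odot> (x \<oplus> y) = c \<odot> x \<oplus> c \<odot> y"
  using M.smult_r_distr[of c x y] by (simp add: complex_ring_def)

lemma smult_smult: "x \<in> carrier A \<Longrightarrow> c \<odot> (d \<odot> x) = (c * d) \<odot> x"
  using M.smult_assoc1[of c d x] by (simp add: complex_ring_def)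

lemma smult_1: "x \<in> carrier A \<Longrightarrow> 1 \<odot> x = x"
  using M.smult_one[of x] by (simp add: complex_ring_def)

lemma smult_0: "x \<in> carrier A \<Longrightarrow> 0 \<odot> x = \<zero>"
  using M.smult_l_null[of x] by (simp add: complex_ring_def)

lemma uminus_eq_smult:
  assumes x: "x \<in> carrier A"
  shows "\<ominus> x = (- 1) \<odot> x"
proof -
  have "(- 1) \<odot> x \<oplus> x = (- 1 + 1) \<odot> x" using smult_add_left[OF x, of "- 1" 1] smult_1[OF x] by simp
  also have "\<dots> = \<zero>" using smult_0[OF x] by simp
  finally show ?thesis using M.minus_equality x smult_closed by auto
qed

lemma minus_eq_smult: "x \<in> carrier A \<Longrightarrow> y \<in> carrier A \<Longrightarrow> x \<ominus> y = x \<oplus> (- 1) \<odot> y"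
  using uminus_eq_smult by (simp add: M.minus_eq)

lemmas closed = M.a_closed M.zero_closed M.minus_closed M.a_inv_closed smult_closed mult_closed adj_closed

lemma mult_minus_left:
  "x \<in> carrier A \<Longrightarrow> y \<in> carrier A \<Longrightarrow> z \<in> carrier A \<Longrightarrow> (x \<ominus> y) \<otimes> z = x \<otimes> z \<ominus> y \<otimes> z"
  by (simp add: minus_eq_smult closed mult_add_left smult_mult_left)

lemma mult_minus_right:
  "x \<in> carrier A \<Longrightarrow> y \<in> carrier A \<Longrightarrow> z \<in> carrier A \<Longrightarrow> z \<otimes> (x \<ominus> y) = z \<otimes> x \<ominus> z \<otimes> y"
  by (simp add: minus_eq_smult closed mult_add_right smult_mult_right)

lemma adj_minus: "x \<in> carrier A \<Longrightarrow> y \<in> carrier A \<Longrightarrow> adj A (x \<ominus> y) = adj A x \<ominus> adj A y"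
  by (simp add: minus_eq_smult closed adj_add adj_smult)

lemma smult_minus: "x \<in> carrier A \<Longrightarrow> y \<in> carrier A \<Longrightarrow> c \<odot> (x \<ominus> y) = c \<odot> x \<ominus> c \<odot> y"
  by (simp add: minus_eq_smult closed smult_add_right smult_smult)

lemma mult_zero_left: "x \<in> carrier A \<Longrightarrow> \<zero> \<otimes> x = \<zero>"
  using smult_mult_left[of x x 0] smult_0[of x] smult_0[of "x \<otimes> x"] closed by simp

lemma mult_zero_right: "x \<in> carrier A \<Longrightarrow> x \<otimes> \<zero> = \<zero>"
  using smult_mult_right[of x x 0] smult_0[of x] smult_0[of "x \<otimes> x"] closed by simp

lemma adj_zero: "adj A \<zero> = \<zero>"
  using adj_smult[of \<zero> 0] smult_0 closed by simp

lemma smult_zero: "c \<odot> \<zero> = \<zero>"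
  using smult_smult[of \<zero> c 0] smult_0[of \<zero>] closed by simp

lemma minus_self: "x \<in> carrier A \<Longrightarrow> x \<ominus> x = \<zero>"
  by (simp add: M.minus_eq M.r_neg)

lemma minus_zero: "x \<in> carrier A \<Longrightarrow> x \<ominus> \<zero> = x"
  by (simp add: M.minus_eq M.minus_zero)

lemma minus_add_minus:
  "x \<in> carrier A \<Longrightarrow> y \<in> carrier A \<Longrightarrow> z \<in> carrier A \<Longrightarrow> x \<ominus> z = (x \<ominus> y) \<oplus> (y \<ominus> z)"
  by (simp add: M.minus_eq M.a_assoc M.r_neg1)

lemma add_minus_add:
  assumes "x \<in> carrier A" "y \<in> carrier A" "u \<in> carrier A" "v \<in> carrier A"
  shows "(x \<oplus> y) \<ominus> (u \<oplus> v) = (x \<ominus> u) \<oplus> (y \<ominus> v)"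
  using assms by (simp add: M.minus_eq M.minus_add M.a_ac closed)

lemma minus_eq_zero_iff:
  assumes "x \<in> carrier A" "y \<in> carrier A"
  shows "x \<ominus> y = \<zero> \<longleftrightarrow> x = y"
proof
  assume h: "x \<ominus> y = \<zero>"
  have "x \<ominus> \<zero> = (x \<ominus> y) \<oplus> (y \<ominus> \<zero>)" using minus_add_minus assms closed by metis
  then show "x = y" using h assms by (simp add: minus_zero)
qed (use assms minus_self in auto)

lemma nrm_zero: "nrm A \<zero> = 0"
  using nrm_eq_0 closed by auto

lemma nrm_minus_commute: "x \<in> carrier A \<Longrightarrow> y \<in> carrier A \<Longrightarrow> nrm A (x \<ominus> y) = nrm A (y \<ominus> x)"
  using nrm_smult[of "y \<ominus> x" "- 1"] smult_minus[of y x "- 1"]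
  by (simp add: closed minus_eq_smult smult_smult smult_1 M.a_comm)

lemma nrm_minus_triangle:
  assumes "x \<in> carrier A" "y \<in> carrier A" "z \<in> carrier A"
  shows "nrm A (x \<ominus> z) \<le> nrm A (x \<ominus> y) + nrm A (y \<ominus> z)"
  using nrm_triangle[of "x \<ominus> y" "y \<ominus> z"] minus_add_minus[OF assms] assms closed by simp

lemma nrm_le_minus:
  assumes "x \<in> carrier A" "y \<in> carrier A"
  shows "nrm A x \<le> nrm A y + nrm A (x \<ominus> y)"
  using nrm_minus_triangle[of x y \<zero>] assms closed by (simp add: minus_zero)

text \<open>By the C*-identity the squared norm of x is at most the norm of its adjoint times the
  norm of x; divide by the latter.\<close>

lemma nrm_adj_le: 
  assumes x: "x \<in> carrier A"
  shows "nrm A x \<le> nrm A (adj A x)"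
proof (cases "nrm A x = 0")
  case True
  then show ?thesis using nrm_nonneg closed x by simp
next
  case False
  then have p: "nrm A x > 0" using nrm_nonneg[OF x] by simp
  have "nrm A x * nrm A x \<le> nrm A (adj A x) * nrm A x"
    using cstar_identity[OF x] nrm_mult[of "adj A x" x] x closed by (simp add: power2_eq_square)
  then show ?thesis using p by simp
qed

lemma nrm_adj: "x \<in> carrier A \<Longrightarrow> nrm A (adj A x) = nrm A x"
  using nrm_adj_le[of x] nrm_adj_le[of "adj A x"] adj_adj closed by (simp add: order_antisym)

section \<open>The norm metric, closures and fixed points\<close>

sublocale MS: Metric_space "carrier A" "cdist A"
proof
  show "0 \<le> cdist A x y" for x y
    unfolding cdist_def using nrm_nonneg closed by auto
  show "cdist A x y = cdist A y x" for x y
    unfolding cdist_def using nrm_minus_commute by auto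
  show "(cdist A x y = 0) = (x = y)" if "x \<in> carrier A" "y \<in> carrier A" for x y
    using that unfolding cdist_def by (simp add: nrm_eq_0 closed minus_eq_zero_iff)
  show "cdist A x z \<le> cdist A x y + cdist A y z"
    if "x \<in> carrier A" "y \<in> carrier A" "z \<in> carrier A" for x y z
    using that unfolding cdist_def by (simp add: nrm_minus_triangle)
qed

lemma closure_iff:
  assumes "V \<subseteq> carrier A"
  shows "x \<in> norm_topology A closure_of V \<longleftrightarrow>
    x \<in> carrier A \<and> (\<forall>e>0. \<exists>v\<in>V. nrm A (x \<ominus> v) < e)"
proof -
  have "x \<in> carrier A \<Longrightarrow> v \<in> V \<Longrightarrow> v \<in> MS.mball x e \<longleftrightarrow> nrm A (x \<ominus> v) < e" for v e
    using assms by (auto simp: MS.in_mball cdist_def)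
  then show ?thesis unfolding MS.metric_closure_of by auto
qed

lemma closedinI:
  assumes "V \<subseteq> carrier A"
    "\<And>x. x \<in> carrier A \<Longrightarrow> (\<And>e. e > 0 \<Longrightarrow> \<exists>v\<in>V. nrm A (x \<ominus> v) < e) \<Longrightarrow> x \<in> V"
  shows "closedin (norm_topology A) V"
proof -
  have "norm_topology A closure_of V = V"
    using closure_iff[OF assms(1)] assms(2) closure_of_subset[of V "norm_topology A"] assms(1) by auto
  then show ?thesis by (metis closedin_closure_of)
qed

text \<open>Banach's theorem on a closed subset. The subset is a closed subalgebra in the use of
  \<open>quasi_inverse\<close> for characters, and a ball of self-adjoint elements in
  \<open>positive_root\<close>.\<close>

lemma contraction_fixpoint:
  assumes V: "closedin (norm_topology A) V" "V \<noteq> {}" and f: "\<And>x. x \<in> V \<Longrightarrow> f x \<in> V" and q: "q < 1"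
    and c: "\<And>x y. x \<in> V \<Longrightarrow> y \<in> V \<Longrightarrow> nrm A (f x \<ominus> f y) \<le> q * nrm A (x \<ominus> y)"
  obtains x where "x \<in> V" "f x = x"
proof -
  have Vc: "V \<subseteq> carrier A" using closedin_subset[OF V(1)] by simp
  interpret S: Submetric "carrier A" "cdist A" V
    by unfold_locales (rule Vc)
  have "S.sub.mcomplete" using S.closedin_mcomplete_imp_mcomplete V(1) complete by auto
  then show ?thesis
    by (rule S.sub.Banach_fixedpoint_thm[OF _ V(2) _ q, of f])
      (use c f Vc that in \<open>auto simp: cdist_def subset_iff\<close>)
qed

text \<open>In the unitization the equation reads (1 - a)(1 + b) = 1. The map b to a + a b contracts
  by the norm of a and preserves V, so the solution stays where a character is defined.\<close>

lemma quasi_inverse: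
  assumes V: "closedin (norm_topology A) V" "\<And>x y. x \<in> V \<Longrightarrow> y \<in> V \<Longrightarrow> x \<oplus> y \<in> V"
    "\<And>x y. x \<in> V \<Longrightarrow> y \<in> V \<Longrightarrow> x \<otimes> y \<in> V"
    and a: "a \<in> V" "nrm A a < 1"
  obtains b where "b \<in> V" "b = a \<oplus> a \<otimes> b"
proof -
  have Vc: "x \<in> carrier A" if "x \<in> V" for x using closedin_subset[OF V(1)] that by auto
  obtain b where "b \<in> V" "a \<oplus> a \<otimes> b = b"
  proof (rule contraction_fixpoint[OF V(1) _ _ a(2), of "\<lambda>b. a \<oplus> a \<otimes> b"])
    show "V \<noteq> {}" "x \<in> V \<Longrightarrow> a \<oplus> a \<otimes> x \<in> V" for x using V a by auto
    fix x y assume xy: "x \<in> V" "y \<in> V"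
    have "(a \<oplus> a \<otimes> x) \<ominus> (a \<oplus> a \<otimes> y) = a \<otimes> (x \<ominus> y)"
      using add_minus_add[of a "a \<otimes> x" a "a \<otimes> y"] minus_self[of a] xy a Vc
      by (simp add: closed mult_minus_right)
    then show "nrm A ((a \<oplus> a \<otimes> x) \<ominus> (a \<oplus> a \<otimes> y)) \<le> nrm A a * nrm A (x \<ominus> y)"
      using nrm_mult[of a "x \<ominus> y"] xy a Vc closed by simp
  qed auto
  then show ?thesis using that by metis
qed

text \<open>
  In the unitization, \<open>b\<close> solves \<open>(1 - b)\<^sup>2 = 1 - a\<^sup>* a\<close>; so \<open>1 - a\<^sup>* a\<close> is positive without any
  spectral theory.
\<close>
lemma positive_root:
  assumes a: "a \<in> carrier A" "nrm A a < 1"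
  obtains b where "b \<in> carrier A" "adj A b = b" "b \<oplus> b = adj A a \<otimes> a \<oplus> b \<otimes> b"
proof -
  let ?h = "adj A a \<otimes> a"
  define t where "t = (nrm A a)\<^sup>2"
  have h: "?h \<in> carrier A" "adj A ?h = ?h" "nrm A ?h = t"
    using a closed adj_mult adj_adj cstar_identity t_def by auto
  have t: "0 \<le> t" "t < 1"
    using a nrm_nonneg[OF a(1)] unfolding t_def by (auto simp: power_less_one_iff abs_square_less_1)
  \<comment> \<open>On self-adjoint elements of norm at most t the map f is a self-map, because (t +
    t^2)/2 \<le> t, and it contracts by the factor t.\<close>
  define V where "V = {b \<in> carrier A. adj A b = b \<and> nrm A b \<le> t}"
  \<comment> \<open>The equation (1 - b)^2 = 1 - a^* a rearranged as b = (a^* a + b^2)/2.\<close>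
  define f where "f b = (1/2) \<odot> (?h \<oplus> b \<otimes> b)" for b
  have V: "closedin (norm_topology A) V"
  proof (rule closedinI)
    show "V \<subseteq> carrier A" unfolding V_def by auto
    fix x assume x: "x \<in> carrier A" "\<And>e. e > 0 \<Longrightarrow> \<exists>v\<in>V. nrm A (x \<ominus> v) < e"
    have "nrm A x \<le> t + e" if e: "e > 0" for e
    proof -
      obtain v where v: "v \<in> V" "nrm A (x \<ominus> v) < e" using x(2) e by blast
      then show ?thesis using nrm_le_minus[OF x(1), of v] unfolding V_def by auto
    qed
    then have "nrm A x \<le> t" by (rule field_le_epsilon)
    moreover have "nrm A (adj A x \<ominus> x) \<le> 0 + e" if e: "e > 0" for e
    proof -
      obtain v where v: "v \<in> V" "nrm A (x \<ominus> v) < e / 2" using x(2)[of "e / 2"] e by auto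
      then have vc: "v \<in> carrier A" "adj A v = v" unfolding V_def by auto
      have "nrm A (adj A x \<ominus> v) = nrm A (x \<ominus> v)"
        using nrm_adj[of "x \<ominus> v"] adj_minus[OF x(1) vc(1)] vc x closed by simp
      then show ?thesis
        using nrm_minus_triangle[of "adj A x" v x] nrm_minus_commute[OF vc(1) x(1)] v x vc closed by simp
    qed
    then have "nrm A (adj A x \<ominus> x) \<le> 0" by (rule field_le_epsilon)
    then have "adj A x = x"
      using nrm_nonneg[of "adj A x \<ominus> x"] nrm_eq_0[of "adj A x \<ominus> x"] minus_eq_zero_iff[of "adj A x" x] x closed
      by simp
    ultimately show "x \<in> V" unfolding V_def using x by auto
  qed
  obtain b where b: "b \<in> V" "f b = b"
  proof (rule contraction_fixpoint[OF V _ _ t(2), of f])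
    show "V \<noteq> {}" unfolding V_def using closed adj_zero nrm_zero t by auto
  next
    fix x assume x: "x \<in> V"
    then have xc: "x \<in> carrier A" "adj A x = x" "nrm A x \<le> t" unfolding V_def by auto
    have "nrm A (?h \<oplus> x \<otimes> x) \<le> t + t * t"
      using nrm_triangle[of ?h "x \<otimes> x"] nrm_mult[of x x] mult_mono[of "nrm A x" t "nrm A x" t] xc h t
        nrm_nonneg[of x] closed by simp
    also have "t * t \<le> t" using t by (simp add: mult_left_le)
    finally have "nrm A (?h \<oplus> x \<otimes> x) \<le> 2 * t" by simp
    then have "nrm A (f x) \<le> t" unfolding f_def using nrm_smult[of "?h \<oplus> x \<otimes> x" "1/2"] xc h closed by simp
    moreover have "adj A (f x) = f x"
      unfolding f_def using adj_smult[of "?h \<oplus> x \<otimes> x" "1/2"] adj_add[of ?h "x \<otimes> x"] adj_mult[of x x] xc h closed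
      by simp
    ultimately show "f x \<in> V" unfolding V_def f_def using xc h closed by auto
  next
    fix x y assume "x \<in> V" "y \<in> V"
    then have c: "x \<in> carrier A" "nrm A x \<le> t" "y \<in> carrier A" "nrm A y \<le> t" unfolding V_def by auto
    let ?n = "nrm A (x \<ominus> y)"
    have n0: "0 \<le> ?n" using nrm_nonneg c closed by simp
    have "f x \<ominus> f y = (1/2) \<odot> ((?h \<oplus> x \<otimes> x) \<ominus> (?h \<oplus> y \<otimes> y))"
      unfolding f_def by (rule smult_minus[symmetric]) (use h c closed in auto)
    also have "(?h \<oplus> x \<otimes> x) \<ominus> (?h \<oplus> y \<otimes> y) = x \<otimes> x \<ominus> y \<otimes> y"
      using add_minus_add[of ?h "x \<otimes> x" ?h "y \<otimes> y"] minus_self[of ?h] h c closed by simp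
    \<comment> \<open>Without commutativity a difference of squares does not factor; this split
      takes its place.\<close>
    also have "\<dots> = x \<otimes> (x \<ominus> y) \<oplus> (x \<ominus> y) \<otimes> y"
      using minus_add_minus[of "x \<otimes> x" "x \<otimes> y" "y \<otimes> y"] mult_minus_left[of x y y] mult_minus_right[of x y x] c closed
      by simp
    finally have "nrm A (f x \<ominus> f y) = 1/2 * nrm A (x \<otimes> (x \<ominus> y) \<oplus> (x \<ominus> y) \<otimes> y)"
      using nrm_smult[of "x \<otimes> (x \<ominus> y) \<oplus> (x \<ominus> y) \<otimes> y" "1/2"] c closed by simp
    also have "\<dots> \<le> 1/2 * (nrm A x * ?n + ?n * nrm A y)"
      using nrm_triangle[of "x \<otimes> (x \<ominus> y)" "(x \<ominus> y) \<otimes> y"] nrm_mult[of x "x \<ominus> y"] nrm_mult[of "x \<ominus> y" y] c closed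
      by simp
    also have "\<dots> \<le> 1/2 * (t * ?n + ?n * t)"
      using c n0 by (intro mult_left_mono add_mono mult_right_mono) auto
    finally show "nrm A (f x \<ominus> f y) \<le> t * ?n" by simp
  qed auto
  have bc: "b \<in> carrier A" "adj A b = b" using b unfolding V_def by auto
  have "b \<oplus> b = 2 \<odot> f b"
    using smult_add_left[OF bc(1), of 1 1] smult_1 bc b by simp
  also have "\<dots> = ?h \<oplus> b \<otimes> b"
    unfolding f_def using smult_smult[of "?h \<oplus> b \<otimes> b" 2 "1/2"] smult_1[of "?h \<oplus> b \<otimes> b"] h bc closed by simp
  finally show ?thesis using that bc by blast
qed

section \<open>Spans, closed spans and generated subalgebras\<close>

lemma subspace_carrier: "subspace_of A (carrier A)"
  unfolding subspace_of_def using closed by auto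

lemma subspaceI:
  assumes "V \<subseteq> carrier A" "\<zero> \<in> V" "\<And>x y. x \<in> V \<Longrightarrow> y \<in> V \<Longrightarrow> x \<oplus> y \<in> V"
    "\<And>c x. x \<in> V \<Longrightarrow> c \<odot> x \<in> V"
  shows "subspace_of A V"
  using assms unfolding subspace_of_def by auto

lemma subspaceD:
  assumes "subspace_of A V"
  shows "V \<subseteq> carrier A" "\<zero> \<in> V" "x \<in> V \<Longrightarrow> y \<in> V \<Longrightarrow> x \<oplus> y \<in> V" "x \<in> V \<Longrightarrow> c \<odot> x \<in> V"
    "x \<in> V \<Longrightarrow> y \<in> V \<Longrightarrow> x \<ominus> y \<in> V"
proof -
  show *: "V \<subseteq> carrier A" "\<zero> \<in> V" "x \<in> V \<Longrightarrow> y \<in> V \<Longrightarrow> x \<oplus> y \<in> V" "x \<in> V \<Longrightarrow> c \<odot> x \<in> V" for x y c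
    using assms unfolding subspace_of_def by auto
  show "x \<ominus> y \<in> V" if "x \<in> V" "y \<in> V" using *(3)[OF that(1) *(4)[OF that(2), of "- 1"]]
      minus_eq_smult[OF subsetD[OF *(1) that(1)] subsetD[OF *(1) that(2)]] by simp
qed

lemma subspace_span:
  assumes "S \<subseteq> carrier A"
  shows "subspace_of A (subspace_of A hull S)"
proof -
  have "subspace_of A (\<Inter>T)" if "\<And>V. V \<in> T \<Longrightarrow> subspace_of A V" "T \<noteq> {}" for T
    using that unfolding subspace_of_def by blast
  moreover have "carrier A \<in> {t. subspace_of A t \<and> S \<subseteq> t}" using subspace_carrier assms by auto
  ultimately show ?thesis unfolding hull_def by (metis (mono_tags, lifting) empty_iff mem_Collect_eq)
qed

lemma span_subset: "subspace_of A V \<Longrightarrow> S \<subseteq> V \<Longrightarrow> subspace_of A hull S \<subseteq> V"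
  by (rule hull_minimal)

text \<open>One factor is extended from S to the span at a time. The hypothesis asks only that
  products of generators lie in the span, because a product of two range projections is a sum of
  range projections.\<close>

lemma span_mult:
  assumes S: "S \<subseteq> carrier A" "\<And>x y. x \<in> S \<Longrightarrow> y \<in> S \<Longrightarrow> x \<otimes> y \<in> subspace_of A hull S"
    and x: "x \<in> subspace_of A hull S" and y: "y \<in> subspace_of A hull S"
  shows "x \<otimes> y \<in> subspace_of A hull S"
proof -
  let ?V = "subspace_of A hull S"
  note D = subspaceD[OF subspace_span[OF S(1)]]
  have "subspace_of A {x \<in> carrier A. \<forall>y\<in>S. x \<otimes> y \<in> ?V}"
    by (rule subspaceI)
      (use closed mult_add_left smult_mult_left mult_zero_left S(1) D in \<open>auto simp: subset_iff\<close>)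
  then have 1: "?V \<subseteq> {x \<in> carrier A. \<forall>y\<in>S. x \<otimes> y \<in> ?V}"
    by (rule span_subset) (use S in auto)
  have "subspace_of A {y \<in> carrier A. \<forall>x\<in>?V. x \<otimes> y \<in> ?V}"
    by (rule subspaceI)
      (use closed mult_add_right smult_mult_right mult_zero_right D in \<open>auto simp: subset_iff\<close>)
  then have "?V \<subseteq> {y \<in> carrier A. \<forall>x\<in>?V. x \<otimes> y \<in> ?V}"
    by (rule span_subset) (use S 1 in auto)
  then show ?thesis using x y by auto
qed

lemma span_adj:
  assumes S: "S \<subseteq> carrier A" "\<And>x. x \<in> S \<Longrightarrow> adj A x \<in> S" and x: "x \<in> subspace_of A hull S"
  shows "adj A x \<in> subspace_of A hull S"
proof -
  let ?V = "subspace_of A hull S"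
  note D = subspaceD[OF subspace_span[OF S(1)]]
  have "subspace_of A {x \<in> carrier A. adj A x \<in> ?V}"
    by (rule subspaceI)
      (use closed adj_add adj_smult adj_zero D in \<open>auto simp: subset_iff\<close>)
  then have "?V \<subseteq> {x \<in> carrier A. adj A x \<in> ?V}"
    by (rule span_subset) (use S hull_inc in fastforce)
  then show ?thesis using x by auto
qed

lemma closed_span_iff:
  assumes "S \<subseteq> carrier A"
  shows "x \<in> closed_span A S \<longleftrightarrow>
    x \<in> carrier A \<and> (\<forall>e>0. \<exists>v\<in>subspace_of A hull S. nrm A (x \<ominus> v) < e)"
  unfolding closed_span_def
  using closure_iff subspaceD(1)[OF subspace_span[OF assms]] by blast

lemma span_subset_closed_span:
  assumes "S \<subseteq> carrier A"
  shows "subspace_of A hull S \<subseteq> closed_span A S"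
  unfolding closed_span_def
  using closure_of_subset[of "subspace_of A hull S" "norm_topology A"] subspaceD(1)[OF subspace_span[OF assms]]
  by simp

lemma closed_span_subset:
  assumes "closedin (norm_topology A) V" "subspace_of A V" "S \<subseteq> V"
  shows "closed_span A S \<subseteq> V"
  unfolding closed_span_def using closure_of_minimal[OF span_subset[OF assms(2,3)] assms(1)] .

lemma subalgebra_closed_span:
  assumes S: "S \<subseteq> carrier A" "\<And>x y. x \<in> S \<Longrightarrow> y \<in> S \<Longrightarrow> x \<otimes> y \<in> subspace_of A hull S"
    "\<And>x. x \<in> S \<Longrightarrow> adj A x \<in> S"
  shows "cstar_subalgebra_of A (closed_span A S)"
proof -
  let ?V = "subspace_of A hull S" and ?W = "closed_span A S"
  note D = subspaceD[OF subspace_span[OF S(1)]]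
  note W = closed_span_iff[OF S(1)]
  have Vc: "v \<in> carrier A" if "v \<in> ?V" for v using D(1) that by auto
  have Wc: "v \<in> carrier A" if "v \<in> ?W" for v using W that by auto
  have add: "x \<oplus> y \<in> ?W" if xy: "x \<in> ?W" "y \<in> ?W" for x y
  proof -
    have "\<exists>v\<in>?V. nrm A ((x \<oplus> y) \<ominus> v) < e" if e: "e > 0" for e
    proof -
      obtain u v where uv: "u \<in> ?V" "v \<in> ?V" "nrm A (x \<ominus> u) < e/2" "nrm A (y \<ominus> v) < e/2"
        using W xy e half_gt_zero by metis
      have "nrm A ((x \<oplus> y) \<ominus> (u \<oplus> v)) < e"
        using nrm_triangle[of "x \<ominus> u" "y \<ominus> v"] add_minus_add[of x y u v] uv xy Vc Wc closed by simp
      then show ?thesis using D(3) uv by blast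
    qed
    then show ?thesis using W Wc xy closed by auto
  qed
  have smult: "c \<odot> x \<in> ?W" if x: "x \<in> ?W" for c x
  proof -
    have "\<exists>v\<in>?V. nrm A (c \<odot> x \<ominus> v) < e" if e: "e > 0" for e
    proof -
      \<comment> \<open>The added 1 keeps the denominator positive when c = 0.\<close>
      obtain u where u: "u \<in> ?V" "nrm A (x \<ominus> u) < e / (cmod c + 1)"
        using W x e by (metis add.commute add_pos_nonneg divide_pos_pos norm_ge_zero zero_less_one)
      have "nrm A (c \<odot> x \<ominus> c \<odot> u) = cmod c * nrm A (x \<ominus> u)"
        using smult_minus nrm_smult u x Vc Wc closed by metis
      also have "\<dots> \<le> (cmod c + 1) * nrm A (x \<ominus> u)"
        using nrm_nonneg[of "x \<ominus> u"] u x Vc Wc closed by (simp add: mult_right_mono)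
      also have "\<dots> < e" using u(2) by (simp add: less_divide_eq mult.commute add_nonneg_pos split: if_splits)
      finally show ?thesis using D(4) u by blast
    qed
    then show ?thesis using W Wc x closed by auto
  qed
  have mult: "x \<otimes> y \<in> ?W" if xy: "x \<in> ?W" "y \<in> ?W" for x y
  proof -
    have "\<exists>v\<in>?V. nrm A (x \<otimes> y \<ominus> v) < e" if e: "e > 0" for e
    proof -
      \<comment> \<open>K bounds the norm of x and, since approximants within distance 1 are chosen,
        that of v; d then makes the error 2 K d at most e.\<close>
      define K where "K = nrm A x + nrm A y + 1"
      have K: "K > 0" "nrm A x \<le> K" "nrm A y + 1 \<le> K"
        unfolding K_def using nrm_nonneg[of x] nrm_nonneg[of y] Wc xy by auto
      define d where "d = min 1 (e / (2 * K))"
      have d: "d > 0" "d \<le> 1" "d \<le> e / (2 * K)" unfolding d_def using e K by auto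
      obtain u v where uv: "u \<in> ?V" "v \<in> ?V" "nrm A (x \<ominus> u) < d" "nrm A (y \<ominus> v) < d"
        using W xy d by metis
      note c = Vc[OF uv(1)] Vc[OF uv(2)] Wc[OF xy(1)] Wc[OF xy(2)]
      have nv: "nrm A v \<le> K"
        using nrm_le_minus[of v y] nrm_minus_commute[of v y] c uv d K by simp
      have "x \<otimes> y \<ominus> u \<otimes> v = x \<otimes> (y \<ominus> v) \<oplus> (x \<ominus> u) \<otimes> v"
        using minus_add_minus[of "x \<otimes> y" "x \<otimes> v" "u \<otimes> v"] mult_minus_left[of x u v] mult_minus_right[of y v x] c closed
        by simp
      then have "nrm A (x \<otimes> y \<ominus> u \<otimes> v) \<le> nrm A x * nrm A (y \<ominus> v) + nrm A (x \<ominus> u) * nrm A v"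
        using nrm_triangle[of "x \<otimes> (y \<ominus> v)" "(x \<ominus> u) \<otimes> v"] nrm_mult[of x "y \<ominus> v"] nrm_mult[of "x \<ominus> u" v] c closed
        by simp
      also have "\<dots> \<le> K * nrm A (y \<ominus> v) + nrm A (x \<ominus> u) * K"
        using K nv nrm_nonneg[of "y \<ominus> v"] nrm_nonneg[of "x \<ominus> u"] c closed
        by (intro add_mono mult_right_mono mult_left_mono) auto
      also have "\<dots> < K * d + d * K"
        using K uv by (intro add_strict_mono mult_strict_left_mono mult_strict_right_mono) auto
      also have "\<dots> \<le> e" using d(3) K(1) by (simp add: le_divide_eq mult_ac)
      finally show ?thesis using span_mult[OF S(1,2) uv(1,2)] by blast
    qed
    then show ?thesis using W Wc xy closed by auto
  qed
  have adj: "adj A x \<in> ?W" if x: "x \<in> ?W" for x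
  proof -
    have "\<exists>v\<in>?V. nrm A (adj A x \<ominus> v) < e" if e: "e > 0" for e
    proof -
      obtain u where u: "u \<in> ?V" "nrm A (x \<ominus> u) < e" using W x e by blast
      have "nrm A (adj A x \<ominus> adj A u) = nrm A (x \<ominus> u)"
        using adj_minus nrm_adj u x Vc Wc closed by metis
      then show ?thesis using span_adj[OF S(1,3) u(1)] u(2) by metis
    qed
    then show ?thesis using W Wc x closed by auto
  qed
  have clo: "closedin (norm_topology A) ?W" unfolding closed_span_def by simp
  have zero: "\<zero> \<in> ?W" using span_subset_closed_span[OF S(1)] D(2) by auto
  have "subspace_of A ?W"
    by (rule subspaceI) (use Wc in blast, fact zero, fact add, fact smult)
  then show ?thesis
    unfolding cstar_subalgebra_of_def using mult adj clo by blast
qed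

text \<open>Norm limits of linear combinations already form a C*-subalgebra, and every C*-subalgebra
  containing S contains them. For the range projections this is the formula for D as a closed
  span.\<close>

lemma generated_eq_closed_span:
  assumes S: "S \<subseteq> carrier A" "\<And>x y. x \<in> S \<Longrightarrow> y \<in> S \<Longrightarrow> x \<otimes> y \<in> subspace_of A hull S"
    "\<And>x. x \<in> S \<Longrightarrow> adj A x \<in> S"
  shows "carrier (generated_cstar A S) = closed_span A S"
proof -
  have "cstar_subalgebra_of A hull S = closed_span A S"
  proof (rule hull_unique)
    show "S \<subseteq> closed_span A S"
      using order_trans[OF hull_subset span_subset_closed_span[OF S(1)]] .
    show "cstar_subalgebra_of A (closed_span A S)" by (rule subalgebra_closed_span[OF S])
    fix T assume "S \<subseteq> T" "cstar_subalgebra_of A T"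
    then show "closed_span A S \<subseteq> T"
      using closed_span_subset[of T S] unfolding cstar_subalgebra_of_def by blast
  qed
  then show ?thesis unfolding generated_cstar_def by simp
qed

text \<open>If the bound failed at a, a multiple c of a would have norm below 1 and value 1. Its
  quasi-inverse b = c + c b would then satisfy \<phi>(b) = 1 + \<phi>(b).\<close>

lemma character_contractive:
  fixes \<phi> :: "'b \<Rightarrow> complex"
  assumes V: "cstar_subalgebra_of A V"
    and f: "\<And>x y. x \<in> V \<Longrightarrow> y \<in> V \<Longrightarrow> \<phi> (x \<oplus> y) = \<phi> x + \<phi> y"
      "\<And>x y. x \<in> V \<Longrightarrow> y \<in> V \<Longrightarrow> \<phi> (x \<otimes> y) = \<phi> x * \<phi> y"
      "\<And>c x. x \<in> V \<Longrightarrow> \<phi> (c \<odot> x) = c * \<phi> x"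
    and a: "a \<in> V"
  shows "cmod (\<phi> a) \<le> nrm A a"
proof (rule ccontr)
  assume "\<not> ?thesis"
  then have n: "nrm A a < cmod (\<phi> a)" by simp
  have Vs: "closedin (norm_topology A) V" "subspace_of A V" "\<And>x y. x \<in> V \<Longrightarrow> y \<in> V \<Longrightarrow> x \<otimes> y \<in> V"
    using V unfolding cstar_subalgebra_of_def by auto
  note D = subspaceD[OF Vs(2)]
  have ac: "a \<in> carrier A" using D(1) a by auto
  then have p: "0 < cmod (\<phi> a)" using n nrm_nonneg by (meson le_less_trans)
  let ?c = "inverse (\<phi> a) \<odot> a"
  have c: "?c \<in> V" "\<phi> ?c = 1" using D a f p by auto
  have "nrm A ?c < 1" using nrm_smult[OF ac, of "inverse (\<phi> a)"] n p
    by (simp only: norm_inverse) (simp add: field_simps)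
  then obtain b where b: "b \<in> V" "b = ?c \<oplus> ?c \<otimes> b"
    using quasi_inverse[OF Vs(1) D(3) Vs(3) c(1)] by metis
  then have "\<phi> b = \<phi> ?c + \<phi> ?c * \<phi> b" using f c Vs(3) by metis
  then show False using c(2) by simp
qed

end

section \<open>The Hilbert space of square-summable sequences\<close>

text \<open>One sequence space over the natural numbers serves all countable orbits. Its vectors are
  functions from nat to complex, so that its operators can be coded in
  \<open>universe\<close>.\<close>

typedef ell2 = "{f :: nat \<Rightarrow> complex. (\<lambda>n. (cmod (f n))\<^sup>2) summable_on UNIV}"
  morphisms coord Ell2
  by (rule exI[of _ "\<lambda>_. 0"]) (simp add: summable_on_0)

lemma coord_summable: "(\<lambda>n. (cmod (coord f n))\<^sup>2) summable_on UNIV"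
  using coord[of f] by simp

lemma ell2_eqI: "(\<And>n. coord f n = coord g n) \<Longrightarrow> f = g"
  using coord_inject by blast

lemma summable_of_square_summable:
  fixes h :: "'a \<Rightarrow> real"
  assumes "f summable_on A" "g summable_on A" "\<And>x. x \<in> A \<Longrightarrow> \<bar>h x\<bar> \<le> f x + g x"
  shows "h summable_on A"
proof -
  have "(\<lambda>x. f x + g x) summable_on A" using assms summable_on_add by blast
  then have "(\<lambda>x. norm (h x)) summable_on A"
    by (rule summable_on_comparison_test) (use assms in auto)
  then show ?thesis using summable_on_iff_abs_summable_on_real by blast
qed

lemma inner_le_squares: "\<bar>x \<bullet> y\<bar> \<le> (norm x)\<^sup>2 + (norm y)\<^sup>2"
proof -
  have "\<bar>x \<bullet> y\<bar> \<le> norm x * norm y" by (rule Cauchy_Schwarz_ineq2)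
  also have "\<dots> \<le> (norm x)\<^sup>2 + (norm y)\<^sup>2"
    using sum_squares_bound[of "norm x" "norm y"] norm_ge_zero[of x] norm_ge_zero[of y]
      mult_nonneg_nonneg[of "norm x" "norm y"] by linarith
  finally show ?thesis .
qed

lemma inner_summable: "(\<lambda>n. coord f n \<bullet> coord g n) summable_on UNIV"
  by (rule summable_of_square_summable[OF coord_summable coord_summable]) (rule inner_le_squares)

lemma norm_add_squares: "(norm (x + y))\<^sup>2 \<le> 2 * (norm x)\<^sup>2 + 2 * (norm y)\<^sup>2" for x y :: "'a::real_inner"
proof -
  have "(norm (x + y))\<^sup>2 = (norm x)\<^sup>2 + (norm y)\<^sup>2 + 2 * (x \<bullet> y)"
    by (simp add: power2_norm_eq_inner inner_add inner_commute)
  moreover have "2 * (x \<bullet> y) \<le> (norm x)\<^sup>2 + (norm y)\<^sup>2"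
    using Cauchy_Schwarz_ineq2[of x y] sum_squares_bound[of "norm x" "norm y"] by linarith
  ultimately show ?thesis by linarith
qed

lemma coord_Ell2_add: "coord (Ell2 (\<lambda>n. coord f n + coord g n)) n = coord f n + coord g n"
proof -
  have "(\<lambda>n. (cmod (coord f n + coord g n))\<^sup>2) summable_on UNIV"
    by (rule summable_of_square_summable[OF summable_on_cmult_right[OF coord_summable[of f], of 2]
      summable_on_cmult_right[OF coord_summable[of g], of 2]]) (simp add: norm_add_squares)
  then show ?thesis by (simp add: Ell2_inverse)
qed

definition cscale :: "complex \<Rightarrow> ell2 \<Rightarrow> ell2" where
  "cscale c f = Ell2 (\<lambda>n. c * coord f n)"

lemma coord_cscale [simp]: "coord (cscale c f) n = c * coord f n"
proof -
  have "(\<lambda>n. (cmod (c * coord f n))\<^sup>2) summable_on UNIV"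
    using summable_on_cmult_right[OF coord_summable, of "(cmod c)\<^sup>2"]
    by (simp add: norm_mult power_mult_distrib)
  then show ?thesis unfolding cscale_def by (simp add: Ell2_inverse)
qed

text \<open>The real part of the complex inner product. It makes the type an instance of the real
  classes on which bounded operators are built; the complex structure is carried separately by
  \<open>cscale\<close>.\<close>

instantiation ell2 :: real_inner
begin

definition zero_ell2 :: ell2 where "0 = Ell2 (\<lambda>_. 0)"
definition plus_ell2 :: "ell2 \<Rightarrow> ell2 \<Rightarrow> ell2" where "f + g = Ell2 (\<lambda>n. coord f n + coord g n)"
definition uminus_ell2 :: "ell2 \<Rightarrow> ell2" where "- f = cscale (- 1) f"
definition minus_ell2 :: "ell2 \<Rightarrow> ell2 \<Rightarrow> ell2" where "f - g = f + - g" for f g :: ell2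
definition scaleR_ell2 :: "real \<Rightarrow> ell2 \<Rightarrow> ell2" where "r *\<^sub>R f = cscale (complex_of_real r) f"
definition inner_ell2 :: "ell2 \<Rightarrow> ell2 \<Rightarrow> real" where "f \<bullet> g = infsum (\<lambda>n. coord f n \<bullet> coord g n) UNIV"
definition norm_ell2 :: "ell2 \<Rightarrow> real" where "norm f = sqrt (f \<bullet> f)" for f :: ell2
definition dist_ell2 :: "ell2 \<Rightarrow> ell2 \<Rightarrow> real" where "dist f g = norm (f - g)" for f g :: ell2
definition sgn_ell2 :: "ell2 \<Rightarrow> ell2" where "sgn f = inverse (norm f) *\<^sub>R f" for f :: ell2
definition uniformity_ell2 :: "(ell2 \<times> ell2) filter" where
  "uniformity_ell2 = (INF e\<in>{0<..}. principal {(f, g). dist f g < e})"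
definition open_ell2 :: "ell2 set \<Rightarrow> bool" where
  "open_ell2 U \<longleftrightarrow> (\<forall>f\<in>U. eventually (\<lambda>(f', g). f' = f \<longrightarrow> g \<in> U) uniformity)"

lemma coord_zero [simp]: "coord 0 n = 0"
  unfolding zero_ell2_def by (simp add: Ell2_inverse summable_on_0)

lemma coord_plus [simp]: "coord (f + g) n = coord f n + coord g n"
  unfolding plus_ell2_def by (rule coord_Ell2_add)

lemma coord_uminus [simp]: "coord (- f) n = - coord f n"
  unfolding uminus_ell2_def by simp

lemma coord_minus [simp]: "coord (f - g) n = coord f n - coord g n"
  unfolding minus_ell2_def by simp

lemma coord_scaleR [simp]: "coord (r *\<^sub>R f) n = complex_of_real r * coord f n"
  unfolding scaleR_ell2_def by simp

instance
proof
  fix f g h :: ell2 and r r' :: real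
  show "f + g + h = f + (g + h)" "f + g = g + f" "0 + f = f" "- f + f = 0" "f - g = f + - g"
    "r *\<^sub>R (f + g) = r *\<^sub>R f + r *\<^sub>R g" "(r + r') *\<^sub>R f = r *\<^sub>R f + r' *\<^sub>R f"
    "r *\<^sub>R r' *\<^sub>R f = (r * r') *\<^sub>R f" "1 *\<^sub>R f = f"
    by (rule ell2_eqI, simp add: algebra_simps)+
  show "sgn f = inverse (norm f) *\<^sub>R f" "dist f g = norm (f - g)" "norm f = sqrt (f \<bullet> f)"
    unfolding sgn_ell2_def dist_ell2_def norm_ell2_def by simp_all
  show "uniformity = (INF e\<in>{0<..}. principal {(f, g :: ell2). dist f g < e})"
    unfolding uniformity_ell2_def by simp
  show "open U \<longleftrightarrow> (\<forall>f\<in>U. \<forall>\<^sub>F (f', g) in uniformity. f' = f \<longrightarrow> g \<in> U)" for U :: "ell2 set"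
    unfolding open_ell2_def by simp
  show "f \<bullet> g = g \<bullet> f"
    unfolding inner_ell2_def by (simp add: inner_commute)
  show "(f + g) \<bullet> h = f \<bullet> h + g \<bullet> h"
    unfolding inner_ell2_def using infsum_add[OF inner_summable inner_summable]
    by (simp add: inner_add_left)
  have "coord (r *\<^sub>R f) n \<bullet> coord g n = r * (coord f n \<bullet> coord g n)" for n
    by (simp add: scaleR_conv_of_real[symmetric])
  then show "(r *\<^sub>R f) \<bullet> g = r * (f \<bullet> g)"
    unfolding inner_ell2_def by (simp only: infsum_cmult_right')
  show "0 \<le> f \<bullet> f"
    unfolding inner_ell2_def by (rule infsum_nonneg) simp
  show "f \<bullet> f = 0 \<longleftrightarrow> f = 0"
  proof
    assume z: "f \<bullet> f = 0"
    have "coord f n \<bullet> coord f n = 0" for n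
      by (rule nonneg_infsum_le_0D[where f = "\<lambda>n. coord f n \<bullet> coord f n" and A = UNIV])
        (use z inner_summable in \<open>auto simp: inner_ell2_def\<close>)
    then show "f = 0" by (intro ell2_eqI) simp
  qed (simp add: inner_ell2_def)
qed

end

lemma norm_ell2_square: "(norm f)\<^sup>2 = infsum (\<lambda>n. (cmod (coord f n))\<^sup>2) UNIV"
  unfolding power2_norm_eq_inner inner_ell2_def ..

lemma cmod_coord_le: "cmod (coord f n) \<le> norm f"
proof -
  have "(\<Sum>n\<in>{n}. (cmod (coord f n))\<^sup>2) \<le> infsum (\<lambda>n. (cmod (coord f n))\<^sup>2) UNIV"
    by (rule finite_sum_le_infsum[OF coord_summable]) auto
  then show ?thesis using norm_ell2_square[of f] by (simp add: power2_le_imp_le)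
qed

lemma coord_sum: "coord (\<Sum>p\<in>M. F p) n = (\<Sum>p\<in>M. coord (F p) n)"
  by (induction M rule: infinite_finite_induct) auto

text \<open>The limit is taken coordinatewise. Bounds on finite partial sums pass to the limit, and
  they give both the square-summability of the limit and convergence in norm.\<close>

instance ell2 :: banach
proof
  fix X :: "nat \<Rightarrow> ell2"
  assume C: "Cauchy X"
  have "Cauchy (\<lambda>m. coord (X m) n)" for n
  proof (rule metric_CauchyI)
    fix e :: real assume "e > 0"
    then obtain M where M: "\<forall>m\<ge>M. \<forall>m'\<ge>M. dist (X m) (X m') < e" using metric_CauchyD[OF C] by blast
    have "dist (coord (X m) n) (coord (X m') n) \<le> dist (X m) (X m')" for m m'
      using cmod_coord_le[of "X m - X m'" n] by (simp add: dist_norm)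
    then show "\<exists>M. \<forall>m\<ge>M. \<forall>m'\<ge>M. dist (coord (X m) n) (coord (X m') n) < e"
      using M le_less_trans by blast
  qed
  then have "\<exists>l. (\<lambda>m. coord (X m) n) \<longlonglongrightarrow> l" for n
    using Cauchy_convergent convergent_def by blast
  then obtain l where l: "\<And>n. (\<lambda>m. coord (X m) n) \<longlonglongrightarrow> l n" by metis
  have fin: "(\<Sum>n\<in>F. (cmod (coord (X m) n - l n))\<^sup>2) \<le> e\<^sup>2"
    if m: "\<forall>m'\<ge>M. dist (X m) (X m') < e" and F: "finite F" for e M m F
  proof (rule LIMSEQ_le_const2)
    show "(\<lambda>m'. \<Sum>n\<in>F. (cmod (coord (X m) n - coord (X m') n))\<^sup>2) \<longlonglongrightarrow> (\<Sum>n\<in>F. (cmod (coord (X m) n - l n))\<^sup>2)"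
      by (intro tendsto_intros l)
    have "(\<Sum>n\<in>F. (cmod (coord (X m) n - coord (X m') n))\<^sup>2) \<le> e\<^sup>2" if "m' \<ge> M" for m'
    proof -
      have "(\<Sum>n\<in>F. (cmod (coord (X m - X m') n))\<^sup>2) \<le> (norm (X m - X m'))\<^sup>2"
        unfolding norm_ell2_square by (rule finite_sum_le_infsum[OF coord_summable F]) auto
      also have "\<dots> \<le> e\<^sup>2" using m that by (intro power_mono) (auto simp: dist_norm less_imp_le)
      finally show ?thesis by simp
    qed
    then show "\<exists>N. \<forall>m'\<ge>N. (\<Sum>n\<in>F. (cmod (coord (X m) n - coord (X m') n))\<^sup>2) \<le> e\<^sup>2" by blast
  qed
  have diff: "(\<lambda>n. (cmod (coord (X m) n - l n))\<^sup>2) summable_on UNIV"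
    if "\<forall>m'\<ge>M. dist (X m) (X m') < e" for e M m
    by (rule nonneg_bdd_above_summable_on) (use fin[OF that] in \<open>auto intro!: bdd_aboveI2\<close>)
  \<comment> \<open>Tolerance 1 suffices here: \<open>X M1\<close> differs from l by a
    square-summable sequence, so l is square-summable too.\<close>
  obtain M1 where M1: "\<forall>m\<ge>M1. \<forall>m'\<ge>M1. dist (X m) (X m') < 1" using metric_CauchyD[OF C, of 1] by auto
  have "(\<lambda>n. (cmod (l n))\<^sup>2) summable_on UNIV"
  proof (rule summable_of_square_summable)
    show "(\<lambda>n. 2 * (cmod (coord (X M1) n))\<^sup>2) summable_on UNIV"
      by (intro summable_on_cmult_right coord_summable)
    show "(\<lambda>n. 2 * (cmod (coord (X M1) n - l n))\<^sup>2) summable_on UNIV"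
      by (intro summable_on_cmult_right diff[of M1 M1 1]) (use M1 in auto)
    show "\<bar>(cmod (l n))\<^sup>2\<bar> \<le> 2 * (cmod (coord (X M1) n))\<^sup>2 + 2 * (cmod (coord (X M1) n - l n))\<^sup>2" for n
      using norm_add_squares[of "coord (X M1) n" "l n - coord (X M1) n"] by (simp add: norm_minus_commute)
  qed
  then have L: "coord (Ell2 l) n = l n" for n by (simp add: Ell2_inverse)
  have "X \<longlonglongrightarrow> Ell2 l"
  proof (rule metric_LIMSEQ_I)
    fix e :: real assume e: "e > 0"
    then obtain M where M: "\<forall>m\<ge>M. \<forall>m'\<ge>M. dist (X m) (X m') < e / 2"
      using metric_CauchyD[OF C, of "e / 2"] by auto
    have "dist (X m) (Ell2 l) < e" if "m \<ge> M" for m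
    proof -
      have m: "\<forall>m'\<ge>M. dist (X m) (X m') < e / 2" using M that by blast
      have "(norm (X m - Ell2 l))\<^sup>2 \<le> (e / 2)\<^sup>2"
        unfolding norm_ell2_square coord_minus L
        by (rule infsum_le_finite_sums[OF diff[OF m]]) (use fin[OF m] in auto)
      then have "norm (X m - Ell2 l) \<le> e / 2" by (rule power2_le_imp_le) (use e in simp)
      then show ?thesis using e by (simp add: dist_norm)
    qed
    then show "\<exists>M. \<forall>m\<ge>M. dist (X m) (Ell2 l) < e" by blast
  qed
  then show "convergent X" unfolding convergent_def by blast
qed

lemma norm_cscale: "norm (cscale c f) = cmod c * norm f"
proof -
  have "(norm (cscale c f))\<^sup>2 = (cmod c * norm f)\<^sup>2"
    unfolding norm_ell2_square power_mult_distrib coord_cscale norm_mult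
    by (rule infsum_cmult_right')
  then show ?thesis by (metis mult_nonneg_nonneg norm_ge_zero power2_eq_iff_nonneg)
qed

lemma cscale_add: "cscale c (f + g) = cscale c f + cscale c g"
  and cscale_uminus: "cscale c (- f) = - cscale c f"
  and cscale_add_left: "cscale (c + d) f = cscale c f + cscale d f"
  and cscale_cscale: "cscale c (cscale d f) = cscale (c * d) f"
  and cscale_scaleR: "cscale c (r *\<^sub>R f) = r *\<^sub>R cscale c f"
  and cscale_1: "cscale 1 f = f"
  and cscale_0: "cscale c 0 = 0"
  by (rule ell2_eqI, simp add: algebra_simps)+

text \<open>Scaling by c and by its conjugate are adjoint for the real inner product;
  \<open>adj_cscale\<close> derives from this that adjoints are complex linear.\<close>

lemma inner_cscale: "cscale c f \<bullet> g = f \<bullet> cscale (cnj c) g"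
  unfolding inner_ell2_def
  by (rule infsum_cong) (simp add: inner_complex_def algebra_simps)

lemma bounded_linear_cscale: "bounded_linear (cscale c)"
  by (rule bounded_linear_intro[of _ "cmod c"])
    (simp_all add: cscale_add cscale_scaleR norm_cscale mult.commute)

definition unit_vector :: "nat \<Rightarrow> ell2" where
  "unit_vector i = Ell2 (\<lambda>n. of_bool (n = i))"

lemma coord_unit_vector [simp]: "coord (unit_vector i) n = of_bool (n = i)"
proof -
  have "(\<lambda>n. (cmod (of_bool (n = i)))\<^sup>2) summable_on UNIV \<longleftrightarrow> (\<lambda>n. 1 :: real) summable_on {i}"
    by (rule summable_on_cong_neutral) auto
  then show ?thesis unfolding unit_vector_def by (simp add: Ell2_inverse)
qed

lemma norm_unit_vector: "norm (unit_vector i) = 1"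
proof -
  have "infsum (\<lambda>n. (cmod (of_bool (n = i)))\<^sup>2) UNIV = infsum (\<lambda>n. 1 :: real) {i}"
    by (rule infsum_cong_neutral) auto
  then have "(norm (unit_vector i))\<^sup>2 = 1" unfolding norm_ell2_square by simp
  then show ?thesis using norm_ge_zero[of "unit_vector i"] by (auto simp: power2_eq_1_iff)
qed

section \<open>Operators on the Hilbert space as a C*-algebra\<close>

type_synonym operator = "ell2 \<Rightarrow>\<^sub>L ell2"

text \<open>Stated with the real inner product. For complex-linear operators it agrees with the
  complex adjoint, since multiplying one argument by i turns imaginary parts into real
  parts.\<close>

definition adjoint_pair :: "operator \<Rightarrow> operator \<Rightarrow> bool" where
  "adjoint_pair T T' \<longleftrightarrow> (\<forall>f g. blinfun_apply T f \<bullet> g = f \<bullet> blinfun_apply T' g)"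

text \<open>Commuting with \<open>cscale\<close> encodes complex linearity, since bounded linear
  functions here are linear over the reals. Existence of the adjoint is built in, and
  \<open>operators_complete\<close> shows that it survives norm limits.\<close>

definition operators :: "operator set" where
  "operators = {T. (\<forall>c f. blinfun_apply T (cscale c f) = cscale c (blinfun_apply T f)) \<and>
     (\<exists>T'. adjoint_pair T T')}"

definition operator_adj :: "operator \<Rightarrow> operator" where
  "operator_adj T = (SOME T'. adjoint_pair T T')"

definition operator_cscale :: "complex \<Rightarrow> operator \<Rightarrow> operator" where
  "operator_cscale c T = Blinfun (\<lambda>f. cscale c (blinfun_apply T f))"

lemma operator_cscale_apply [simp]:
  "blinfun_apply (operator_cscale c T) f = cscale c (blinfun_apply T f)"
  unfolding operator_cscale_def
  by (simp add: bounded_linear_Blinfun_apply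
      bounded_linear_compose[OF bounded_linear_cscale blinfun.bounded_linear_right])

lemma adjoint_unique:
  assumes "adjoint_pair T T'" "adjoint_pair T T''"
  shows "T' = T''"
proof (rule blinfun_eqI)
  fix g
  have "f \<bullet> (T' g - T'' g) = 0" for f
    using assms unfolding adjoint_pair_def by (metis inner_diff_right diff_self)
  then show "T' g = T'' g" using inner_eq_zero_iff eq_iff_diff_eq_0 by metis
qed

lemma operator_adj_eq: "adjoint_pair T T' \<Longrightarrow> operator_adj T = T'"
  unfolding operator_adj_def using adjoint_unique by (metis someI)

lemma adjoint_pair_adj: "T \<in> operators \<Longrightarrow> adjoint_pair T (operator_adj T)"
  unfolding operators_def using operator_adj_eq by auto

lemma adjoint_pair_sym: "adjoint_pair T T' \<Longrightarrow> adjoint_pair T' T"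
  unfolding adjoint_pair_def by (simp add: inner_commute)

lemma operators_cscale: "T \<in> operators \<Longrightarrow> blinfun_apply T (cscale c f) = cscale c (blinfun_apply T f)"
  unfolding operators_def by auto

text \<open>Tested against every f: c moves to the other side as its conjugate, passes through T
  there, and moves back.\<close>

lemma adj_cscale:
  assumes T: "\<And>c f. blinfun_apply T (cscale c f) = cscale c (blinfun_apply T f)" and a: "adjoint_pair T T'"
  shows "blinfun_apply T' (cscale c g) = cscale c (blinfun_apply T' g)"
proof -
  have "f \<bullet> (T' (cscale c g) - cscale c (T' g)) = 0" for f
  proof -
    have "f \<bullet> T' (cscale c g) = T f \<bullet> cscale c g" using a unfolding adjoint_pair_def by simp
    also have "\<dots> = T (cscale (cnj c) f) \<bullet> g" using inner_cscale[of "cnj c" "T f" g] T by simp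
    also have "\<dots> = f \<bullet> cscale c (T' g)"
      using a inner_cscale[of "cnj c" f "T' g"] unfolding adjoint_pair_def by simp
    finally show ?thesis by (simp add: inner_diff_right)
  qed
  then show ?thesis using inner_eq_zero_iff eq_iff_diff_eq_0 by metis
qed

lemma operatorsI:
  assumes "\<And>c f. blinfun_apply T (cscale c f) = cscale c (blinfun_apply T f)" "adjoint_pair T T'"
  shows "T \<in> operators"
  using assms unfolding operators_def by blast

lemma adj_operators:
  assumes "T \<in> operators"
  shows "operator_adj T \<in> operators" "operator_adj (operator_adj T) = T"
proof -
  note a = adjoint_pair_adj[OF assms]
  show "operator_adj T \<in> operators"
    by (rule operatorsI[OF adj_cscale[OF operators_cscale[OF assms] a] adjoint_pair_sym[OF a]])
  show "operator_adj (operator_adj T) = T"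
    by (rule operator_adj_eq[OF adjoint_pair_sym[OF a]])
qed

lemma adjoint_pair_add: "adjoint_pair T T' \<Longrightarrow> adjoint_pair S S' \<Longrightarrow> adjoint_pair (T + S) (T' + S')"
  unfolding adjoint_pair_def by (simp add: plus_blinfun.rep_eq inner_add)

lemma adjoint_pair_compose:
  "adjoint_pair T T' \<Longrightarrow> adjoint_pair S S' \<Longrightarrow> adjoint_pair (T o\<^sub>L S) (S' o\<^sub>L T')"
  unfolding adjoint_pair_def by simp

lemma adjoint_pair_cscale:
  "adjoint_pair T T' \<Longrightarrow> adjoint_pair (operator_cscale c T) (operator_cscale (cnj c) T')"
  if "\<And>d f. blinfun_apply T (cscale d f) = cscale d (blinfun_apply T f)"
  using adj_cscale[OF that] unfolding adjoint_pair_def by (simp add: inner_cscale)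

lemma adjoint_pair_0: "adjoint_pair 0 0"
  unfolding adjoint_pair_def by simp

lemma zero_operators: "0 \<in> operators"
  by (rule operatorsI[OF _ adjoint_pair_0]) (simp add: cscale_0)

lemma operators_closed_unary:
  assumes T: "T \<in> operators"
  shows "operator_cscale c T \<in> operators" "- T \<in> operators"
    "operator_adj (operator_cscale c T) = operator_cscale (cnj c) (operator_adj T)"
proof -
  note t = operators_cscale[OF T] adjoint_pair_adj[OF T]
  note c = adjoint_pair_cscale[OF t]
  show "operator_cscale c T \<in> operators"
    by (rule operatorsI[OF _ c]) (simp add: t cscale_cscale mult.commute)
  have "adjoint_pair (- T) (- operator_adj T)"
    using t(2) unfolding adjoint_pair_def by (simp add: uminus_blinfun.rep_eq)
  then show "- T \<in> operators"
    by (rule operatorsI[rotated]) (simp add: uminus_blinfun.rep_eq t cscale_uminus)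
  show "operator_adj (operator_cscale c T) = operator_cscale (cnj c) (operator_adj T)"
    by (rule operator_adj_eq[OF c])
qed

lemma operators_closed_binary:
  assumes T: "T \<in> operators" and S: "S \<in> operators"
  shows "T + S \<in> operators" "T o\<^sub>L S \<in> operators"
    "operator_adj (T + S) = operator_adj T + operator_adj S"
    "operator_adj (T o\<^sub>L S) = operator_adj S o\<^sub>L operator_adj T"
proof -
  note t = operators_cscale[OF T] adjoint_pair_adj[OF T]
  note s = operators_cscale[OF S] adjoint_pair_adj[OF S]
  show "T + S \<in> operators"
    by (rule operatorsI[OF _ adjoint_pair_add[OF t(2) s(2)]]) (simp add: plus_blinfun.rep_eq t s cscale_add)
  show "T o\<^sub>L S \<in> operators"
    by (rule operatorsI[OF _ adjoint_pair_compose[OF t(2) s(2)]]) (simp add: t s)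
  show "operator_adj (T + S) = operator_adj T + operator_adj S"
    by (rule operator_adj_eq[OF adjoint_pair_add[OF t(2) s(2)]])
  show "operator_adj (T o\<^sub>L S) = operator_adj S o\<^sub>L operator_adj T"
    by (rule operator_adj_eq[OF adjoint_pair_compose[OF t(2) s(2)]])
qed

lemmas operators_closed = zero_operators operators_closed_unary operators_closed_binary

text \<open>Pair T' g with itself, move T' across as T, and divide by the norm of T' g.\<close>

lemma norm_adj_le:
  assumes a: "adjoint_pair T T'"
  shows "norm T' \<le> norm T"
proof (rule norm_blinfun_bound)
  fix g
  have "(norm (T' g))\<^sup>2 = T (T' g) \<bullet> g"
    using a unfolding adjoint_pair_def power2_norm_eq_inner by simp
  also have "\<dots> \<le> norm (T (T' g)) * norm g" by (rule norm_cauchy_schwarz)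
  also have "\<dots> \<le> norm T * norm (T' g) * norm g" by (intro mult_right_mono norm_blinfun) auto
  finally have "norm (T' g) * norm (T' g) \<le> norm (T' g) * (norm T * norm g)"
    by (simp add: power2_eq_square mult_ac)
  then show "norm (T' g) \<le> norm T * norm g"
    by (cases "T' g = 0") (simp_all)
qed simp

lemma norm_operator_adj: "T \<in> operators \<Longrightarrow> norm (operator_adj T) = norm T"
  using norm_adj_le adjoint_pair_adj adjoint_pair_sym by (metis order_antisym)

lemma norm_adj_compose:
  assumes T: "T \<in> operators"
  shows "norm (operator_adj T o\<^sub>L T) = (norm T)\<^sup>2"
proof (rule antisym)
  show "norm (operator_adj T o\<^sub>L T) \<le> (norm T)\<^sup>2"
    using norm_blinfun_compose[of "operator_adj T" T] norm_operator_adj[OF T] by (simp add: power2_eq_square)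
  have "norm T \<le> sqrt (norm (operator_adj T o\<^sub>L T))"
  proof (rule norm_blinfun_bound)
    fix f
    have "(norm (T f))\<^sup>2 = f \<bullet> (operator_adj T o\<^sub>L T) f"
      using adjoint_pair_adj[OF T] unfolding adjoint_pair_def power2_norm_eq_inner by simp
    also have "\<dots> \<le> norm f * norm ((operator_adj T o\<^sub>L T) f)" by (rule norm_cauchy_schwarz)
    also have "\<dots> \<le> norm f * (norm (operator_adj T o\<^sub>L T) * norm f)"
      by (intro mult_left_mono norm_blinfun) auto
    finally have "(norm (T f))\<^sup>2 \<le> (sqrt (norm (operator_adj T o\<^sub>L T)) * norm f)\<^sup>2"
      by (simp add: power_mult_distrib power2_eq_square mult_ac)
    then show "norm (T f) \<le> sqrt (norm (operator_adj T o\<^sub>L T)) * norm f"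
      by (rule power2_le_imp_le) simp
  qed simp
  then have "(norm T)\<^sup>2 \<le> (sqrt (norm (operator_adj T o\<^sub>L T)))\<^sup>2" by (rule power_mono) simp
  then show "(norm T)\<^sup>2 \<le> norm (operator_adj T o\<^sub>L T)" by simp
qed

lemma norm_operator_cscale: "norm (operator_cscale c T) = cmod c * norm T"
proof (cases "c = 0")
  case True
  then have "operator_cscale c T = 0"
    by (intro blinfun_eqI ell2_eqI) simp
  then show ?thesis using True by simp
next
  case False
  have le: "norm (operator_cscale d R) \<le> cmod d * norm R" for d R
  proof (rule norm_blinfun_bound)
    fix f
    show "norm (operator_cscale d R f) \<le> cmod d * norm R * norm f"
      using mult_left_mono[OF norm_blinfun[of R f], of "cmod d"] by (simp add: norm_cscale mult_ac)
  qed simp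
  \<comment> \<open>The upper bound applied to the inverse scalar is the missing lower
    bound.\<close>
  have "operator_cscale (inverse c) (operator_cscale c T) = T"
    by (rule blinfun_eqI) (simp add: cscale_cscale False cscale_1)
  then have "norm T \<le> inverse (cmod c) * norm (operator_cscale c T)"
    using le[of "inverse c" "operator_cscale c T"] by (simp add: norm_inverse)
  then have "cmod c * norm T \<le> norm (operator_cscale c T)"
    using False by (simp add: field_simps)
  then show ?thesis using le[of c T] by simp
qed

text \<open>Passing to adjoints preserves distances, so the adjoints form a Cauchy sequence as well.
  The adjoint relation and complex linearity hold vector by vector in the limit.\<close>

lemma operators_complete:
  assumes X: "range X \<subseteq> operators" and C: "Cauchy X"
  obtains T where "T \<in> operators" "X \<longlonglongrightarrow> T"
proof -
  have Xo: "X n \<in> operators" for n using X by auto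
  obtain T where T: "X \<longlonglongrightarrow> T" using C Cauchy_convergent convergent_def by blast
  have nd: "norm (operator_adj (X m) - operator_adj (X n)) = norm (X m - X n)" for m n
  proof -
    have "adjoint_pair (X m - X n) (operator_adj (X m) - operator_adj (X n))"
      using adjoint_pair_adj[OF Xo[of m]] adjoint_pair_adj[OF Xo[of n]]
      unfolding adjoint_pair_def by (simp add: minus_blinfun.rep_eq inner_diff)
    then show ?thesis using norm_adj_le adjoint_pair_sym by (metis order_antisym)
  qed
  have "Cauchy (\<lambda>n. operator_adj (X n))"
    using C unfolding Cauchy_def dist_norm nd .
  then obtain T' where T': "(\<lambda>n. operator_adj (X n)) \<longlonglongrightarrow> T'" using Cauchy_convergent convergent_def by blast
  have ap: "(\<lambda>n. X n f) \<longlonglongrightarrow> T f" "(\<lambda>n. operator_adj (X n) f) \<longlonglongrightarrow> T' f" for f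
    by (intro blinfun.tendsto T T' tendsto_const)+
  have "adjoint_pair T T'"
    unfolding adjoint_pair_def
  proof (intro allI)
    fix f g
    have "(\<lambda>n. X n f \<bullet> g) \<longlonglongrightarrow> T f \<bullet> g" "(\<lambda>n. f \<bullet> operator_adj (X n) g) \<longlonglongrightarrow> f \<bullet> T' g"
      by (intro tendsto_intros ap)+
    moreover have "X n f \<bullet> g = f \<bullet> operator_adj (X n) g" for n
      using adjoint_pair_adj[OF Xo] unfolding adjoint_pair_def by blast
    ultimately show "T f \<bullet> g = f \<bullet> T' g" using LIMSEQ_unique by auto
  qed
  moreover have "T (cscale c f) = cscale c (T f)" for c f
  proof -
    have "(\<lambda>n. X n (cscale c f)) \<longlonglongrightarrow> cscale c (T f)"
      unfolding operators_cscale[OF Xo] by (rule bounded_linear.tendsto[OF bounded_linear_cscale ap(1)])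
    then show ?thesis using LIMSEQ_unique[OF ap(1)] by blast
  qed
  ultimately have "T \<in> operators" using operatorsI by blast
  then show ?thesis using that T by blast
qed

text \<open>The injection of the operators into the type over which universal families quantify.\<close>

definition operator_code :: "operator \<Rightarrow> universe" where
  "operator_code T = (\<lambda>x. coord (blinfun_apply T (Ell2 x)))"

lemma inj_operator_code: "inj operator_code"
proof (rule injI)
  fix S T assume eq: "operator_code S = operator_code T"
  show "S = T"
  proof (rule blinfun_eqI)
    fix f
    have "coord (S f) = coord (T f)"
      using fun_cong[OF eq, of "coord f"] unfolding operator_code_def coord_inverse .
    then show "S f = T f" using coord_inject by blast
  qed
qed

definition operator_decode :: "universe \<Rightarrow> operator" where
  "operator_decode = the_inv operator_code"

lemma decode_code [simp]: "operator_decode (operator_code T) = T"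
  unfolding operator_decode_def using inj_operator_code by (simp add: the_inv_f_f)

section \<open>Coded operators as a C*-algebra\<close>

definition operator_algebra :: "universe cstar" where
  "operator_algebra = \<lparr>carrier = operator_code ` operators,
     mult = (\<lambda>x y. operator_code (operator_decode x o\<^sub>L operator_decode y)),
     one = operator_code 0, zero = operator_code 0,
     add = (\<lambda>x y. operator_code (operator_decode x + operator_decode y)),
     smult = (\<lambda>c x. operator_code (operator_cscale c (operator_decode x))),
     adj = (\<lambda>x. operator_code (operator_adj (operator_decode x))),
     nrm = (\<lambda>x. norm (operator_decode x))\<rparr>"

lemma operator_algebra_simps:
  "carrier operator_algebra = operator_code ` operators"
  "operator_code S \<otimes>\<^bsub>operator_algebra\<^esub> operator_code T = operator_code (S o\<^sub>L T)"
  "operator_code S \<oplus>\<^bsub>operator_algebra\<^esub> operator_code T = operator_code (S + T)"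
  "\<zero>\<^bsub>operator_algebra\<^esub> = operator_code 0"
  "c \<odot>\<^bsub>operator_algebra\<^esub> operator_code T = operator_code (operator_cscale c T)"
  "adj operator_algebra (operator_code T) = operator_code (operator_adj T)"
  "nrm operator_algebra (operator_code T) = norm T"
  unfolding operator_algebra_def by simp_all

lemma operator_code_mem [simp]: "operator_code T \<in> operator_code ` operators \<longleftrightarrow> T \<in> operators"
  using inj_image_mem_iff[OF inj_operator_code] .

lemma abelian_group_operator_algebra: "abelian_group operator_algebra"
proof (rule abelian_groupI)
  fix x assume "x \<in> carrier operator_algebra"
  then obtain T where T: "x = operator_code T" "T \<in> operators" by (auto simp: operator_algebra_simps)
  show "\<exists>y\<in>carrier operator_algebra. y \<oplus>\<^bsub>operator_algebra\<^esub> x = \<zero>\<^bsub>operator_algebra\<^esub>"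
    by (rule bexI[of _ "operator_code (- T)"]) (simp_all add: T operator_algebra_simps operators_closed)
qed (auto simp: operator_algebra_simps operators_closed add_ac)

lemma cring_complex_ring: "cring complex_ring"
proof (rule cringI)
  show "abelian_group complex_ring"
  proof (rule abelian_groupI)
    fix x :: complex
    show "\<exists>y\<in>carrier complex_ring. y \<oplus>\<^bsub>complex_ring\<^esub> x = \<zero>\<^bsub>complex_ring\<^esub>"
      by (rule bexI[of _ "- x"]) (simp_all add: complex_ring_def)
  qed (simp_all add: complex_ring_def)
  show "Group.comm_monoid complex_ring"
    by (rule comm_monoidI) (simp_all add: complex_ring_def)
qed (simp add: complex_ring_def distrib_right)

lemma module_operator_algebra: "module complex_ring operator_algebra"
proof (rule moduleI[OF cring_complex_ring abelian_group_operator_algebra])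
  fix a b :: complex and x y assume x: "x \<in> carrier operator_algebra"
  then obtain T where T: "x = operator_code T" "T \<in> operators" by (auto simp: operator_algebra_simps)
  show "a \<odot>\<^bsub>operator_algebra\<^esub> x \<in> carrier operator_algebra"
    by (simp add: T operator_algebra_simps operators_closed)
  have *: "operator_cscale (a + b) T = operator_cscale a T + operator_cscale b T"
    "operator_cscale (a * b) T = operator_cscale a (operator_cscale b T)" "operator_cscale 1 T = T"
    by (rule blinfun_eqI, simp add: plus_blinfun.rep_eq cscale_add_left cscale_cscale cscale_1)+
  then show "(a \<oplus>\<^bsub>complex_ring\<^esub> b) \<odot>\<^bsub>operator_algebra\<^esub> x =
      a \<odot>\<^bsub>operator_algebra\<^esub> x \<oplus>\<^bsub>operator_algebra\<^esub> b \<odot>\<^bsub>operator_algebra\<^esub> x"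
    "(a \<otimes>\<^bsub>complex_ring\<^esub> b) \<odot>\<^bsub>operator_algebra\<^esub> x = a \<odot>\<^bsub>operator_algebra\<^esub> (b \<odot>\<^bsub>operator_algebra\<^esub> x)"
    "\<one>\<^bsub>complex_ring\<^esub> \<odot>\<^bsub>operator_algebra\<^esub> x = x"
    by (simp_all add: T operator_algebra_simps complex_ring_def)
  assume "y \<in> carrier operator_algebra"
  then obtain S where S: "y = operator_code S" "S \<in> operators" by (auto simp: operator_algebra_simps)
  have "operator_cscale a (T + S) = operator_cscale a T + operator_cscale a S"
    by (rule blinfun_eqI, simp add: plus_blinfun.rep_eq cscale_add)
  then show "a \<odot>\<^bsub>operator_algebra\<^esub> (x \<oplus>\<^bsub>operator_algebra\<^esub> y) =
      a \<odot>\<^bsub>operator_algebra\<^esub> x \<oplus>\<^bsub>operator_algebra\<^esub> a \<odot>\<^bsub>operator_algebra\<^esub> y"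
    by (simp add: T S operator_algebra_simps)
qed

lemma operator_algebra_minus:
  assumes "S \<in> operators" "T \<in> operators"
  shows "operator_code S \<ominus>\<^bsub>operator_algebra\<^esub> operator_code T = operator_code (S - T)"
proof -
  interpret G: abelian_group operator_algebra by (rule abelian_group_operator_algebra)
  have "\<ominus>\<^bsub>operator_algebra\<^esub> operator_code T = operator_code (- T)"
    by (rule G.minus_equality) (use assms operators_closed in \<open>auto simp: operator_algebra_simps\<close>)
  then show ?thesis by (simp add: G.minus_eq operator_algebra_simps)
qed

lemma cdist_operator_algebra:
  assumes "S \<in> operators" "T \<in> operators"
  shows "cdist operator_algebra (operator_code S) (operator_code T) = dist S T"
  using assms by (simp add: cdist_def operator_algebra_minus operator_algebra_simps dist_norm)

text \<open>Completeness is an assumption of \<open>cstar_algebra\<close> and needs the metric space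
  first, so the metric axioms are transported through the coding instead of being inherited from
  that locale.\<close>

lemma metric_operator_algebra: "Metric_space (carrier operator_algebra) (cdist operator_algebra)"
proof
  have *: "cdist operator_algebra x y = (if x \<in> carrier operator_algebra \<and> y \<in> carrier operator_algebra
      then dist (operator_decode x) (operator_decode y) else 0)" for x y
  proof (cases "x \<in> carrier operator_algebra \<and> y \<in> carrier operator_algebra")
    case True
    then obtain S T where "x = operator_code S" "y = operator_code T" "S \<in> operators" "T \<in> operators"
      by (auto simp: operator_algebra_simps)
    then show ?thesis using True cdist_operator_algebra by simp
  qed (auto simp: cdist_def)
  show "0 \<le> cdist operator_algebra x y" "cdist operator_algebra x y = cdist operator_algebra y x" for x y
    unfolding * by (auto simp: dist_commute)
  show "(cdist operator_algebra x y = 0) = (x = y)"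
    if "x \<in> carrier operator_algebra" "y \<in> carrier operator_algebra" for x y
    using that unfolding * by (auto simp: operator_algebra_simps)
  show "cdist operator_algebra x z \<le> cdist operator_algebra x y + cdist operator_algebra y z"
    if "x \<in> carrier operator_algebra" "y \<in> carrier operator_algebra" "z \<in> carrier operator_algebra" for x y z
    using that unfolding * by (auto simp: dist_triangle)
qed

lemma mcomplete_operator_algebra:
  "Metric_space.mcomplete (carrier operator_algebra) (cdist operator_algebra)"
proof -
  interpret MS: Metric_space "carrier operator_algebra" "cdist operator_algebra"
    by (rule metric_operator_algebra)
  show ?thesis
    unfolding MS.mcomplete_def
  proof (intro allI impI)
    fix s assume s: "MS.MCauchy s"
    then have "s n \<in> operator_code ` operators" for n
      unfolding MS.MCauchy_def by (auto simp: operator_algebra_simps)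
    then have "\<forall>n. \<exists>T. T \<in> operators \<and> s n = operator_code T" by blast
    then obtain X where X: "\<And>n. X n \<in> operators" "\<And>n. s n = operator_code (X n)" by metis
    have "\<forall>e>0. \<exists>N. \<forall>n n'. N \<le> n \<longrightarrow> N \<le> n' \<longrightarrow> dist (X n) (X n') < e"
      using s unfolding MS.MCauchy_def X(2) cdist_operator_algebra[OF X(1) X(1)] by (rule conjunct2)
    then have "Cauchy X" by (intro metric_CauchyI) meson
    then obtain T where T: "T \<in> operators" "X \<longlonglongrightarrow> T"
      using operators_complete[of X] X(1) by auto
    have "limitin MS.mtopology s (operator_code T) sequentially"
      unfolding MS.limitin_metric X(2) cdist_operator_algebra[OF X(1) T(1)]
      using T X(1) tendstoD[OF T(2)] by (auto simp: operator_algebra_simps)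
    then show "\<exists>x. limitin MS.mtopology s x sequentially" by blast
  qed
qed

lemma operator_compose_simps:
  "(S + T) o\<^sub>L R = (S o\<^sub>L R) + (T o\<^sub>L R)"
  "R o\<^sub>L (S + T) = (R o\<^sub>L S) + (R o\<^sub>L T)"
  "operator_cscale c S o\<^sub>L T = operator_cscale c (S o\<^sub>L T)"
  "R \<in> operators \<Longrightarrow> R o\<^sub>L operator_cscale c S = operator_cscale c (R o\<^sub>L S)"
  "(S o\<^sub>L T) o\<^sub>L R = S o\<^sub>L (T o\<^sub>L R)" for R S T :: operator
  by (rule blinfun_eqI, simp add: plus_blinfun.rep_eq blinfun.add_right operators_cscale)+

lemma cstar_operator_algebra: "cstar_algebra operator_algebra"
proof (rule cstar_algebra.intro)
  show "Module.module complex_ring operator_algebra" by (rule module_operator_algebra)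
  show "Metric_space.mcomplete (carrier operator_algebra) (cdist operator_algebra)"
    by (rule mcomplete_operator_algebra)
qed (auto simp: operator_algebra_simps operators_closed adj_operators operator_compose_simps
    norm_triangle_ineq norm_blinfun_compose norm_operator_cscale norm_adj_compose
    inj_eq[OF inj_operator_code])

section \<open>Partial permutations as partial isometries\<close>

definition partial_injection :: "(nat \<times> nat) set \<Rightarrow> bool" where
  "partial_injection R \<longleftrightarrow> single_valued R \<and> single_valued (R\<inverse>)"

definition preimage :: "(nat \<times> nat) set \<Rightarrow> nat \<Rightarrow> nat" where
  "preimage R n = (THE m. (m, n) \<in> R)"

text \<open>For a partial injection R this sends the basis vector at m to the one at n when (m, n)
  \<in> R, and kills those outside the domain. Relations make the calculus combinatorial: adjoints
  are converses, and operator products are relational compositions in reversed order.\<close>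

definition partial_shift :: "(nat \<times> nat) set \<Rightarrow> operator" where
  "partial_shift R = Blinfun (\<lambda>f. Ell2 (\<lambda>n. if n \<in> Range R then coord f (preimage R n) else 0))"

lemma partial_injectionI:
  assumes "\<And>m n n'. (m, n) \<in> R \<Longrightarrow> (m, n') \<in> R \<Longrightarrow> n = n'" "\<And>m m' n. (m, n) \<in> R \<Longrightarrow> (m', n) \<in> R \<Longrightarrow> m = m'"
  shows "partial_injection R"
  using assms unfolding partial_injection_def single_valued_def by blast

lemma partial_injectionD:
  assumes "partial_injection R"
  shows "(m, n) \<in> R \<Longrightarrow> (m, n') \<in> R \<Longrightarrow> n = n'" "(m, n) \<in> R \<Longrightarrow> (m', n) \<in> R \<Longrightarrow> m = m'"
  using assms unfolding partial_injection_def single_valued_def by blast+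

lemma partial_injection_converse: "partial_injection R \<Longrightarrow> partial_injection (R\<inverse>)"
  unfolding partial_injection_def by simp

lemma partial_injection_comp: "partial_injection R \<Longrightarrow> partial_injection S \<Longrightarrow> partial_injection (R O S)"
  unfolding partial_injection_def by (simp add: converse_relcomp single_valued_relcomp)

lemma partial_injection_subset: "partial_injection R \<Longrightarrow> S \<subseteq> R \<Longrightarrow> partial_injection S"
  unfolding partial_injection_def single_valued_def by blast

lemma preimage_eq: "partial_injection R \<Longrightarrow> (m, n) \<in> R \<Longrightarrow> preimage R n = m"
  unfolding preimage_def using partial_injectionD(2) by blast

text \<open>Reindexing sums along this bijection gives the square-summability of the image, the norm
  bound and the adjoint.\<close>

lemma bij_betw_preimage:
  assumes "partial_injection R"
  shows "bij_betw (preimage R) (Range R) (Domain R)"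
proof (rule bij_betwI[where g = "preimage (R\<inverse>)"])
  note R = preimage_eq[OF assms] preimage_eq[OF partial_injection_converse[OF assms], unfolded converse_iff]
  show "preimage R \<in> Range R \<rightarrow> Domain R" "preimage (R\<inverse>) \<in> Domain R \<rightarrow> Range R"
    using R by (auto simp: Range.simps Domain.simps)
  show "preimage (R\<inverse>) (preimage R n) = n" if "n \<in> Range R" for n
    using that R by (elim RangeE) simp
  show "preimage R (preimage (R\<inverse>) m) = m" if "m \<in> Domain R" for m
    using that R by (elim DomainE) simp
qed

context
  fixes R assumes R: "partial_injection R"
begin

text \<open>The vector-valued function inside \<open>partial_shift\<close>; it must be shown
  square-summable and bounded before \<open>Blinfun\<close> can be evaluated.\<close>

private definition "shift_vec f = Ell2 (\<lambda>n. if n \<in> Range R then coord f (preimage R n) else 0)"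

private lemma coord_shift_vec:
  "coord (shift_vec f) n = (if n \<in> Range R then coord f (preimage R n) else 0)"
proof -
  have "(\<lambda>m. (cmod (coord f m))\<^sup>2) summable_on Domain R"
    using summable_on_subset_banach[OF coord_summable] by auto
  then have "(\<lambda>n. (cmod (coord f (preimage R n)))\<^sup>2) summable_on Range R"
    using summable_on_reindex_bij_betw[OF bij_betw_preimage[OF R], of "\<lambda>m. (cmod (coord f m))\<^sup>2"] by simp
  also have "?this \<longleftrightarrow> (\<lambda>n. (cmod (if n \<in> Range R then coord f (preimage R n) else 0))\<^sup>2) summable_on UNIV"
    by (rule summable_on_cong_neutral) auto
  finally show ?thesis unfolding shift_vec_def by (simp add: Ell2_inverse)
qed

private lemma norm_shift_vec: "norm (shift_vec f) \<le> norm f"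
proof -
  have "(norm (shift_vec f))\<^sup>2 = infsum (\<lambda>n. (cmod (coord f (preimage R n)))\<^sup>2) (Range R)"
    unfolding norm_ell2_square by (rule infsum_cong_neutral) (auto simp: coord_shift_vec)
  also have "\<dots> = infsum (\<lambda>m. (cmod (coord f m))\<^sup>2) (Domain R)"
    by (rule infsum_reindex_bij_betw[OF bij_betw_preimage[OF R]])
  also have "\<dots> \<le> (norm f)\<^sup>2"
    unfolding norm_ell2_square
    by (rule infsum_mono_neutral[OF summable_on_subset_banach[OF coord_summable] coord_summable]) auto
  finally show ?thesis by (rule power2_le_imp_le) simp
qed

lemma coord_partial_shift:
  "coord (blinfun_apply (partial_shift R) f) n = (if n \<in> Range R then coord f (preimage R n) else 0)"
proof -
  have "bounded_linear shift_vec"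
    by (rule bounded_linear_intro[of _ 1]) (auto intro!: ell2_eqI norm_shift_vec simp: coord_shift_vec)
  then have "blinfun_apply (partial_shift R) f = shift_vec f"
    unfolding partial_shift_def shift_vec_def[symmetric] by (simp add: bounded_linear_Blinfun_apply)
  then show ?thesis by (simp add: coord_shift_vec)
qed

end

lemma coord_partial_shift_mem:
  "partial_injection R \<Longrightarrow> (m, n) \<in> R \<Longrightarrow> coord (blinfun_apply (partial_shift R) f) n = coord f m"
  by (auto simp: coord_partial_shift preimage_eq)

lemma coord_partial_shift_notin:
  "partial_injection R \<Longrightarrow> n \<notin> Range R \<Longrightarrow> coord (blinfun_apply (partial_shift R) f) n = 0"
  by (simp add: coord_partial_shift)

lemma adjoint_partial_shift:
  assumes R: "partial_injection R"
  shows "adjoint_pair (partial_shift R) (partial_shift (R\<inverse>))"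
  unfolding adjoint_pair_def
proof (intro allI)
  fix f g
  note R' = partial_injection_converse[OF R]
  let ?h = "\<lambda>m. coord f m \<bullet> coord g (preimage (R\<inverse>) m)"
  have "partial_shift R f \<bullet> g = infsum (\<lambda>n. ?h (preimage R n)) (Range R)"
    unfolding inner_ell2_def
  proof (rule infsum_cong_neutral)
    fix n assume "n \<in> UNIV \<inter> Range R"
    then obtain m where "(m, n) \<in> R" by blast
    then have "preimage R n = m" "preimage (R\<inverse>) m = n" using preimage_eq R R' by auto
    then show "coord (partial_shift R f) n \<bullet> coord g n = ?h (preimage R n)"
      using \<open>(m, n) \<in> R\<close> by (simp add: coord_partial_shift_mem[OF R])
  qed (simp_all add: coord_partial_shift_notin[OF R])
  also have "\<dots> = infsum ?h (Domain R)"
    by (rule infsum_reindex_bij_betw[OF bij_betw_preimage[OF R]])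
  also have "\<dots> = f \<bullet> partial_shift (R\<inverse>) g"
    unfolding inner_ell2_def by (rule infsum_cong_neutral) (auto simp: coord_partial_shift[OF R'])
  finally show "partial_shift R f \<bullet> g = f \<bullet> partial_shift (R\<inverse>) g" .
qed

lemma partial_shift_operators:
  assumes R: "partial_injection R"
  shows "partial_shift R \<in> operators" "operator_adj (partial_shift R) = partial_shift (R\<inverse>)"
proof -
  show "partial_shift R \<in> operators"
    by (rule operatorsI[OF _ adjoint_partial_shift[OF R]])
      (auto intro!: ell2_eqI simp: coord_partial_shift[OF R])
  show "operator_adj (partial_shift R) = partial_shift (R\<inverse>)"
    by (rule operator_adj_eq[OF adjoint_partial_shift[OF R]])
qed

text \<open>Follow an index n backwards: it has a preimage under both relations, only under R, or
  under neither.\<close>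

lemma partial_shift_compose:
  assumes R: "partial_injection R" and S: "partial_injection S"
  shows "partial_shift R o\<^sub>L partial_shift S = partial_shift (S O R)"
proof (intro blinfun_eqI ell2_eqI)
  fix f n
  note SR = partial_injection_comp[OF S R]
  consider l m where "(l, m) \<in> S" "(m, n) \<in> R" | m where "(m, n) \<in> R" "m \<notin> Range S" | "n \<notin> Range R"
    by blast
  then show "coord ((partial_shift R o\<^sub>L partial_shift S) f) n = coord (partial_shift (S O R) f) n"
  proof cases
    case 1
    then have "(l, n) \<in> S O R" by blast
    then show ?thesis
      using 1 by (simp add: coord_partial_shift_mem[OF SR] coord_partial_shift_mem[OF R] coord_partial_shift_mem[OF S])
  next
    case 2
    then have "n \<notin> Range (S O R)" using partial_injectionD(2)[OF R] by blast
    then show ?thesis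
      using 2 by (simp add: coord_partial_shift_notin[OF SR] coord_partial_shift_mem[OF R] coord_partial_shift_notin[OF S])
  next
    case 3
    then have "n \<notin> Range (S O R)" by blast
    then show ?thesis
      using 3 by (simp add: coord_partial_shift_notin[OF SR] coord_partial_shift_notin[OF R])
  qed
qed

lemma partial_shift_empty: "partial_shift {} = 0"
proof (intro blinfun_eqI ell2_eqI)
  show "coord (partial_shift {} f) n = coord (blinfun_apply 0 f) n" for f n
    using coord_partial_shift_notin[of "{}" n f] by (simp add: partial_injection_def single_valued_def)
qed

text \<open>Produces the finite sum of (CK3) from a union of relations. Disjoint ranges leave at
  most one nonzero summand at each index.\<close>

lemma partial_shift_UN:
  assumes R: "partial_injection (\<Union>p\<in>M. F p)" and M: "finite M"
    and disj: "\<And>p q n. p \<in> M \<Longrightarrow> q \<in> M \<Longrightarrow> n \<in> Range (F p) \<Longrightarrow> n \<in> Range (F q) \<Longrightarrow> p = q"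
  shows "partial_shift (\<Union>p\<in>M. F p) = (\<Sum>p\<in>M. partial_shift (F p))"
proof (intro blinfun_eqI ell2_eqI)
  fix f n
  have Fp: "partial_injection (F p)" if "p \<in> M" for p
    using partial_injection_subset[OF R] that by blast
  have *: "blinfun_apply (\<Sum>p\<in>M. partial_shift (F p)) f = (\<Sum>p\<in>M. blinfun_apply (partial_shift (F p)) f)"
    by (rule blinfun.sum_left)
  show "coord (partial_shift (\<Union>p\<in>M. F p) f) n = coord (blinfun_apply (\<Sum>p\<in>M. partial_shift (F p)) f) n"
  proof (cases "n \<in> Range (\<Union>p\<in>M. F p)")
    case True
    then obtain m q where mq: "q \<in> M" "(m, n) \<in> F q" by blast
    have mn: "(m, n) \<in> (\<Union>p\<in>M. F p)" using mq by blast
    have "n \<notin> Range (F p)" if "p \<in> M" "p \<noteq> q" for p using mq disj that by blast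
    then have "(\<Sum>p\<in>M. coord (partial_shift (F p) f) n) = (\<Sum>p\<in>M. if p = q then coord f m else 0)"
      using mq Fp coord_partial_shift_mem coord_partial_shift_notin by (intro sum.cong) auto
    also have "\<dots> = coord f m" using M mq by simp
    also have "\<dots> = coord (partial_shift (\<Union>p\<in>M. F p) f) n"
      using coord_partial_shift_mem[OF R mn] by simp
    finally show ?thesis unfolding * coord_sum by simp
  next
    case False
    then have "\<And>p. p \<in> M \<Longrightarrow> n \<notin> Range (F p)" by blast
    then show ?thesis
      unfolding * coord_sum using coord_partial_shift_notin[OF R False] coord_partial_shift_notin[OF Fp] by simp
  qed
qed

lemma partial_injection_Id_on: "partial_injection (Id_on B)"
  by (rule partial_injectionI) auto

lemma coord_partial_shift_Id_on:
  "coord (blinfun_apply (partial_shift (Id_on B)) f) n = (if n \<in> B then coord f n else 0)"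
  using coord_partial_shift_mem[OF partial_injection_Id_on Id_onI, of n B f]
    coord_partial_shift_notin[OF partial_injection_Id_on, of n B f] by auto

lemma partial_shift_Id_on_minus:
  assumes "C \<subseteq> B"
  shows "partial_shift (Id_on B) - partial_shift (Id_on C) = partial_shift (Id_on (B - C))"
proof (intro blinfun_eqI ell2_eqI)
  fix f n
  show "coord (blinfun_apply (partial_shift (Id_on B) - partial_shift (Id_on C)) f) n =
      coord (partial_shift (Id_on (B - C)) f) n"
    using assms by (auto simp: minus_blinfun.rep_eq coord_partial_shift_Id_on)
qed

lemma partial_shift_Id_on_unit_vector:
  "blinfun_apply (partial_shift (Id_on B)) (unit_vector m) = (if m \<in> B then unit_vector m else 0)"
  by (auto intro!: ell2_eqI simp: coord_partial_shift_Id_on)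

lemma finsum_operator_algebra:
  assumes "finite M" "\<And>p. p \<in> M \<Longrightarrow> F p \<in> operators"
  shows "(\<Oplus>\<^bsub>operator_algebra\<^esub>p\<in>M. operator_code (F p)) = operator_code (\<Sum>p\<in>M. F p) \<and> (\<Sum>p\<in>M. F p) \<in> operators"
proof -
  interpret G: abelian_group operator_algebra by (rule abelian_group_operator_algebra)
  show ?thesis
    using assms
  proof (induction M)
    case empty
    then show ?case by (simp add: operator_algebra_simps zero_operators)
  next
    case (insert p M)
    have "(\<lambda>p. operator_code (F p)) \<in> M \<rightarrow> carrier operator_algebra" "operator_code (F p) \<in> carrier operator_algebra"
      using insert by (auto simp: operator_algebra_simps)
    then show ?case
      using insert by (simp add: operator_algebra_simps operators_closed)
  qed
qed

section \<open>Contractivity of representations\<close>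

context cstar_algebra
begin

text \<open>For norm below 1, \<open>positive_root\<close> exhibits 1 - x^* x as the square of a
  self-adjoint 1 - b. Its image is a positive operator, which says that the operator of x does not
  increase norms. Scaling gives the general case.\<close>

lemma star_hom_operator_bound:
  assumes p: "star_hom A operator_algebra \<pi>" and a: "a \<in> carrier A"
  shows "norm (blinfun_apply (operator_decode (\<pi> a)) f) \<le> nrm A a * norm f"
proof -
  let ?P = "\<lambda>x. operator_decode (\<pi> x)"
  have code: "\<pi> x = operator_code (?P x) \<and> ?P x \<in> operators" if "x \<in> carrier A" for x
  proof -
    have "\<pi> x \<in> operator_code ` operators"
      using p that unfolding star_hom_def by (simp add: operator_algebra_simps)
    then show ?thesis by auto
  qed
  note hom = p[unfolded star_hom_def]
  have P: "?P (adj A x) = operator_adj (?P x)" "?P (c \<odot> x) = operator_cscale c (?P x)"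
    "?P (x \<oplus> y) = ?P x + ?P y" "?P (x \<otimes> y) = ?P x o\<^sub>L ?P y"
    if "x \<in> carrier A" "y \<in> carrier A" for x y c
    using hom that code[OF that(1)] code[OF that(2)] by (metis decode_code operator_algebra_simps)+
  have small: "norm (?P x f) \<le> norm f" if x: "x \<in> carrier A" "nrm A x < 1" for x
  proof -
    obtain b where b: "b \<in> carrier A" "adj A b = b" "b \<oplus> b = adj A x \<otimes> x \<oplus> b \<otimes> b"
      using positive_root[OF x] by blast
    let ?T = "?P x" and ?R = "?P b"
    have R: "operator_adj ?R = ?R" using P(1)[OF b(1) b(1)] b(2) by simp
    have "?R + ?R = (operator_adj ?T o\<^sub>L ?T) + (?R o\<^sub>L ?R)"
      using P(3)[OF b(1) b(1)] P(3)[of "adj A x \<otimes> x" "b \<otimes> b"] P(4)[of "adj A x" x] P(4)[OF b(1) b(1)] P(1)[OF x(1) x(1)] b x closed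
      by simp
    from arg_cong[OF this, of "\<lambda>T. blinfun_apply T f \<bullet> f"]
    have "2 * (?R f \<bullet> f) = operator_adj ?T (?T f) \<bullet> f + ?R (?R f) \<bullet> f"
      by (simp add: plus_blinfun.rep_eq inner_add_left)
    moreover have "operator_adj ?T (?T f) \<bullet> f = ?T f \<bullet> ?T f"
      using adjoint_pair_adj[of ?T] code[OF x(1)] unfolding adjoint_pair_def by (metis inner_commute)
    moreover have "?R (?R f) \<bullet> f = ?R f \<bullet> ?R f"
      using adjoint_pair_adj[of ?R] code[OF b(1)] R unfolding adjoint_pair_def by (metis inner_commute)
    \<comment> \<open>By the equation for b, the difference of the squared norms of f and ?T f
      equals this square.\<close>
    moreover have "0 \<le> (f - ?R f) \<bullet> (f - ?R f)" by simp
    then have "0 \<le> f \<bullet> f - 2 * (?R f \<bullet> f) + ?R f \<bullet> ?R f"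
      by (simp add: inner_diff inner_commute)
    ultimately have "?T f \<bullet> ?T f \<le> f \<bullet> f" by simp
    then show ?thesis by (simp add: norm_le)
  qed
  \<comment> \<open>The root needs norm strictly below 1, so a is scaled by an arbitrary r above its
    norm; letting r decrease to the norm comes last.\<close>
  have "norm (?P a f) \<le> r * norm f" if r: "nrm A a < r" for r
  proof -
    have r0: "r > 0" using nrm_nonneg[OF a] r by linarith
    let ?x = "complex_of_real (inverse r) \<odot> a"
    have "nrm A ?x = inverse r * nrm A a"
      using nrm_smult[OF a, of "complex_of_real (inverse r)"] r0 by (simp only: norm_of_real) simp
    moreover have "inverse r * nrm A a < 1" using r r0 by (simp add: field_simps)
    ultimately have "nrm A ?x < 1" by linarith
    then have "norm (?P ?x f) \<le> norm f" using small smult_closed a by blast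
    moreover have "?P ?x f = inverse r *\<^sub>R ?P a f"
      using P(2)[OF a a, of "complex_of_real (inverse r)"] by (simp add: scaleR_ell2_def)
    ultimately show ?thesis using r0 by (simp add: field_simps)
  qed
  then have bd: "norm (?P a f) \<le> (nrm A a + e) * norm f" if "e > 0" for e
    using that by simp
  have "norm (?P a f) \<le> nrm A a * norm f + e" if e: "e > 0" for e
  proof (cases "norm f = 0")
    case False
    then show ?thesis using bd[of "e / norm f"] e by (simp add: distrib_right)
  qed (use e in simp)
  then show ?thesis by (rule field_le_epsilon)
qed

end

section \<open>The boundary path representation\<close>

text \<open>
  The paths act by prepending on \<open>\<ell>\<^sup>2(X)\<close>, where \<open>X\<close> is a countable set of boundary filters closed
  under the shifts; \<open>e\<close> enumerates \<open>X\<close>.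
\<close>
locale filter_action = k_graph k \<Lambda> for k :: nat and \<Lambda> :: "'a kgraph" +
  fixes X :: "'a set set" and e :: "'a set \<Rightarrow> nat"
  assumes aligned: "finitely_aligned \<Lambda>"
    and boundary: "S \<in> X \<Longrightarrow> boundary_filter S"
    and shift_closed: "S \<in> X \<Longrightarrow> \<xi> \<in> S \<Longrightarrow> shift_filter \<xi> S \<in> X"
    and prepend_closed: "S \<in> X \<Longrightarrow> \<xi> \<in> paths \<Lambda> \<Longrightarrow> src \<Lambda> \<xi> \<in> S \<Longrightarrow> prepend_filter \<xi> S \<in> X"
    and inj: "inj_on e X"
begin

definition act :: "'a \<Rightarrow> (nat \<times> nat) set" where
  "act \<xi> = {(e S, e (prepend_filter \<xi> S)) | S. S \<in> X \<and> src \<Lambda> \<xi> \<in> S}"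

text \<open>The trace on X of the cylinder of \<mu>, transported to indices; by
  \<open>act_range\<close> it carries the range projection.\<close>

definition points :: "'a \<Rightarrow> nat set" where
  "points \<mu> = e ` {S \<in> X. \<mu> \<in> S}"

definition isom :: "'a \<Rightarrow> universe" where
  "isom \<xi> = operator_code (partial_shift (act \<xi>))"

lemma pf: "S \<in> X \<Longrightarrow> path_filter S"
  using boundary unfolding boundary_filter_def by blast

lemma e_eq: "S \<in> X \<Longrightarrow> T \<in> X \<Longrightarrow> e S = e T \<longleftrightarrow> S = T"
  using inj by (simp add: inj_on_eq_iff)

lemma actE:
  assumes "(m, n) \<in> act \<xi>" "\<xi> \<in> paths \<Lambda>"
  obtains S where "S \<in> X" "src \<Lambda> \<xi> \<in> S" "m = e S" "n = e (prepend_filter \<xi> S)" "prepend_filter \<xi> S \<in> X"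
  using assms prepend_closed unfolding act_def by blast

lemma actI: "S \<in> X \<Longrightarrow> src \<Lambda> \<xi> \<in> S \<Longrightarrow> (e S, e (prepend_filter \<xi> S)) \<in> act \<xi>"
  unfolding act_def by blast

lemma actI':
  assumes "T \<in> X" "\<xi> \<in> T"
  shows "(e (shift_filter \<xi> T), e T) \<in> act \<xi>"
  using actI[OF shift_closed[OF assms] src_mem_shift[OF pf[OF assms(1)] assms(2)]]
  by (simp add: prepend_shift[OF pf[OF assms(1)] assms(2)])

text \<open>Injectivity holds because shifting by \<xi> undoes prepending \<xi>, and the enumeration
  separates the filters in X.\<close>

lemma partial_injection_act:
  assumes x: "\<xi> \<in> paths \<Lambda>"
  shows "partial_injection (act \<xi>)"
proof (rule partial_injectionI)
  fix m n n' assume "(m, n) \<in> act \<xi>" "(m, n') \<in> act \<xi>"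
  then show "n = n'" using x e_eq by (elim actE) auto
next
  fix m m' n assume "(m, n) \<in> act \<xi>" "(m', n) \<in> act \<xi>"
  then obtain S T where S: "S \<in> X" "src \<Lambda> \<xi> \<in> S" "m = e S" "n = e (prepend_filter \<xi> S)" "prepend_filter \<xi> S \<in> X"
    and T: "T \<in> X" "src \<Lambda> \<xi> \<in> T" "m' = e T" "n = e (prepend_filter \<xi> T)" "prepend_filter \<xi> T \<in> X"
    using x by (elim actE)
  then have "prepend_filter \<xi> S = prepend_filter \<xi> T" using e_eq by metis
  then show "m = m'" using prepend_inj[OF pf[OF S(1)] pf[OF T(1)] x S(2) T(2)] S T by simp
qed

lemma isom_carrier: "\<xi> \<in> paths \<Lambda> \<Longrightarrow> isom \<xi> \<in> carrier operator_algebra"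
  using partial_shift_operators[OF partial_injection_act] unfolding isom_def
  by (simp add: operator_algebra_simps)

lemma isom_adj:
  "\<xi> \<in> paths \<Lambda> \<Longrightarrow> adj operator_algebra (isom \<xi>) = operator_code (partial_shift ((act \<xi>)\<inverse>))"
  using partial_shift_operators[OF partial_injection_act] unfolding isom_def
  by (simp add: operator_algebra_simps)

text \<open>A filter arises by prepending \<xi> exactly when it contains \<xi>. In operator terms,
  s_xi s_xi^* projects onto the sequences supported on \<open>points \<xi>\<close>.\<close>

lemma act_range: 
  assumes x: "\<xi> \<in> paths \<Lambda>"
  shows "(act \<xi>)\<inverse> O act \<xi> = Id_on (points \<xi>)"
proof (intro equalityI subrelI)
  fix m n assume "(m, n) \<in> (act \<xi>)\<inverse> O act \<xi>"
  then obtain l where l: "(l, m) \<in> act \<xi>" "(l, n) \<in> act \<xi>" by blast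
  then have "m = n" using partial_injectionD(1)[OF partial_injection_act[OF x]] by blast
  obtain S where S: "S \<in> X" "src \<Lambda> \<xi> \<in> S" "n = e (prepend_filter \<xi> S)" "prepend_filter \<xi> S \<in> X"
    using l(2) x by (elim actE)
  then have "n \<in> points \<xi>" unfolding points_def using prepend_path_filter(2)[OF pf[OF S(1)] x S(2)] by blast
  then show "(m, n) \<in> Id_on (points \<xi>)" using \<open>m = n\<close> by blast
next
  fix m n assume "(m, n) \<in> Id_on (points \<xi>)"
  then obtain T where T: "T \<in> X" "\<xi> \<in> T" "m = e T" "n = e T" unfolding points_def by auto
  then show "(m, n) \<in> (act \<xi>)\<inverse> O act \<xi>" using actI'[OF T(1,2)] by auto
qed

lemma isom_range_projection:
  assumes "\<xi> \<in> paths \<Lambda>"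
  shows "isom \<xi> \<otimes>\<^bsub>operator_algebra\<^esub> adj operator_algebra (isom \<xi>) = operator_code (partial_shift (Id_on (points \<xi>)))"
  using partial_shift_compose[OF partial_injection_act partial_injection_converse[OF partial_injection_act]]
    assms act_range[OF assms]
  unfolding isom_adj[OF assms] by (simp add: isom_def operator_algebra_simps)

text \<open>Shifting by an identity fixes every filter that contains it, and hence so does
  prepending it.\<close>

lemma act_vertex:
  assumes v: "v \<in> vertices \<Lambda>"
  shows "act v = Id_on (points v)"
proof -
  note vv = vertex_rng_src[OF v]
  have "prepend_filter v S = S" if S: "S \<in> X" "v \<in> S" for S
  proof -
    have "shift_filter v S = S"
    proof (intro equalityI subsetI)
      fix \<alpha> assume "\<alpha> \<in> shift_filter v S"
      then show "\<alpha> \<in> S" unfolding shift_filter_def using vv comp_rng by auto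
    next
      fix \<alpha> assume a: "\<alpha> \<in> S"
      then have "\<alpha> \<in> paths \<Lambda>" "rng \<Lambda> \<alpha> = v"
        using path_filterD(1)[OF pf[OF S(1)]] filter_mem_vertex_iff[OF pf[OF S(1)] a v] S(2) by auto
      then show "\<alpha> \<in> shift_filter v S" unfolding shift_filter_def using vv comp_rng a by auto
    qed
    then show ?thesis using prepend_shift[OF pf[OF S(1)] S(2)] by simp
  qed
  then show ?thesis unfolding act_def points_def using vv by force
qed

lemma isom_vertex: "v \<in> vertices \<Lambda> \<Longrightarrow> isom v = operator_code (partial_shift (Id_on (points v)))"
  unfolding isom_def using act_vertex by simp

lemma e_mem_points: "S \<in> X \<Longrightarrow> e S \<in> points \<mu> \<longleftrightarrow> \<mu> \<in> S"
  unfolding points_def using e_eq by auto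

lemma points_vertex_disjoint:
  assumes "v \<in> vertices \<Lambda>" "w \<in> vertices \<Lambda>" "v \<noteq> w"
  shows "points v \<inter> points w = {}"
proof -
  have False if S: "S \<in> X" "v \<in> S" "w \<in> S" for S
    using filter_mem_vertex_iff[OF pf[OF S(1)] S(2) assms(2)] vertex_rng_src[OF assms(1)] S(3) assms(3) by simp
  then show ?thesis unfolding points_def using e_eq by auto
qed

lemma act_comp:
  assumes p: "\<mu> \<in> paths \<Lambda>" "\<nu> \<in> paths \<Lambda>" "src \<Lambda> \<mu> = rng \<Lambda> \<nu>"
  shows "act \<nu> O act \<mu> = act (\<mu> \<cdot> \<nu>)"
proof -
  note c = comp_closed[OF p] src_comp[OF p]
  show ?thesis
  proof (intro equalityI subrelI)
    fix m n assume "(m, n) \<in> act \<nu> O act \<mu>"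
    then obtain l where l: "(m, l) \<in> act \<nu>" "(l, n) \<in> act \<mu>" by blast
    obtain S where S: "S \<in> X" "src \<Lambda> \<nu> \<in> S" "m = e S" "l = e (prepend_filter \<nu> S)" "prepend_filter \<nu> S \<in> X"
      using l(1) p by (elim actE)
    obtain T where T: "T \<in> X" "l = e T" "n = e (prepend_filter \<mu> T)" using l(2) p by (elim actE)
    have "T = prepend_filter \<nu> S" using S T e_eq by metis
    then have "n = e (prepend_filter (\<mu> \<cdot> \<nu>) S)" using T prepend_comp[OF pf[OF S(1)] p S(2)] by simp
    then show "(m, n) \<in> act (\<mu> \<cdot> \<nu>)" using actI[of S "\<mu> \<cdot> \<nu>"] S c by simp
  next
    fix m n assume "(m, n) \<in> act (\<mu> \<cdot> \<nu>)"
    then obtain S where S: "S \<in> X" "src \<Lambda> \<nu> \<in> S" "m = e S" "n = e (prepend_filter (\<mu> \<cdot> \<nu>) S)"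
      using c by (elim actE) auto
    let ?T = "prepend_filter \<nu> S"
    note T = prepend_closed[OF S(1) p(2) S(2)] prepend_path_filter[OF pf[OF S(1)] p(2) S(2)]
    have "src \<Lambda> \<mu> \<in> ?T" using filter_rng_in[OF T(2,3)] p(3) by simp
    then have "(e ?T, n) \<in> act \<mu>"
      using actI[OF T(1), of \<mu>] S(4) prepend_comp[OF pf[OF S(1)] p S(2)] by simp
    moreover have "(m, e ?T) \<in> act \<nu>" using actI[OF S(1,2)] S(3) by simp
    ultimately show "(m, n) \<in> act \<nu> O act \<mu>" by blast
  qed
qed

text \<open>The combinatorial form of (CK3). If prepending \<nu> to S and \<mu> to T gives the same
  filter K, then K contains both paths and so a minimal extension \<mu> \<cdot> \<alpha> = \<nu>
  \<cdot> \<beta>. S and T then arise by prepending \<beta> and \<alpha> to one common tail.\<close>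

lemma act_min_ext:
  assumes p: "\<mu> \<in> paths \<Lambda>" "\<nu> \<in> paths \<Lambda>"
  shows "act \<nu> O (act \<mu>)\<inverse> = (\<Union>p\<in>min_ext \<Lambda> \<mu> \<nu>. (act (snd p))\<inverse> O act (fst p))"
proof (intro equalityI subrelI)
  fix m n assume "(m, n) \<in> act \<nu> O (act \<mu>)\<inverse>"
  then obtain l where l: "(m, l) \<in> act \<nu>" "(n, l) \<in> act \<mu>" by blast
  obtain S where S: "S \<in> X" "src \<Lambda> \<nu> \<in> S" "m = e S" "l = e (prepend_filter \<nu> S)" "prepend_filter \<nu> S \<in> X"
    using l(1) p(2) by (elim actE)
  obtain T where T: "T \<in> X" "src \<Lambda> \<mu> \<in> T" "n = e T" "l = e (prepend_filter \<mu> T)" "prepend_filter \<mu> T \<in> X"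
    using l(2) p(1) by (elim actE)
  let ?K = "prepend_filter \<nu> S"
  have K: "?K = prepend_filter \<mu> T" using S T e_eq by metis
  have mn: "\<mu> \<in> ?K" "\<nu> \<in> ?K"
    using prepend_path_filter(2)[OF pf[OF S(1)] p(2) S(2)] prepend_path_filter(2)[OF pf[OF T(1)] p(1) T(2)] K by auto
  obtain \<alpha> \<beta> where ab: "(\<alpha>, \<beta>) \<in> min_ext \<Lambda> \<mu> \<nu>" "\<mu> \<cdot> \<alpha> \<in> ?K"
    using filter_min_ext[OF pf[OF S(5)] mn] by (metis fst_conv surj_pair)
  then have m: "\<alpha> \<in> paths \<Lambda>" "\<beta> \<in> paths \<Lambda>" "src \<Lambda> \<mu> = rng \<Lambda> \<alpha>" "src \<Lambda> \<nu> = rng \<Lambda> \<beta>" "\<mu> \<cdot> \<alpha> = \<nu> \<cdot> \<beta>"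
    unfolding min_ext_def by auto
  have aT: "\<alpha> \<in> T"
    using shift_prepend[OF pf[OF T(1)] p(1) T(2)] ab(2) m K unfolding shift_filter_def by auto
  have bS: "\<beta> \<in> S"
    using shift_prepend[OF pf[OF S(1)] p(2) S(2)] ab(2) m unfolding shift_filter_def by auto
  let ?U = "shift_filter \<alpha> T" and ?V = "shift_filter \<beta> S"
  have U: "?U \<in> X" "src \<Lambda> \<alpha> \<in> ?U" "prepend_filter \<alpha> ?U = T"
    using shift_closed[OF T(1) aT] src_mem_shift[OF pf[OF T(1)] aT] prepend_shift[OF pf[OF T(1)] aT] by auto
  have V: "?V \<in> X" "src \<Lambda> \<beta> \<in> ?V" "prepend_filter \<beta> ?V = S"
    using shift_closed[OF S(1) bS] src_mem_shift[OF pf[OF S(1)] bS] prepend_shift[OF pf[OF S(1)] bS] by auto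
  have s: "src \<Lambda> (\<mu> \<cdot> \<alpha>) = src \<Lambda> \<alpha>" "src \<Lambda> (\<mu> \<cdot> \<alpha>) = src \<Lambda> \<beta>"
    using src_comp p m by metis+
  \<comment> \<open>The tails agree because prepending \<mu> \<cdot> \<alpha> = \<nu> \<cdot>
    \<beta> to either of them gives ?K.\<close>
  have "?U = ?V"
  proof (rule prepend_inj[of _ _ "\<mu> \<cdot> \<alpha>"])
    show "prepend_filter (\<mu> \<cdot> \<alpha>) ?U = prepend_filter (\<mu> \<cdot> \<alpha>) ?V"
      using prepend_comp[OF pf[OF U(1)] p(1) m(1,3) U(2)] prepend_comp[OF pf[OF V(1)] p(2) m(2,4) V(2)] U(3) V(3) K m(5)
      by simp
  qed (use U V s pf p m comp_closed in auto)
  then have "(m, n) \<in> (act \<beta>)\<inverse> O act \<alpha>"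
    using actI[OF U(1,2)] actI[OF V(1,2)] U(3) V(3) S(3) T(3) by auto
  then show "(m, n) \<in> (\<Union>p\<in>min_ext \<Lambda> \<mu> \<nu>. (act (snd p))\<inverse> O act (fst p))"
    using ab(1) by force
next
  fix m n assume "(m, n) \<in> (\<Union>p\<in>min_ext \<Lambda> \<mu> \<nu>. (act (snd p))\<inverse> O act (fst p))"
  then obtain \<alpha> \<beta> l where ab: "(\<alpha>, \<beta>) \<in> min_ext \<Lambda> \<mu> \<nu>" "(l, m) \<in> act \<beta>" "(l, n) \<in> act \<alpha>" by auto
  have m: "\<alpha> \<in> paths \<Lambda>" "\<beta> \<in> paths \<Lambda>" "src \<Lambda> \<mu> = rng \<Lambda> \<alpha>" "src \<Lambda> \<nu> = rng \<Lambda> \<beta>" "\<mu> \<cdot> \<alpha> = \<nu> \<cdot> \<beta>"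
    using ab(1) unfolding min_ext_def by auto
  obtain U where U: "U \<in> X" "src \<Lambda> \<alpha> \<in> U" "l = e U" using ab(3) m(1) by (elim actE)
  have s: "src \<Lambda> \<alpha> = src \<Lambda> \<beta>" using src_comp p m by metis
  have kk: "(l, e (prepend_filter (\<mu> \<cdot> \<alpha>) U)) \<in> act (\<mu> \<cdot> \<alpha>)"
    using actI[OF U(1), of "\<mu> \<cdot> \<alpha>"] U src_comp[OF p(1) m(1,3)] by simp
  then obtain n' m' where nm: "(l, n') \<in> act \<alpha>" "(n', e (prepend_filter (\<mu> \<cdot> \<alpha>) U)) \<in> act \<mu>"
    "(l, m') \<in> act \<beta>" "(m', e (prepend_filter (\<mu> \<cdot> \<alpha>) U)) \<in> act \<nu>"
    using act_comp[OF p(1) m(1,3)] act_comp[OF p(2) m(2,4)] m(5) by (metis relcompEpair)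
  have "n = n'" "m = m'"
    using partial_injectionD(1)[OF partial_injection_act] ab nm m(1,2) by metis+
  then show "(m, n) \<in> act \<nu> O (act \<mu>)\<inverse>" using nm by blast
qed

text \<open>The first components of minimal extensions all have the same degree, and one filter
  contains at most one path of each degree. The second components then agree by cancelling
  \<nu>.\<close>

lemma range_min_ext_disjoint:
  assumes p: "\<mu> \<in> paths \<Lambda>" "\<nu> \<in> paths \<Lambda>" and pq: "p \<in> min_ext \<Lambda> \<mu> \<nu>" "q \<in> min_ext \<Lambda> \<mu> \<nu>"
    and n: "n \<in> Range (act (fst p))" "n \<in> Range (act (fst q))"
  shows "p = q"
proof -
  obtain \<alpha> \<beta> \<gamma> \<delta> where e: "p = (\<alpha>, \<beta>)" "q = (\<gamma>, \<delta>)" by fastforce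
  have m: "\<alpha> \<in> paths \<Lambda>" "\<beta> \<in> paths \<Lambda>" "src \<Lambda> \<mu> = rng \<Lambda> \<alpha>" "src \<Lambda> \<nu> = rng \<Lambda> \<beta>" "\<mu> \<cdot> \<alpha> = \<nu> \<cdot> \<beta>"
    "deg \<Lambda> (\<mu> \<cdot> \<alpha>) = sup (deg \<Lambda> \<mu>) (deg \<Lambda> \<nu>)"
    "\<gamma> \<in> paths \<Lambda>" "\<delta> \<in> paths \<Lambda>" "src \<Lambda> \<mu> = rng \<Lambda> \<gamma>" "src \<Lambda> \<nu> = rng \<Lambda> \<delta>" "\<mu> \<cdot> \<gamma> = \<nu> \<cdot> \<delta>"
    "deg \<Lambda> (\<mu> \<cdot> \<gamma>) = sup (deg \<Lambda> \<mu>) (deg \<Lambda> \<nu>)"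
    using pq unfolding e min_ext_def by auto
  obtain S where S: "S \<in> X" "src \<Lambda> \<alpha> \<in> S" "n = e (prepend_filter \<alpha> S)" "prepend_filter \<alpha> S \<in> X"
    using n(1) m(1) e by (auto elim: actE)
  obtain T where T: "T \<in> X" "src \<Lambda> \<gamma> \<in> T" "n = e (prepend_filter \<gamma> T)" "prepend_filter \<gamma> T \<in> X"
    using n(2) m(7) e by (auto elim: actE)
  have eq: "prepend_filter \<alpha> S = prepend_filter \<gamma> T" using S T e_eq by metis
  have "deg \<Lambda> \<mu> + deg \<Lambda> \<alpha> = deg \<Lambda> \<mu> + deg \<Lambda> \<gamma>" using deg_comp p m by metis
  then have "deg \<Lambda> \<alpha> = deg \<Lambda> \<gamma>" by (rule add_left_imp_eq)
  then have ag: "\<alpha> = \<gamma>"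
    using filter_deg_unique[OF pf[OF S(4)]] prepend_path_filter(2)[OF pf[OF S(1)] m(1) S(2)]
      prepend_path_filter(2)[OF pf[OF T(1)] m(7) T(2)] eq by metis
  then have "\<beta> = \<delta>" using comp_cancel[OF p(2) m(2,8,4,10)] m(5,11) by simp
  then show ?thesis using e ag by simp
qed

text \<open>Projections onto index sets multiply by intersection, so each factor of the product
  removes the points of one \<mu> from the points of v.\<close>

lemma isom_prod_vertex:
  assumes v: "v \<in> vertices \<Lambda>" and Es: "set Es \<subseteq> paths_from \<Lambda> v"
  shows "foldr (\<lambda>\<mu> a. (isom v \<ominus>\<^bsub>operator_algebra\<^esub> isom \<mu> \<otimes>\<^bsub>operator_algebra\<^esub> adj operator_algebra (isom \<mu>))
      \<otimes>\<^bsub>operator_algebra\<^esub> a) Es (isom v) = operator_code (partial_shift (Id_on (points v - (\<Union>\<mu>\<in>set Es. points \<mu>))))"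
  using Es
proof (induction Es)
  case Nil
  then show ?case using isom_vertex[OF v] by simp
next
  case (Cons \<mu> Es)
  have m: "\<mu> \<in> paths \<Lambda>" "rng \<Lambda> \<mu> = v" using Cons.prems unfolding paths_from_def by auto
  have sub: "points \<mu> \<subseteq> points v"
    unfolding points_def using filter_rng_in[OF pf] m(2) by blast
  note PI = partial_injection_Id_on
  note PO = partial_shift_operators(1)[OF PI]
  have "isom v \<ominus>\<^bsub>operator_algebra\<^esub> isom \<mu> \<otimes>\<^bsub>operator_algebra\<^esub> adj operator_algebra (isom \<mu>) =
      operator_code (partial_shift (Id_on (points v - points \<mu>)))"
    unfolding isom_range_projection[OF m(1)] isom_vertex[OF v] operator_algebra_minus[OF PO PO]
      partial_shift_Id_on_minus[OF sub] ..
  moreover have "Id_on (points v - (\<Union>\<mu>\<in>set Es. points \<mu>)) O Id_on (points v - points \<mu>) =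
      Id_on (points v - (\<Union>\<mu>\<in>set (\<mu> # Es). points \<mu>))" by auto
  ultimately show ?case
    using Cons by (simp add: operator_algebra_simps partial_shift_compose[OF PI PI])
qed

lemma ck_family_isom: "ck_family operator_algebra \<Lambda> isom"
proof (rule ck_family.intro[OF cstar_operator_algebra ck_family_axioms.intro])
  note P = partial_injection_act
  note PO = partial_shift_operators(1)
  show "isom \<xi> \<in> carrier operator_algebra" if "\<xi> \<in> paths \<Lambda>" for \<xi> using isom_carrier[OF that] .
  show "isom \<xi> \<otimes>\<^bsub>operator_algebra\<^esub> adj operator_algebra (isom \<xi>) \<otimes>\<^bsub>operator_algebra\<^esub> isom \<xi> = isom \<xi>"
    if x: "\<xi> \<in> paths \<Lambda>" for \<xi>
  proof -
    have "act \<xi> O Id_on (points \<xi>) = act \<xi>"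
    proof -
      have "n \<in> points \<xi>" if "(m, n) \<in> act \<xi>" for m n using that act_range[OF x] by blast
      then show ?thesis by auto
    qed
    then show ?thesis
      unfolding isom_range_projection[OF x]
      by (simp add: isom_def operator_algebra_simps partial_shift_compose[OF partial_injection_Id_on P[OF x]])
  qed
  show "isom v \<otimes>\<^bsub>operator_algebra\<^esub> isom v = isom v \<and> adj operator_algebra (isom v) = isom v"
    if v: "v \<in> vertices \<Lambda>" for v
  proof -
    have "Id_on (points v) O Id_on (points v) = Id_on (points v)" by auto
    then show ?thesis
      using partial_shift_operators(2)[OF partial_injection_Id_on, of "points v"]
        partial_shift_compose[OF partial_injection_Id_on partial_injection_Id_on, of "points v" "points v"]
      by (simp add: isom_vertex[OF v] operator_algebra_simps)
  qed
  show "isom v \<otimes>\<^bsub>operator_algebra\<^esub> isom w = \<zero>\<^bsub>operator_algebra\<^esub>"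
    if v: "v \<in> vertices \<Lambda>" "w \<in> vertices \<Lambda>" "v \<noteq> w" for v w
  proof -
    have "Id_on (points w) O Id_on (points v) = {}" using points_vertex_disjoint[OF v] by auto
    then show ?thesis
      by (simp add: isom_vertex[OF v(1)] isom_vertex[OF v(2)] operator_algebra_simps
          partial_shift_compose[OF partial_injection_Id_on partial_injection_Id_on] partial_shift_empty)
  qed
  show "isom \<mu> \<otimes>\<^bsub>operator_algebra\<^esub> isom \<nu> = isom (\<mu> \<cdot> \<nu>)"
    if p: "\<mu> \<in> paths \<Lambda>" "\<nu> \<in> paths \<Lambda>" "src \<Lambda> \<mu> = rng \<Lambda> \<nu>" for \<mu> \<nu>
    using partial_shift_compose[OF P[OF p(1)] P[OF p(2)]] act_comp[OF p]
    by (simp add: isom_def operator_algebra_simps)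
  show "adj operator_algebra (isom \<mu>) \<otimes>\<^bsub>operator_algebra\<^esub> isom \<nu> =
      (\<Oplus>\<^bsub>operator_algebra\<^esub>p\<in>min_ext \<Lambda> \<mu> \<nu>. isom (fst p) \<otimes>\<^bsub>operator_algebra\<^esub> adj operator_algebra (isom (snd p)))"
    if p: "\<mu> \<in> paths \<Lambda>" "\<nu> \<in> paths \<Lambda>" for \<mu> \<nu>
  proof -
    let ?M = "min_ext \<Lambda> \<mu> \<nu>" and ?F = "\<lambda>p. (act (snd p))\<inverse> O act (fst p)"
    have fin: "finite ?M" using aligned p unfolding finitely_aligned_def by blast
    have mp: "fst p \<in> paths \<Lambda>" "snd p \<in> paths \<Lambda>" if "p \<in> ?M" for p
      using that unfolding min_ext_def by auto
    have pi: "partial_injection (act \<nu> O (act \<mu>)\<inverse>)"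
      using partial_injection_comp P partial_injection_converse p by blast
    have Fi: "partial_injection (?F p)" if "p \<in> ?M" for p
      using partial_injection_comp P partial_injection_converse mp[OF that] by blast
    have summand: "isom (fst p) \<otimes>\<^bsub>operator_algebra\<^esub> adj operator_algebra (isom (snd p)) = operator_code (partial_shift (?F p))"
      if "p \<in> ?M" for p
      using partial_shift_compose[OF P[OF mp(1)[OF that]] partial_injection_converse[OF P[OF mp(2)[OF that]]]]
      unfolding isom_adj[OF mp(2)[OF that]] by (simp add: isom_def operator_algebra_simps)
    have "adj operator_algebra (isom \<mu>) \<otimes>\<^bsub>operator_algebra\<^esub> isom \<nu> = operator_code (partial_shift (act \<nu> O (act \<mu>)\<inverse>))"
      using partial_shift_compose[OF partial_injection_converse[OF P[OF p(1)]] P[OF p(2)]]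
      unfolding isom_adj[OF p(1)] by (simp add: isom_def operator_algebra_simps)
    also have "partial_shift (act \<nu> O (act \<mu>)\<inverse>) = (\<Sum>p\<in>?M. partial_shift (?F p))"
      unfolding act_min_ext[OF p]
    proof (rule partial_shift_UN[OF _ fin])
      show "partial_injection (\<Union>p\<in>?M. ?F p)" using pi unfolding act_min_ext[OF p] .
      fix q r n assume "q \<in> ?M" "r \<in> ?M" "n \<in> Range (?F q)" "n \<in> Range (?F r)"
      then show "q = r" using range_min_ext_disjoint[OF p, of q r n] by blast
    qed
    also have "operator_code (\<Sum>p\<in>?M. partial_shift (?F p)) =
        (\<Oplus>\<^bsub>operator_algebra\<^esub>p\<in>?M. operator_code (partial_shift (?F p)))"
      using finsum_operator_algebra[OF fin, of "\<lambda>p. partial_shift (?F p)"] PO[OF Fi] by simp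
    also have "\<dots> = (\<Oplus>\<^bsub>operator_algebra\<^esub>p\<in>?M. isom (fst p) \<otimes>\<^bsub>operator_algebra\<^esub> adj operator_algebra (isom (snd p)))"
    proof -
      interpret G: abelian_group operator_algebra by (rule abelian_group_operator_algebra)
      show ?thesis
        by (rule G.finsum_cong') (use summand PO[OF Fi] in \<open>auto simp: operator_algebra_simps\<close>)
    qed
    finally show ?thesis .
  qed
  show "foldr (\<lambda>\<mu> a. (isom v \<ominus>\<^bsub>operator_algebra\<^esub> isom \<mu> \<otimes>\<^bsub>operator_algebra\<^esub> adj operator_algebra (isom \<mu>))
      \<otimes>\<^bsub>operator_algebra\<^esub> a) Es (isom v) = \<zero>\<^bsub>operator_algebra\<^esub>"
    if v: "v \<in> vertices \<Lambda>" and E: "E \<in> finite_exhaustive \<Lambda> v" and Es: "distinct Es" "set Es = E" for v E Es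
  proof -
    have sub: "set Es \<subseteq> paths_from \<Lambda> v" using E Es unfolding finite_exhaustive_def exhaustive_def by auto
    \<comment> \<open>The boundary condition at the vertex v itself: every filter in X containing v
      meets E, so the set left over by the product is empty.\<close>
    have "\<exists>\<nu>\<in>E. \<nu> \<in> S" if S: "S \<in> X" "v \<in> S" for S
    proof -
      obtain \<nu> where n: "\<nu> \<in> E" "v \<cdot> \<nu> \<in> S"
        using boundary[OF S(1)] S(2) E vertex_rng_src(3)[OF v] unfolding boundary_filter_def by metis
      then have "v \<cdot> \<nu> = \<nu>" using sub Es comp_rng unfolding paths_from_def by auto
      then show ?thesis using n by auto
    qed
    then have empty: "points v - (\<Union>\<mu>\<in>set Es. points \<mu>) = {}" unfolding points_def using Es by auto
    then show ?thesis
      unfolding isom_prod_vertex[OF v sub] empty by (simp add: partial_shift_empty operator_algebra_simps)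
  qed
qed

end

text \<open>X is what finite words of shifts and prepends reach from S0. The letters form a
  countable set, hence so do the words and their results.\<close>

lemma (in k_graph) ex_filter_action:
  assumes fa: "finitely_aligned \<Lambda>" and S0: "boundary_filter S0"
  obtains X e where "filter_action k \<Lambda> X e" "S0 \<in> X"
proof -
  \<comment> \<open>The flag selects shift or prepend. A move that does not apply leaves the filter
    unchanged, so words act without side conditions.\<close>
  define act where "act p S = (let (b, \<xi>) = p in
      if b \<and> \<xi> \<in> S then shift_filter \<xi> S
      else if \<not> b \<and> \<xi> \<in> paths \<Lambda> \<and> src \<Lambda> \<xi> \<in> S then prepend_filter \<xi> S else S)" for p :: "bool \<times> 'a" and S
  define X where "X = (\<lambda>w. fold act w S0) ` lists (UNIV \<times> paths \<Lambda>)"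
  have cX: "countable X" unfolding X_def using countable_paths by (intro countable_image countable_lists) auto
  have bf: "boundary_filter (act p S)" if "boundary_filter S" for p S
    using that shift_boundary_filter prepend_boundary_filter[OF fa] unfolding act_def
    by (auto split: prod.split)
  have bX: "boundary_filter S" if S: "S \<in> X" for S
  proof -
    have "boundary_filter (fold act w T)" if "boundary_filter T" for w T
      using that by (induction w arbitrary: T) (auto intro: bf)
    then show ?thesis using S S0 unfolding X_def by auto
  qed
  have aX: "act p S \<in> X" if S: "S \<in> X" and p: "snd p \<in> paths \<Lambda>" for p S
  proof -
    obtain w where w: "w \<in> lists (UNIV \<times> paths \<Lambda>)" "S = fold act w S0" using S unfolding X_def by auto
    \<comment> \<open>The new move is appended at the end, because \<open>fold\<close> applies the
      last letter last.\<close>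
    have "w @ [p] \<in> lists (UNIV \<times> paths \<Lambda>)" using w(1) p by (cases p) auto
    moreover have "act p S = fold act (w @ [p]) S0" using w(2) by simp
    ultimately show ?thesis unfolding X_def by blast
  qed
  have "filter_action k \<Lambda> X (to_nat_on X)"
  proof (unfold_locales)
    show "finitely_aligned \<Lambda>" by (rule fa)
    show "boundary_filter S" if "S \<in> X" for S using bX that .
    show "inj_on (to_nat_on X) X" by (rule inj_on_to_nat_on[OF cX])
    fix S \<xi> assume S: "S \<in> X"
    have "path_filter S" using bX[OF S] unfolding boundary_filter_def by blast
    then show "shift_filter \<xi> S \<in> X" if "\<xi> \<in> S"
      using aX[OF S, of "(True, \<xi>)"] that path_filterD(1) by (simp add: act_def)
    show "prepend_filter \<xi> S \<in> X" if "\<xi> \<in> paths \<Lambda>" "src \<Lambda> \<xi> \<in> S"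
      using aX[OF S, of "(False, \<xi>)"] that by (simp add: act_def)
  qed
  moreover have "S0 \<in> X" unfolding X_def by (rule image_eqI[of _ _ "[]"]) auto
  ultimately show ?thesis using that by blast
qed

section \<open>The diagonal subalgebra and its characters\<close>

context cstar_algebra
begin

section \<open>Finite sums in a C*-algebra\<close>

lemma finsum_mult_left:
  assumes "finite M" "\<And>p. p \<in> M \<Longrightarrow> F p \<in> carrier A" "x \<in> carrier A"
  shows "x \<otimes> (\<Oplus>p\<in>M. F p) = (\<Oplus>p\<in>M. x \<otimes> F p)"
  using assms
proof (induction M)
  case (insert p M)
  have F: "F \<in> M \<rightarrow> carrier A" "(\<lambda>p. x \<otimes> F p) \<in> M \<rightarrow> carrier A" using insert closed by auto
  then show ?case using insert closed by (simp add: mult_add_right M.finsum_closed)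
qed (simp add: mult_zero_right)

lemma finsum_mult_right:
  assumes "finite M" "\<And>p. p \<in> M \<Longrightarrow> F p \<in> carrier A" "x \<in> carrier A"
  shows "(\<Oplus>p\<in>M. F p) \<otimes> x = (\<Oplus>p\<in>M. F p \<otimes> x)"
  using assms
proof (induction M)
  case (insert p M)
  have F: "F \<in> M \<rightarrow> carrier A" "(\<lambda>p. F p \<otimes> x) \<in> M \<rightarrow> carrier A" using insert closed by auto
  then show ?case using insert closed by (simp add: mult_add_left M.finsum_closed)
qed (simp add: mult_zero_left)

lemma finsum_subspace:
  assumes "finite M" "subspace_of A V" "\<And>p. p \<in> M \<Longrightarrow> F p \<in> V"
  shows "(\<Oplus>p\<in>M. F p) \<in> V"
  using assms(1,3)
proof (induction M)
  case empty
  then show ?case using subspaceD(2)[OF assms(2)] by simp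
next
  case (insert p M)
  have "F \<in> M \<rightarrow> carrier A" "F p \<in> carrier A" using insert subspaceD(1)[OF assms(2)] by auto
  then show ?case using insert subspaceD(3)[OF assms(2)] by simp
qed

end

section \<open>Range projections and the diagonal\<close>

locale aligned_ck_family = k_graph k \<Lambda> + ck_family A \<Lambda> s
  for k :: nat and \<Lambda> :: "'a kgraph" and A :: "'b cstar" (structure) and s :: "'a \<Rightarrow> 'b" +
  assumes aligned: "finitely_aligned \<Lambda>"
begin

definition proj :: "'a \<Rightarrow> 'b" where
  "proj \<mu> = s \<mu> \<otimes> adj A (s \<mu>)"

lemma s_closed: "\<mu> \<in> paths \<Lambda> \<Longrightarrow> s \<mu> \<in> carrier A" "\<mu> \<in> paths \<Lambda> \<Longrightarrow> adj A (s \<mu>) \<in> carrier A"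
  using in_carrier closed by auto

lemma proj_closed: "\<mu> \<in> paths \<Lambda> \<Longrightarrow> proj \<mu> \<in> carrier A"
  unfolding proj_def using s_closed closed by auto

lemma proj_adj: "\<mu> \<in> paths \<Lambda> \<Longrightarrow> adj A (proj \<mu>) = proj \<mu>"
  unfolding proj_def using s_closed adj_mult adj_adj by auto

lemma range_projections_eq: "range_projections A \<Lambda> s = proj ` paths \<Lambda>"
  unfolding range_projections_def proj_def by auto

lemma s_src:
  assumes m: "\<mu> \<in> paths \<Lambda>"
  shows "adj A (s \<mu>) \<otimes> s \<mu> = s (src \<Lambda> \<mu>)"
proof -
  let ?v = "src \<Lambda> \<mu>"
  have v: "?v \<in> vertices \<Lambda>" "?v \<in> paths \<Lambda>" using src_vertex src_closed m by auto
  have "adj A (s \<mu>) \<otimes> s \<mu> = s ?v \<otimes> adj A (s ?v)"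
    using CK3[OF m m] min_ext_self[OF m] s_closed[OF v(2)] closed by simp
  then show ?thesis using CK1_projection[OF v(1)] by simp
qed

text \<open>Apply (CK3) to the two inner factors of the product. Each resulting term is s at \<mu>
  \<cdot> \<alpha> times the adjoint of s at \<nu> \<cdot> \<beta>, a range projection because these
  two paths are equal.\<close>

lemma proj_mult:
  assumes p: "\<mu> \<in> paths \<Lambda>" "\<nu> \<in> paths \<Lambda>"
  shows "proj \<mu> \<otimes> proj \<nu> = (\<Oplus>p\<in>min_ext \<Lambda> \<mu> \<nu>. proj (\<mu> \<cdot> fst p))"
proof -
  let ?M = "min_ext \<Lambda> \<mu> \<nu>" and ?F = "\<lambda>p. s (fst p) \<otimes> adj A (s (snd p))"
  have fin: "finite ?M" using aligned p unfolding finitely_aligned_def by blast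
  note c = s_closed[OF p(1)] s_closed[OF p(2)]
  have mp: "fst q \<in> paths \<Lambda>" "snd q \<in> paths \<Lambda>" "src \<Lambda> \<mu> = rng \<Lambda> (fst q)" "src \<Lambda> \<nu> = rng \<Lambda> (snd q)"
    "\<mu> \<cdot> fst q = \<nu> \<cdot> snd q" if "q \<in> ?M" for q
    using that unfolding min_ext_def by auto
  have F: "?F q \<in> carrier A" if "q \<in> ?M" for q using mp[OF that] s_closed closed by auto
  have G: "s \<mu> \<otimes> ?F q \<otimes> adj A (s \<nu>) = proj (\<mu> \<cdot> fst q)" if q: "q \<in> ?M" for q
  proof -
    note d = s_closed[OF mp(1)[OF q]] s_closed[OF mp(2)[OF q]]
    have "s \<mu> \<otimes> ?F q \<otimes> adj A (s \<nu>) = (s \<mu> \<otimes> s (fst q)) \<otimes> (adj A (s (snd q)) \<otimes> adj A (s \<nu>))"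
      using c d closed by (simp add: mult_assoc)
    also have "adj A (s (snd q)) \<otimes> adj A (s \<nu>) = adj A (s \<nu> \<otimes> s (snd q))"
      using c d adj_mult by simp
    finally show ?thesis
      using CK2[OF p(1) mp(1)[OF q] mp(3)[OF q]] CK2[OF p(2) mp(2)[OF q] mp(4)[OF q]] mp(5)[OF q]
      unfolding proj_def by simp
  qed
  have "proj \<mu> \<otimes> proj \<nu> = s \<mu> \<otimes> (adj A (s \<mu>) \<otimes> s \<nu>) \<otimes> adj A (s \<nu>)"
    unfolding proj_def using c closed by (simp add: mult_assoc)
  also have "\<dots> = s \<mu> \<otimes> (\<Oplus>q\<in>?M. ?F q) \<otimes> adj A (s \<nu>)" unfolding CK3[OF p] ..
  also have "\<dots> = (\<Oplus>q\<in>?M. s \<mu> \<otimes> ?F q) \<otimes> adj A (s \<nu>)" using finsum_mult_left[OF fin, of ?F] F c by simp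
  also have "\<dots> = (\<Oplus>q\<in>?M. s \<mu> \<otimes> ?F q \<otimes> adj A (s \<nu>))"
    using finsum_mult_right[OF fin, of "\<lambda>q. s \<mu> \<otimes> ?F q"] F c closed by simp
  also have "\<dots> = (\<Oplus>q\<in>?M. proj (\<mu> \<cdot> fst q))"
    by (rule M.finsum_cong') (use G proj_closed comp_closed p mp in auto)
  finally show ?thesis .
qed

text \<open>The element s_xi factors as s_mu s_alpha, and s_mu s_mu^* fixes s_mu by the partial
  isometry law.\<close>

lemma proj_mult_prefix:
  assumes "prefix \<mu> \<xi>"
  shows "proj \<mu> \<otimes> proj \<xi> = proj \<xi>"
proof -
  obtain \<alpha> where a: "\<mu> \<in> paths \<Lambda>" "\<alpha> \<in> paths \<Lambda>" "src \<Lambda> \<mu> = rng \<Lambda> \<alpha>" "\<xi> = \<mu> \<cdot> \<alpha>"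
    using assms unfolding prefix_def by blast
  note c = s_closed[OF a(1)] s_closed[OF a(2)]
  have "proj \<mu> \<otimes> (s \<mu> \<otimes> s \<alpha>) = s \<mu> \<otimes> s \<alpha>"
    using partial_isometry[OF a(1)] mult_assoc[of "proj \<mu>" "s \<mu>" "s \<alpha>"] proj_closed[OF a(1)] c unfolding proj_def by simp
  then have "proj \<mu> \<otimes> s \<xi> = s \<xi>" using CK2[OF a(1-3)] a(4) by simp
  then show ?thesis
    using mult_assoc[of "proj \<mu>" "s \<xi>" "adj A (s \<xi>)"] proj_closed[OF a(1)] s_closed[of \<xi>] comp_closed[OF a(1-3)] a(4)
    unfolding proj_def[of \<xi>] by simp
qed

abbreviation P :: "'b set" where "P \<equiv> range_projections A \<Lambda> s"

abbreviation D :: "'b cstar" where "D \<equiv> diagonal A \<Lambda> s"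

lemma P_carrier: "P \<subseteq> carrier A"
  unfolding range_projections_eq using proj_closed by auto

lemma P_mult: "x \<in> P \<Longrightarrow> y \<in> P \<Longrightarrow> x \<otimes> y \<in> subspace_of A hull P"
proof -
  assume "x \<in> P" "y \<in> P"
  then obtain \<mu> \<nu> where p: "\<mu> \<in> paths \<Lambda>" "\<nu> \<in> paths \<Lambda>" "x = proj \<mu>" "y = proj \<nu>"
    unfolding range_projections_eq by auto
  have "(\<Oplus>p\<in>min_ext \<Lambda> \<mu> \<nu>. proj (\<mu> \<cdot> fst p)) \<in> subspace_of A hull P"
  proof (rule finsum_subspace[OF _ subspace_span[OF P_carrier]])
    show "finite (min_ext \<Lambda> \<mu> \<nu>)" using aligned p unfolding finitely_aligned_def by blast
    fix q assume "q \<in> min_ext \<Lambda> \<mu> \<nu>"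
    then have "\<mu> \<cdot> fst q \<in> paths \<Lambda>" using comp_closed p unfolding min_ext_def by auto
    then show "proj (\<mu> \<cdot> fst q) \<in> subspace_of A hull P" unfolding range_projections_eq by (simp add: hull_inc)
  qed
  then show ?thesis using proj_mult[OF p(1,2)] p by simp
qed

lemma P_adj: "x \<in> P \<Longrightarrow> adj A x \<in> P"
  unfolding range_projections_eq using proj_adj by auto

lemma carrier_D: "carrier D = closed_span A P"
  unfolding diagonal_def by (rule generated_eq_closed_span[OF P_carrier P_mult P_adj])

lemma D_subalgebra: "cstar_subalgebra_of A (carrier D)"
  unfolding carrier_D by (rule subalgebra_closed_span[OF P_carrier P_mult P_adj])

lemma D_simps:
  "x \<otimes>\<^bsub>D\<^esub> y = x \<otimes> y" "x \<oplus>\<^bsub>D\<^esub> y = x \<oplus> y" "c \<odot>\<^bsub>D\<^esub> x = c \<odot> x"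
  unfolding diagonal_def generated_cstar_def by simp_all

lemma D_closed:
  shows "x \<in> carrier D \<Longrightarrow> x \<in> carrier A" "x \<in> carrier D \<Longrightarrow> y \<in> carrier D \<Longrightarrow> x \<oplus> y \<in> carrier D"
    "x \<in> carrier D \<Longrightarrow> y \<in> carrier D \<Longrightarrow> x \<otimes> y \<in> carrier D" "x \<in> carrier D \<Longrightarrow> c \<odot> x \<in> carrier D"
    "x \<in> carrier D \<Longrightarrow> y \<in> carrier D \<Longrightarrow> x \<ominus> y \<in> carrier D" "\<zero> \<in> carrier D"
  using D_subalgebra subspaceD[of "carrier D"] unfolding cstar_subalgebra_of_def by auto

lemma span_D: "v \<in> subspace_of A hull P \<Longrightarrow> v \<in> carrier D"
  unfolding carrier_D using span_subset_closed_span[OF P_carrier] by auto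

lemma proj_D: "\<mu> \<in> paths \<Lambda> \<Longrightarrow> proj \<mu> \<in> carrier D"
  by (rule span_D) (simp add: range_projections_eq hull_inc)

lemma spectrum_iff:
  "\<phi> \<in> spectrum D \<longleftrightarrow> \<phi> \<in> extensional (carrier D) \<and>
     (\<forall>x\<in>carrier D. \<forall>y\<in>carrier D. \<phi> (x \<oplus> y) = \<phi> x + \<phi> y \<and> \<phi> (x \<otimes> y) = \<phi> x * \<phi> y) \<and>
     (\<forall>c. \<forall>x\<in>carrier D. \<phi> (c \<odot> x) = c * \<phi> x) \<and> (\<exists>x\<in>carrier D. \<phi> x \<noteq> 0)"
  unfolding spectrum_def D_simps by blast

section \<open>Characters of the diagonal and boundary filters\<close>

context
  fixes \<phi> :: "'b \<Rightarrow> complex"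
  assumes phi: "\<phi> \<in> spectrum D"
begin

lemma phi_add: "x \<in> carrier D \<Longrightarrow> y \<in> carrier D \<Longrightarrow> \<phi> (x \<oplus> y) = \<phi> x + \<phi> y"
  and phi_mult: "x \<in> carrier D \<Longrightarrow> y \<in> carrier D \<Longrightarrow> \<phi> (x \<otimes> y) = \<phi> x * \<phi> y"
  and phi_smult: "x \<in> carrier D \<Longrightarrow> \<phi> (c \<odot> x) = c * \<phi> x"
  using phi unfolding spectrum_iff by blast+

lemma phi_minus: "x \<in> carrier D \<Longrightarrow> y \<in> carrier D \<Longrightarrow> \<phi> (x \<ominus> y) = \<phi> x - \<phi> y"
  by (simp add: minus_eq_smult D_closed phi_add phi_smult)

lemma phi_zero: "\<phi> \<zero> = 0"
  using phi_smult[OF D_closed(6), of 0] smult_zero by simp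

lemma phi_le: "x \<in> carrier D \<Longrightarrow> cmod (\<phi> x) \<le> nrm A x"
  by (rule character_contractive[OF D_subalgebra phi_add phi_mult phi_smult])

lemma phi_finsum:
  assumes "finite M" "\<And>p. p \<in> M \<Longrightarrow> F p \<in> carrier D"
  shows "\<phi> (\<Oplus>p\<in>M. F p) = (\<Sum>p\<in>M. \<phi> (F p))"
  using assms
proof (induction M)
  case empty
  then show ?case by (simp add: phi_zero)
next
  case (insert p M)
  have "F \<in> M \<rightarrow> carrier A" "F p \<in> carrier A" using insert D_closed by auto
  moreover have "(\<Oplus>p\<in>M. F p) \<in> carrier D"
    by (rule finsum_subspace[OF insert(1)])
      (use D_subalgebra insert in \<open>auto simp: cstar_subalgebra_of_def\<close>)
  ultimately show ?case using insert phi_add by simp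
qed

lemma phi_proj_cases:
  assumes "\<mu> \<in> paths \<Lambda>"
  shows "\<phi> (proj \<mu>) = 0 \<or> \<phi> (proj \<mu>) = 1"
proof -
  have "\<phi> (proj \<mu>) * \<phi> (proj \<mu>) = \<phi> (proj \<mu>)"
    using phi_mult[OF proj_D proj_D, OF assms assms] proj_mult_prefix[OF prefix_refl[OF assms]] by simp
  then show ?thesis by simp
qed

text \<open>(CK4) lives at the source of \<xi>, while \<phi> is known to be 1 at the range
  projection of \<xi>. Conjugation by s \<xi> carries the product there, and each factor becomes
  proj \<xi> minus proj (\<xi> \<cdot> \<mu>). Membership in D is carried through the induction
  because \<phi> is multiplicative on D.\<close>

lemma phi_CK4:
  assumes x: "\<xi> \<in> paths \<Lambda>" "\<phi> (proj \<xi>) = 1" and Es: "set Es \<subseteq> paths_from \<Lambda> (src \<Lambda> \<xi>)"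
  defines "v \<equiv> src \<Lambda> \<xi>"
  shows "foldr (\<lambda>\<mu> a. (s v \<ominus> s \<mu> \<otimes> adj A (s \<mu>)) \<otimes> a) Es (s v) \<in> carrier A \<and>
    s \<xi> \<otimes> foldr (\<lambda>\<mu> a. (s v \<ominus> s \<mu> \<otimes> adj A (s \<mu>)) \<otimes> a) Es (s v) \<otimes> adj A (s \<xi>) \<in> carrier D \<and>
    \<phi> (s \<xi> \<otimes> foldr (\<lambda>\<mu> a. (s v \<ominus> s \<mu> \<otimes> adj A (s \<mu>)) \<otimes> a) Es (s v) \<otimes> adj A (s \<xi>)) =
      (\<Prod>\<mu>\<leftarrow>Es. 1 - \<phi> (proj (\<xi> \<cdot> \<mu>)))"
  using Es
proof (induction Es)
  case Nil
  have v: "v \<in> paths \<Lambda>" unfolding v_def using x(1) src_closed by auto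
  have "s \<xi> \<otimes> s v = s \<xi>" unfolding v_def using CK2[of \<xi> "src \<Lambda> \<xi>"] x(1) src_closed rng_src comp_src by simp
  then show ?case using x s_closed[OF v] proj_D[OF x(1)] by (simp add: proj_def)
next
  case (Cons \<mu> Es)
  define a where "a = foldr (\<lambda>\<mu> a. (s v \<ominus> s \<mu> \<otimes> adj A (s \<mu>)) \<otimes> a) Es (s v)"
  have m: "\<mu> \<in> paths \<Lambda>" "src \<Lambda> \<xi> = rng \<Lambda> \<mu>" using Cons.prems unfolding paths_from_def by auto
  have v: "v \<in> paths \<Lambda>" "v \<in> vertices \<Lambda>" unfolding v_def using x(1) src_closed src_vertex by auto
  have xm: "\<xi> \<cdot> \<mu> \<in> paths \<Lambda>" using comp_closed x m by auto
  have IH: "a \<in> carrier A" "s \<xi> \<otimes> a \<otimes> adj A (s \<xi>) \<in> carrier D"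
    "\<phi> (s \<xi> \<otimes> a \<otimes> adj A (s \<xi>)) = (\<Prod>\<mu>\<leftarrow>Es. 1 - \<phi> (proj (\<xi> \<cdot> \<mu>)))"
    using Cons unfolding a_def by auto
  note c = s_closed[OF x(1)] s_closed[OF m(1)] s_closed[OF v(1)] proj_closed[OF x(1)] proj_closed[OF m(1)] proj_closed[OF xm] IH(1)
  have 1: "s \<xi> \<otimes> s v = s \<xi>" unfolding v_def using CK2[of \<xi> "src \<Lambda> \<xi>"] x(1) src_closed rng_src comp_src by simp
  have 2: "proj \<xi> \<otimes> s \<xi> = s \<xi>" unfolding proj_def using partial_isometry[OF x(1)] .
  \<comment> \<open>The aim is that s \<xi> intertwines proj \<mu> with proj (\<xi> \<cdot> \<mu>),
    so that a factor at v can be pulled out to the left of s \<xi>.\<close>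
  have "proj (\<xi> \<cdot> \<mu>) \<otimes> s \<xi> = s \<xi> \<otimes> (proj \<mu> \<otimes> (adj A (s \<xi>) \<otimes> s \<xi>))"
    unfolding proj_def CK2[OF x(1) m, symmetric] using c closed by (simp add: adj_mult mult_assoc)
  also have "adj A (s \<xi>) \<otimes> s \<xi> = s v" unfolding v_def by (rule s_src[OF x(1)])
  also have "proj \<mu> \<otimes> s v = proj \<mu>"
  proof -
    have "adj A (s v \<otimes> s \<mu>) = adj A (s \<mu>) \<otimes> s v" using adj_mult c CK1_projection[OF v(2)] by simp
    moreover have "s v \<otimes> s \<mu> = s \<mu>" using CK2[OF v(1) m(1)] m(2) vertex_rng_src[OF v(2)] comp_rng[OF m(1)] unfolding v_def by simp
    ultimately show ?thesis unfolding proj_def using c closed by (simp add: mult_assoc)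
  qed
  finally have 3: "proj (\<xi> \<cdot> \<mu>) \<otimes> s \<xi> = s \<xi> \<otimes> proj \<mu>" .
  let ?q = "proj \<xi> \<ominus> proj (\<xi> \<cdot> \<mu>)"
  have "s \<xi> \<otimes> (s v \<ominus> proj \<mu>) = ?q \<otimes> s \<xi>"
    using c closed by (simp add: mult_minus_left mult_minus_right 1 2 3)
  then have "s \<xi> \<otimes> ((s v \<ominus> proj \<mu>) \<otimes> a) \<otimes> adj A (s \<xi>) = ?q \<otimes> (s \<xi> \<otimes> a \<otimes> adj A (s \<xi>))"
    using c closed by (simp add: mult_assoc[symmetric])
  moreover have qD: "?q \<in> carrier D" using D_closed(5) proj_D x(1) xm by blast
  moreover have "\<phi> ?q = 1 - \<phi> (proj (\<xi> \<cdot> \<mu>))" using phi_minus[OF proj_D proj_D, OF x(1) xm] x(2) by simp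
  ultimately have "s \<xi> \<otimes> ((s v \<ominus> proj \<mu>) \<otimes> a) \<otimes> adj A (s \<xi>) \<in> carrier D"
    "\<phi> (s \<xi> \<otimes> ((s v \<ominus> proj \<mu>) \<otimes> a) \<otimes> adj A (s \<xi>)) = (1 - \<phi> (proj (\<xi> \<cdot> \<mu>))) * (\<Prod>\<mu>\<leftarrow>Es. 1 - \<phi> (proj (\<xi> \<cdot> \<mu>)))"
    using D_closed(3) phi_mult IH by simp_all
  moreover have "(s v \<ominus> proj \<mu>) \<otimes> a \<in> carrier A" using c closed by simp
  ultimately show ?case unfolding a_def proj_def[of \<mu>] by simp
qed

lemma character_boundary_filter: "boundary_filter {\<mu> \<in> paths \<Lambda>. \<phi> (proj \<mu>) = 1}"
proof -
  let ?S = "{\<mu> \<in> paths \<Lambda>. \<phi> (proj \<mu>) = 1}"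
  have her: "\<mu> \<in> ?S" if "prefix \<mu> \<xi>" "\<xi> \<in> ?S" for \<mu> \<xi>
  proof -
    have p: "\<mu> \<in> paths \<Lambda>" "\<xi> \<in> paths \<Lambda>" using prefix_in_paths that by auto
    have "\<phi> (proj \<mu>) * \<phi> (proj \<xi>) = \<phi> (proj \<xi>)"
      using phi_mult[OF proj_D proj_D, OF p] proj_mult_prefix[OF that(1)] by simp
    then show ?thesis using that p by simp
  qed
  have dir: "\<exists>\<xi>\<in>?S. prefix \<mu> \<xi> \<and> prefix \<nu> \<xi>" if "\<mu> \<in> ?S" "\<nu> \<in> ?S" for \<mu> \<nu>
  proof -
    have p: "\<mu> \<in> paths \<Lambda>" "\<nu> \<in> paths \<Lambda>" "\<phi> (proj \<mu>) = 1" "\<phi> (proj \<nu>) = 1" using that by auto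
    have fin: "finite (min_ext \<Lambda> \<mu> \<nu>)" using aligned p unfolding finitely_aligned_def by blast
    have cl: "\<mu> \<cdot> fst q \<in> paths \<Lambda>" if "q \<in> min_ext \<Lambda> \<mu> \<nu>" for q
      using that comp_closed[OF p(1), of "fst q"] unfolding min_ext_def by auto
    \<comment> \<open>Multiplicativity gives the product of the two projections the value 1, so some
      term of its expansion has a nonzero value, hence 1.\<close>
    have "(\<Sum>q\<in>min_ext \<Lambda> \<mu> \<nu>. \<phi> (proj (\<mu> \<cdot> fst q))) = 1"
      using phi_finsum[OF fin, of "\<lambda>q. proj (\<mu> \<cdot> fst q)"] proj_D cl proj_mult[OF p(1,2)]
        phi_mult[OF proj_D proj_D, OF p(1,2)] p by simp
    then obtain q where q: "q \<in> min_ext \<Lambda> \<mu> \<nu>" "\<phi> (proj (\<mu> \<cdot> fst q)) \<noteq> 0"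
      by (metis (no_types, lifting) sum.neutral zero_neq_one)
    then have "\<mu> \<cdot> fst q \<in> ?S" using phi_proj_cases cl by blast
    then show ?thesis using min_ext_prefix[of "fst q" "snd q" \<mu> \<nu>] q p by auto
  qed
  \<comment> \<open>Were every projection sent to 0, \<phi> would vanish on the span and, being
    contractive, on all of D; but characters are nonzero.\<close>
  have "?S \<noteq> {}"
  proof
    assume "?S = {}"
    then have z: "\<phi> (proj \<mu>) = 0" if "\<mu> \<in> paths \<Lambda>" for \<mu> using phi_proj_cases that by blast
    have "subspace_of A {x \<in> carrier D. \<phi> x = 0}"
      by (rule subspaceI) (auto simp: D_closed phi_add phi_smult phi_zero)
    then have span: "subspace_of A hull P \<subseteq> {x \<in> carrier D. \<phi> x = 0}"
      by (rule span_subset) (auto simp: range_projections_eq z proj_D)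
    have "\<phi> x = 0" if x: "x \<in> carrier D" for x
    proof -
      have "cmod (\<phi> x) \<le> 0 + e" if e: "e > 0" for e
      proof -
        obtain v where v: "v \<in> subspace_of A hull P" "nrm A (x \<ominus> v) < e"
          using closed_span_iff[OF P_carrier, of x] x e unfolding carrier_D by blast
        have vD: "v \<in> carrier D" "\<phi> v = 0" using span v(1) by auto
        then show ?thesis using phi_le[OF D_closed(5)[OF x vD(1)]] phi_minus[OF x vD(1)] v(2) by simp
      qed
      then show ?thesis using field_le_epsilon[of "cmod (\<phi> x)" 0] by simp
    qed
    then show False using phi unfolding spectrum_iff by blast
  qed
  then have pf: "path_filter ?S" unfolding path_filter_def using her dir by blast
  have "\<exists>\<nu>\<in>E. \<xi> \<cdot> \<nu> \<in> ?S" if x: "\<xi> \<in> ?S" and E: "E \<in> finite_exhaustive \<Lambda> (src \<Lambda> \<xi>)" for \<xi> E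
  proof -
    have xp: "\<xi> \<in> paths \<Lambda>" "\<phi> (proj \<xi>) = 1" using x by auto
    obtain Es where Es: "distinct Es" "set Es = E"
      using E finite_distinct_list unfolding finite_exhaustive_def by blast
    have sub: "set Es \<subseteq> paths_from \<Lambda> (src \<Lambda> \<xi>)"
      using E Es unfolding finite_exhaustive_def exhaustive_def by auto
    have "s \<xi> \<otimes> \<zero> \<otimes> adj A (s \<xi>) = \<zero>"
      using s_closed[OF xp(1)] by (simp add: mult_zero_left mult_zero_right)
    \<comment> \<open>A product of complex numbers vanishes only if some factor does, and that
      factor picks the path \<nu> in E.\<close>
    then have "(\<Prod>\<mu>\<leftarrow>Es. 1 - \<phi> (proj (\<xi> \<cdot> \<mu>))) = 0"
      using phi_CK4[OF xp sub] CK4[OF src_vertex[OF xp(1)] E Es] phi_zero by simp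
    then obtain \<nu> where n: "\<nu> \<in> E" "\<phi> (proj (\<xi> \<cdot> \<nu>)) = 1"
      using Es(2) unfolding prod_list_zero_iff by auto
    then have "\<xi> \<cdot> \<nu> \<in> paths \<Lambda>" using comp_closed xp sub Es unfolding paths_from_def by auto
    then show ?thesis using n by blast
  qed
  then show ?thesis unfolding boundary_filter_def using pf by blast
qed

end

lemma spectrum_eqI:
  assumes f: "\<phi> \<in> spectrum D" and g: "\<psi> \<in> spectrum D" and eq: "\<And>\<mu>. \<mu> \<in> paths \<Lambda> \<Longrightarrow> \<phi> (proj \<mu>) = \<psi> (proj \<mu>)"
  shows "\<phi> = \<psi>"
proof -
  have "subspace_of A {x \<in> carrier D. \<phi> x = \<psi> x}"
    by (rule subspaceI)
      (auto simp: D_closed phi_add[OF f] phi_smult[OF f] phi_zero[OF f] phi_add[OF g] phi_smult[OF g] phi_zero[OF g])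
  then have span: "subspace_of A hull P \<subseteq> {x \<in> carrier D. \<phi> x = \<psi> x}"
    by (rule span_subset) (auto simp: range_projections_eq eq proj_D)
  have "\<phi> x = \<psi> x" if x: "x \<in> carrier D" for x
  proof -
    have "cmod (\<phi> x - \<psi> x) \<le> 0 + e" if e: "e > 0" for e
    proof -
      obtain v where v: "v \<in> subspace_of A hull P" "nrm A (x \<ominus> v) < e / 2"
        using closed_span_iff[OF P_carrier, of x] x e half_gt_zero unfolding carrier_D by blast
      have vD: "v \<in> carrier D" "\<phi> v = \<psi> v" using span v(1) by auto
      have "cmod (\<phi> x - \<phi> v) \<le> nrm A (x \<ominus> v)" "cmod (\<psi> x - \<psi> v) \<le> nrm A (x \<ominus> v)"
        using phi_le[OF f D_closed(5)[OF x vD(1)]] phi_minus[OF f x vD(1)]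
          phi_le[OF g D_closed(5)[OF x vD(1)]] phi_minus[OF g x vD(1)] by simp_all
      moreover have "\<phi> x - \<psi> x = (\<phi> x - \<phi> v) - (\<psi> x - \<psi> v)" using vD by simp
      ultimately show ?thesis using norm_triangle_ineq4[of "\<phi> x - \<phi> v" "\<psi> x - \<psi> v"] v(2) by simp
    qed
    then show ?thesis using field_le_epsilon[of "cmod (\<phi> x - \<psi> x)" 0] by simp
  qed
  then show ?thesis
    using f g unfolding spectrum_iff by (intro extensionalityI[of _ "carrier D"]) auto
qed

text \<open>The diagonal matrix coefficient at the basis vector of S0 is linear and bounded by
  construction. Multiplicativity comes from the eigenvector property, which is proved on D; hence
  the restriction to D.\<close>

lemma ex_boundary_character:
  assumes u: "universal_ck_family A \<Lambda> s" and S0: "boundary_filter S0"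
  obtains \<phi> where "\<phi> \<in> spectrum D" "\<And>\<mu>. \<mu> \<in> paths \<Lambda> \<Longrightarrow> \<phi> (proj \<mu>) = (if \<mu> \<in> S0 then 1 else 0)"
proof -
  obtain X e where Xe: "filter_action k \<Lambda> X e" "S0 \<in> X" using ex_filter_action[OF aligned S0] by blast
  interpret F: filter_action k \<Lambda> X e by (rule Xe(1))
  obtain \<pi> where p: "star_hom A operator_algebra \<pi>" "\<And>\<xi>. \<xi> \<in> paths \<Lambda> \<Longrightarrow> \<pi> (s \<xi>) = F.isom \<xi>"
    using u F.ck_family_isom unfolding universal_ck_family_def by blast
  let ?d = "unit_vector (e S0)"
  define v where "v a = blinfun_apply (operator_decode (\<pi> a)) ?d" for a
  define \<psi> where "\<psi> a = coord (v a) (e S0)" for a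
  note hom = p(1)[unfolded star_hom_def]
  have code: "\<pi> x = operator_code (operator_decode (\<pi> x)) \<and> operator_decode (\<pi> x) \<in> operators" if "x \<in> carrier A" for x
  proof -
    have "\<pi> x \<in> operator_code ` operators"
      using hom that by (simp add: operator_algebra_simps)
    then show ?thesis by auto
  qed
  have dec: "operator_decode (\<pi> (x \<oplus> y)) = operator_decode (\<pi> x) + operator_decode (\<pi> y)"
    "operator_decode (\<pi> (x \<otimes> y)) = operator_decode (\<pi> x) o\<^sub>L operator_decode (\<pi> y)"
    "operator_decode (\<pi> (c \<odot> x)) = operator_cscale c (operator_decode (\<pi> x))"
    if "x \<in> carrier A" "y \<in> carrier A" for x y c
    using hom that code[OF that(1)] code[OF that(2)] by (metis decode_code operator_algebra_simps)+
  have v: "v (x \<oplus> y) = v x + v y" "v (c \<odot> x) = cscale c (v x)"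
    "v (x \<otimes> y) = blinfun_apply (operator_decode (\<pi> x)) (v y)"
    if "x \<in> carrier A" "y \<in> carrier A" for x y c
    unfolding v_def by (simp_all add: dec[OF that] plus_blinfun.rep_eq)
  have vm: "v (x \<ominus> y) = v x - v y" if "x \<in> carrier A" "y \<in> carrier A" for x y
    using that closed by (simp add: minus_eq_smult v uminus_ell2_def[symmetric])
  have vz: "v \<zero> = 0" using vm[of \<zero> \<zero>] closed minus_self by simp
  have bound: "norm (v x) \<le> nrm A x" "cmod (\<psi> x) \<le> nrm A x" if "x \<in> carrier A" for x
  proof -
    show *: "norm (v x) \<le> nrm A x"
      using star_hom_operator_bound[OF p(1) that, of ?d] unfolding v_def by (simp add: norm_unit_vector)
    show "cmod (\<psi> x) \<le> nrm A x" unfolding \<psi>_def using cmod_coord_le * by (rule order_trans)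
  qed
  have psi: "\<psi> (x \<oplus> y) = \<psi> x + \<psi> y" "\<psi> (c \<odot> x) = c * \<psi> x" "\<psi> (x \<ominus> y) = \<psi> x - \<psi> y"
    if "x \<in> carrier A" "y \<in> carrier A" for x y c
    unfolding \<psi>_def using v[OF that] vm[OF that] by simp_all
  \<comment> \<open>The elements having ?d as an eigenvector form a closed subspace containing all
    range projections, hence containing D.\<close>
  define V where "V = {a \<in> carrier A. v a = cscale (\<psi> a) ?d}"
  have "subspace_of A V"
  proof (rule subspaceI)
    show "V \<subseteq> carrier A" unfolding V_def by auto
    have "\<psi> \<zero> = 0" unfolding \<psi>_def vz by simp
    moreover have "cscale 0 ?d = 0" by (rule ell2_eqI) simp
    ultimately show "\<zero> \<in> V" unfolding V_def using vz closed by simp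
    show "x \<oplus> y \<in> V" if "x \<in> V" "y \<in> V" for x y
      using that unfolding V_def by (auto simp: closed v psi cscale_add_left)
    show "c \<odot> x \<in> V" if x: "x \<in> V" for c x
    proof -
      have xc: "x \<in> carrier A" "v x = cscale (\<psi> x) ?d" using x unfolding V_def by auto
      then have "v (c \<odot> x) = cscale (\<psi> (c \<odot> x)) ?d"
        using v(2)[OF xc(1) xc(1)] psi(2)[OF xc(1) xc(1)] by (simp only: xc(2) cscale_cscale)
      then show ?thesis unfolding V_def using xc closed by auto
    qed
  qed
  moreover have "closedin (norm_topology A) V"
  proof (rule closedinI)
    show "V \<subseteq> carrier A" unfolding V_def by auto
    fix x assume x: "x \<in> carrier A" "\<And>e. e > 0 \<Longrightarrow> \<exists>v\<in>V. nrm A (x \<ominus> v) < e"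
    have "norm (v x - cscale (\<psi> x) ?d) \<le> 0 + e" if e: "e > 0" for e
    proof -
      obtain y where y: "y \<in> V" "nrm A (x \<ominus> y) < e / 2" using x(2)[of "e / 2"] e by auto
      then have yc: "y \<in> carrier A" "v y = cscale (\<psi> y) ?d" unfolding V_def by auto
      have xy: "x \<ominus> y \<in> carrier A" using x yc closed by simp
      \<comment> \<open>The defect of the eigenvector equation is additive and vanishes at y, so it
        is controlled by the norm of x minus y.\<close>
      have "v x - cscale (\<psi> x) ?d = v (x \<ominus> y) - cscale (\<psi> (x \<ominus> y)) ?d"
        unfolding vm[OF x(1) yc(1)] psi(3)[OF x(1) yc(1)] yc(2)
        by (rule ell2_eqI) (simp add: algebra_simps)
      also have "norm \<dots> \<le> norm (v (x \<ominus> y)) + norm (cscale (\<psi> (x \<ominus> y)) ?d)" by (rule norm_triangle_ineq4)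
      also have "\<dots> \<le> nrm A (x \<ominus> y) + nrm A (x \<ominus> y)"
        using bound[OF xy] by (simp add: norm_cscale norm_unit_vector add_mono)
      finally show ?thesis using y(2) by simp
    qed
    then have "norm (v x - cscale (\<psi> x) ?d) \<le> 0" by (rule field_le_epsilon)
    then show "x \<in> V" unfolding V_def using x(1) by simp
  qed
  moreover have vproj: "v (proj \<mu>) = (if \<mu> \<in> S0 then ?d else 0)" if m: "\<mu> \<in> paths \<Lambda>" for \<mu>
  proof -
    have "\<pi> (proj \<mu>) = F.isom \<mu> \<otimes>\<^bsub>operator_algebra\<^esub> adj operator_algebra (F.isom \<mu>)"
      unfolding proj_def using hom p(2)[OF m] s_closed[OF m] by simp
    then show ?thesis
      unfolding v_def F.isom_range_projection[OF m]
      by (simp add: partial_shift_Id_on_unit_vector F.e_mem_points[OF Xe(2)])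
  qed
  moreover have "P \<subseteq> V"
  proof -
    have "proj \<mu> \<in> V" if m: "\<mu> \<in> paths \<Lambda>" for \<mu>
      using proj_closed[OF m] unfolding V_def \<psi>_def mem_Collect_eq vproj[OF m]
      by (auto intro!: ell2_eqI)
    then show ?thesis unfolding range_projections_eq by auto
  qed
  ultimately have DV: "carrier D \<subseteq> V" unfolding carrier_D using closed_span_subset by blast
  define \<phi> where "\<phi> = restrict \<psi> (carrier D)"
  have phi: "\<phi> a = \<psi> a" if "a \<in> carrier D" for a using that unfolding \<phi>_def by simp
  have pm: "\<phi> (proj \<mu>) = (if \<mu> \<in> S0 then 1 else 0)" if "\<mu> \<in> paths \<Lambda>" for \<mu>
    using phi[OF proj_D[OF that]] vproj[OF that] unfolding \<psi>_def by simp
  have mult: "\<psi> (x \<otimes> y) = \<psi> x * \<psi> y" if xy: "x \<in> carrier D" "y \<in> carrier D" for x y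
  proof -
    have c: "x \<in> carrier A" "y \<in> carrier A" "v x = cscale (\<psi> x) ?d" "v y = cscale (\<psi> y) ?d"
      using DV xy unfolding V_def by auto
    \<comment> \<open>The eigenvalue of y passes through the operator of x by complex
      linearity.\<close>
    have "v (x \<otimes> y) = cscale (\<psi> y) (v x)"
      unfolding v(3)[OF c(1,2)] c(4) using operators_cscale code[OF c(1)] unfolding v_def by blast
    then show ?thesis unfolding \<psi>_def by simp
  qed
  obtain \<mu> where m: "\<mu> \<in> paths \<Lambda>" "\<mu> \<in> S0"
    using S0 unfolding boundary_filter_def path_filter_def by blast
  have "\<phi> \<in> spectrum D"
    unfolding spectrum_iff
  proof (intro conjI ballI allI)
    show "\<phi> \<in> extensional (carrier D)" unfolding \<phi>_def by simp
    show "\<exists>x\<in>carrier D. \<phi> x \<noteq> 0" using pm[OF m(1)] m(2) by (intro bexI[OF _ proj_D[OF m(1)]]) simp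
    fix x y c assume x: "x \<in> carrier D"
    then show "\<phi> (c \<odot> x) = c * \<phi> x" using phi D_closed psi(2)[of x x] by simp
    assume "y \<in> carrier D"
    then show "\<phi> (x \<oplus> y) = \<phi> x + \<phi> y" "\<phi> (x \<otimes> y) = \<phi> x * \<phi> y"
      using phi D_closed psi mult x by simp_all
  qed
  then show ?thesis using that pm by blast
qed

end

section \<open>The homeomorphism\<close>

lemma continuous_map_to_complex_iff:
  fixes f :: "'c \<Rightarrow> complex"
  shows "continuous_map T euclidean f \<longleftrightarrow>
    (\<forall>x\<in>topspace T. \<forall>e>0. \<exists>U. openin T U \<and> x \<in> U \<and> (\<forall>y\<in>U. dist (f x) (f y) < e))"
  using Met_TC.continuous_map_to_metric[of T f] by simp

lemma continuous_map_complex_add: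
  fixes f g :: "'c \<Rightarrow> complex"
  assumes f: "continuous_map T euclidean f" and g: "continuous_map T euclidean g"
  shows "continuous_map T euclidean (\<lambda>x. f x + g x)"
  unfolding continuous_map_to_complex_iff
proof (intro ballI allI impI)
  fix x and d :: real assume x: "x \<in> topspace T" and d: "d > 0"
  obtain U where U: "openin T U" "x \<in> U" "\<forall>y\<in>U. dist (f x) (f y) < d / 2"
    using f x d half_gt_zero unfolding continuous_map_to_complex_iff by metis
  obtain V where V: "openin T V" "x \<in> V" "\<forall>y\<in>V. dist (g x) (g y) < d / 2"
    using g x d half_gt_zero unfolding continuous_map_to_complex_iff by metis
  have "dist (f x + g x) (f y + g y) < d" if "y \<in> U \<inter> V" for y
    using dist_triangle_add[of "f x" "g x" "f y" "g y"] U(3) V(3) that by fastforce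
  then show "\<exists>U. openin T U \<and> x \<in> U \<and> (\<forall>y\<in>U. dist (f x + g x) (f y + g y) < d)"
    using U V by (intro exI[of _ "U \<inter> V"]) auto
qed

lemma continuous_map_complex_cmult:
  fixes f :: "'c \<Rightarrow> complex"
  assumes f: "continuous_map T euclidean f"
  shows "continuous_map T euclidean (\<lambda>x. c * f x)"
  using continuous_map_compose[OF f, of euclidean "\<lambda>z. c * z"]
  by (simp add: o_def continuous_on_mult_left)

context aligned_ck_family
begin

text \<open>Removes \<open>prepend\<close> from the characterisation; from here on a character is
  compared with the filter of x.\<close>

lemma is_path_character_iff:
  assumes x: "x \<in> path_space k \<Lambda>"
  shows "is_path_character k \<Lambda> A s x \<phi> \<longleftrightarrow>
    \<phi> \<in> spectrum D \<and> (\<forall>\<mu>\<in>paths \<Lambda>. \<phi> (proj \<mu>) = (if \<mu> \<in> initial x then 1 else 0))"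
  unfolding is_path_character_def proj_def using ex_prepend_iff[OF x] by auto

section \<open>The cylinder topology\<close>

lemma openin_cylinder_diff:
  assumes "\<mu> \<in> paths \<Lambda>" "finite G" "G \<subseteq> paths_from \<Lambda> (src \<Lambda> \<mu>)"
  shows "openin (path_topology k \<Lambda>) (cylinder k \<Lambda> \<mu> - (\<Union>\<nu>\<in>G. cylinder k \<Lambda> (\<mu> \<cdot> \<nu>)))"
  unfolding path_topology_def by (rule topology_generated_by_Basis) (use assms in blast)

lemma openin_cylinder: "\<mu> \<in> paths \<Lambda> \<Longrightarrow> openin (path_topology k \<Lambda>) (cylinder k \<Lambda> \<mu>)"
  using openin_cylinder_diff[of \<mu> "{}"] by simp

text \<open>The cylinders of vertices cover the path space, which identifies its underlying set and
  supplies the neighbourhoods for complements of cylinders.\<close>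

lemma cylinder_prng:
  assumes x: "x \<in> path_space k \<Lambda>"
  shows "prng x \<in> vertices \<Lambda>" "x \<in> cylinder k \<Lambda> (prng x)"
proof -
  have "prng x \<in> paths \<Lambda>" "deg \<Lambda> (prng x) = 0"
    unfolding prng_def using initial_deg[OF x emb_0_le] by auto
  then show v: "prng x \<in> vertices \<Lambda>" unfolding vertices_def by simp
  show "x \<in> cylinder k \<Lambda> (prng x)" unfolding cylinder_eq using x prng_mem_initial[OF x v] by simp
qed

lemma topspace_path_topology: "topspace (path_topology k \<Lambda>) = path_space k \<Lambda>"
proof
  show "topspace (path_topology k \<Lambda>) \<subseteq> path_space k \<Lambda>"
    unfolding path_topology_def topology_generated_by_topspace cylinder_def by auto
  show "path_space k \<Lambda> \<subseteq> topspace (path_topology k \<Lambda>)"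
  proof
    fix x assume x: "x \<in> path_space k \<Lambda>"
    have "prng x \<in> paths \<Lambda>" using cylinder_prng(1)[OF x] unfolding vertices_def by simp
    from openin_subset[OF openin_cylinder[OF this]] cylinder_prng(2)[OF x]
    show "x \<in> topspace (path_topology k \<Lambda>)" by auto
  qed
qed

lemma topspace_boundary_topology: "topspace (boundary_topology k \<Lambda>) = boundary_paths k \<Lambda>"
  unfolding boundary_topology_def topspace_subtopology topspace_path_topology boundary_paths_def by auto

text \<open>Cylinders are closed: off the cylinder of \<open>\<mu>\<close>, use the cylinder of the range with \<open>\<mu>\<close> removed.\<close>
lemma cylinder_complement_nhd:
  assumes x: "x \<in> path_space k \<Lambda>" and m: "\<mu> \<in> paths \<Lambda>" "x \<notin> cylinder k \<Lambda> \<mu>"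
  obtains U where "openin (path_topology k \<Lambda>) U" "x \<in> U" "U \<inter> cylinder k \<Lambda> \<mu> = {}"
proof -
  let ?v = "prng x"
  note v = cylinder_prng[OF x]
  note vv = vertex_rng_src[OF v(1)]
  show ?thesis
  proof (cases "rng \<Lambda> \<mu> = ?v")
    case True
    have "?v \<cdot> \<mu> = \<mu>" using True m comp_rng by metis
    moreover have "{\<mu>} \<subseteq> paths_from \<Lambda> (src \<Lambda> ?v)" using True m vv unfolding paths_from_def by auto
    ultimately have "openin (path_topology k \<Lambda>) (cylinder k \<Lambda> ?v - cylinder k \<Lambda> \<mu>)"
      using openin_cylinder_diff[OF vv(1), of "{\<mu>}"] by simp
    then show ?thesis using that v m by blast
  next
    case False
    have "cylinder k \<Lambda> ?v \<inter> cylinder k \<Lambda> \<mu> = {}"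
      using False filter_mem_vertex_iff[OF path_filter_initial _ v(1)] unfolding cylinder_eq by blast
    then show ?thesis using that openin_cylinder[OF vv(1)] v by blast
  qed
qed

text \<open>Evaluations at range projections are locally constant along h, and contractivity extends
  their continuity to all of D by uniform approximation. Conversely, a basic set of paths pulls back
  under the inverse to finitely many open conditions on the values at range projections.\<close>

theorem path_character_homeomorphism:
  assumes u: "universal_ck_family A \<Lambda> s"
  defines "h \<equiv> \<lambda>x. THE \<phi>. is_path_character k \<Lambda> A s x \<phi>"
  shows "\<forall>x\<in>boundary_paths k \<Lambda>. \<exists>!\<phi>. is_path_character k \<Lambda> A s x \<phi>"
    and "homeomorphic_map (boundary_topology k \<Lambda>) (spectrum_topology D) h"
proof -
  let ?B = "boundary_paths k \<Lambda>"
  have B: "x \<in> path_space k \<Lambda>" "boundary_filter (initial x)" if "x \<in> ?B" for x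
    using that unfolding boundary_paths_eq by auto
  show ex1: "\<forall>x\<in>?B. \<exists>!\<phi>. is_path_character k \<Lambda> A s x \<phi>"
  proof
    fix x assume x: "x \<in> ?B"
    obtain \<phi> where p: "\<phi> \<in> spectrum D" "\<And>\<mu>. \<mu> \<in> paths \<Lambda> \<Longrightarrow> \<phi> (proj \<mu>) = (if \<mu> \<in> initial x then 1 else 0)"
      using ex_boundary_character[OF u B(2)[OF x]] by blast
    show "\<exists>!\<phi>. is_path_character k \<Lambda> A s x \<phi>"
      unfolding is_path_character_iff[OF B(1)[OF x]]
    proof (rule ex1I[of _ \<phi>])
      fix \<psi> assume q: "\<psi> \<in> spectrum D \<and> (\<forall>\<mu>\<in>paths \<Lambda>. \<psi> (proj \<mu>) = (if \<mu> \<in> initial x then 1 else 0))"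
      show "\<psi> = \<phi>" by (rule spectrum_eqI) (use p q in auto)
    qed (use p in blast)
  qed
  have h: "h x \<in> spectrum D" "\<mu> \<in> paths \<Lambda> \<Longrightarrow> h x (proj \<mu>) = (if \<mu> \<in> initial x then 1 else 0)"
    if x: "x \<in> ?B" for x \<mu>
  proof -
    have "is_path_character k \<Lambda> A s x (h x)" unfolding h_def by (rule theI'[OF bspec[OF ex1 x]])
    then show "h x \<in> spectrum D" "\<mu> \<in> paths \<Lambda> \<Longrightarrow> h x (proj \<mu>) = (if \<mu> \<in> initial x then 1 else 0)"
      unfolding is_path_character_iff[OF B(1)[OF x]] by auto
  qed
  \<comment> \<open>The inverse of h. The choice has a candidate because the filter of a character
    is the filter of a boundary path.\<close>
  define g where "g \<phi> = (SOME x. x \<in> ?B \<and> h x = \<phi>)" for \<phi>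
  have inj: "x = y" if x: "x \<in> ?B" "y \<in> ?B" "h x = h y" for x y
  proof (rule initial_inj[OF B(1)[OF x(1)] B(1)[OF x(2)]])
    have "\<mu> \<in> initial x \<longleftrightarrow> \<mu> \<in> initial y" if "\<mu> \<in> paths \<Lambda>" for \<mu>
      using h(2)[OF x(1) that] h(2)[OF x(2) that] x(3) by (auto split: if_splits)
    then show "initial x = initial y"
      using path_filterD(1)[OF path_filter_initial] B x by blast
  qed
  have g: "g \<phi> \<in> ?B" "h (g \<phi>) = \<phi>" if f: "\<phi> \<in> spectrum D" for \<phi>
  proof -
    let ?S = "{\<mu> \<in> paths \<Lambda>. \<phi> (proj \<mu>) = 1}"
    have S: "boundary_filter ?S" by (rule character_boundary_filter[OF f])
    then have "path_filter ?S" unfolding boundary_filter_def by blast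
    then obtain x where x: "x \<in> path_space k \<Lambda>" "initial x = ?S" by (rule ex_path_initial)
    then have xB: "x \<in> ?B" unfolding boundary_paths_eq using S by simp
    have "h x = \<phi>"
    proof (rule spectrum_eqI[OF h(1)[OF xB] f])
      fix \<mu> assume "\<mu> \<in> paths \<Lambda>"
      then show "h x (proj \<mu>) = \<phi> (proj \<mu>)" using h(2)[OF xB] x(2) phi_proj_cases[OF f] by auto
    qed
    then have "\<exists>x. x \<in> ?B \<and> h x = \<phi>" using xB by blast
    then show "g \<phi> \<in> ?B" "h (g \<phi>) = \<phi>" unfolding g_def by (metis (mono_tags, lifting) someI_ex)+
  qed
  have gh: "g (h x) = x" if x: "x \<in> ?B" for x
    using inj[OF g(1)[OF h(1)[OF x]] x g(2)[OF h(1)[OF x]]] .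
  let ?X = "boundary_topology k \<Lambda>" and ?Y = "spectrum_topology D"
  have tY: "topspace ?Y = spectrum D"
    unfolding spectrum_topology_def spectrum_def by (auto simp: PiE_def)
  have op: "openin ?X (U \<inter> ?B)" if "openin (path_topology k \<Lambda>) U" for U
    unfolding boundary_topology_def using that by (rule openin_subtopology_Int)
  have cont_proj: "continuous_map ?X euclidean (\<lambda>x. h x (proj \<mu>))" if m: "\<mu> \<in> paths \<Lambda>" for \<mu>
    unfolding continuous_map_to_complex_iff topspace_boundary_topology
  proof (intro ballI allI impI)
    fix x and d :: real assume x: "x \<in> ?B" and d: "d > 0"
    \<comment> \<open>Membership in the cylinder of \<mu> is locally constant, as cylinders are both
      open and closed.\<close>
    obtain U where U: "openin (path_topology k \<Lambda>) U" "x \<in> U"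
      "\<And>y. y \<in> U \<Longrightarrow> y \<in> cylinder k \<Lambda> \<mu> \<longleftrightarrow> x \<in> cylinder k \<Lambda> \<mu>"
    proof (cases "x \<in> cylinder k \<Lambda> \<mu>")
      case True
      show ?thesis by (rule that[OF openin_cylinder[OF m] True]) (use True in auto)
    next
      case False
      obtain V where V: "openin (path_topology k \<Lambda>) V" "x \<in> V" "V \<inter> cylinder k \<Lambda> \<mu> = {}"
        using cylinder_complement_nhd[OF B(1)[OF x] m False] .
      show ?thesis by (rule that[OF V(1,2)]) (use V(3) False in auto)
    qed
    have "h x (proj \<mu>) = h y (proj \<mu>)" if y: "y \<in> U \<inter> ?B" for y
    proof -
      have "\<mu> \<in> initial y \<longleftrightarrow> \<mu> \<in> initial x"
        using U(3)[of y] y B(1)[OF x] B(1)[of y] unfolding cylinder_eq by auto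
      then show ?thesis using h(2)[OF x m] h(2)[of y, OF _ m] y by simp
    qed
    then have "openin ?X (U \<inter> ?B) \<and> x \<in> U \<inter> ?B \<and> (\<forall>y\<in>U \<inter> ?B. dist (h x (proj \<mu>)) (h y (proj \<mu>)) < d)"
      using op[OF U(1)] U(2) x d by simp
    then show "\<exists>U. openin ?X U \<and> x \<in> U \<and> (\<forall>y\<in>U. dist (h x (proj \<mu>)) (h y (proj \<mu>)) < d)" by blast
  qed
  \<comment> \<open>Continuity of evaluation is extended from the projections to their span first;
    the passage to norm limits comes afterwards.\<close>
  let ?Q = "{a \<in> carrier D. continuous_map ?X euclidean (\<lambda>x. h x a)}"
  have cong: "continuous_map ?X euclidean f" if "continuous_map ?X euclidean f'" "\<And>x. x \<in> ?B \<Longrightarrow> f x = f' x"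
    for f f' :: "'a gpath \<Rightarrow> complex"
    using continuous_map_eq[OF that(1)] that(2) by (simp add: topspace_boundary_topology)
  have "subspace_of A ?Q"
  proof (rule subspaceI)
    show "?Q \<subseteq> carrier A" using D_closed(1) by blast
    have "continuous_map ?X euclidean (\<lambda>x. h x \<zero>)"
      by (rule cong[of "\<lambda>_. 0"]) (simp_all add: phi_zero h)
    then show "\<zero> \<in> ?Q" using D_closed(6) by simp
    show "a \<oplus> b \<in> ?Q" if ab: "a \<in> ?Q" "b \<in> ?Q" for a b
    proof -
      have "continuous_map ?X euclidean (\<lambda>x. h x (a \<oplus> b))"
        by (rule cong[of "\<lambda>x. h x a + h x b"]) (use ab in \<open>auto intro: continuous_map_complex_add simp: phi_add h\<close>)
      then show ?thesis using ab D_closed by auto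
    qed
    show "c \<odot> a \<in> ?Q" if a: "a \<in> ?Q" for c a
    proof -
      have "continuous_map ?X euclidean (\<lambda>x. h x (c \<odot> a))"
        by (rule cong[of "\<lambda>x. c * h x a"]) (use a in \<open>auto intro: continuous_map_complex_cmult simp: phi_smult h\<close>)
      then show ?thesis using a D_closed by auto
    qed
  qed
  then have span: "subspace_of A hull P \<subseteq> ?Q"
    by (rule span_subset) (auto simp: range_projections_eq proj_D cont_proj)
  have cont: "continuous_map ?X euclidean (\<lambda>x. h x a)" if a: "a \<in> carrier D" for a
    unfolding continuous_map_to_complex_iff topspace_boundary_topology
  proof (intro ballI allI impI)
    fix x and d :: real assume x: "x \<in> ?B" and d: "d > 0"
    obtain v where v: "v \<in> subspace_of A hull P" "nrm A (a \<ominus> v) < d / 3"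
      using closed_span_iff[OF P_carrier, of a] a d unfolding carrier_D by (metis divide_pos_pos zero_less_numeral)
    have vD: "v \<in> carrier D" "continuous_map ?X euclidean (\<lambda>x. h x v)" using span v(1) by auto
    \<comment> \<open>The approximation is uniform in y because every character \<open>h y\<close>
      is contractive; three thirds then make up d.\<close>
    have close: "dist (h y a) (h y v) < d / 3" if y: "y \<in> ?B" for y
      using phi_le[OF h(1)[OF y] D_closed(5)[OF a vD(1)]] phi_minus[OF h(1)[OF y] a vD(1)] v(2)
      by (simp add: dist_norm)
    obtain U where U: "openin ?X U" "x \<in> U" "\<forall>y\<in>U. dist (h x v) (h y v) < d / 3"
      using vD(2) x d unfolding continuous_map_to_complex_iff topspace_boundary_topology
      by (metis divide_pos_pos zero_less_numeral)
    have "dist (h x a) (h y a) < d" if y: "y \<in> U" for y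
    proof -
      have yB: "y \<in> ?B" using openin_subset[OF U(1)] y topspace_boundary_topology by auto
      have "dist (h x a) (h y a) \<le> dist (h x a) (h x v) + dist (h x v) (h y v) + dist (h y v) (h y a)"
        using dist_triangle[of "h x a" "h y a" "h x v"] dist_triangle[of "h x v" "h y a" "h y v"] by linarith
      then show ?thesis using close[OF x] close[OF yB] U(3) y dist_commute[of "h y v" "h y a"] by fastforce
    qed
    then show "\<exists>U. openin ?X U \<and> x \<in> U \<and> (\<forall>y\<in>U. dist (h x a) (h y a) < d)" using U by blast
  qed
  have hc: "continuous_map ?X ?Y h"
    unfolding spectrum_topology_def continuous_map_in_subtopology continuous_map_componentwise
    using cont h(1) unfolding topspace_boundary_topology by (auto simp: spectrum_def)
  have ev: "continuous_map ?Y euclidean (\<lambda>\<phi>. \<phi> a)" if "a \<in> carrier D" for a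
    unfolding spectrum_topology_def
    by (rule continuous_map_from_subtopology)
      (use continuous_map_product_projection[OF that, of "\<lambda>_. euclidean"] in simp)
  have evopen: "openin ?Y {\<phi> \<in> spectrum D. \<phi> a \<in> W}" if "a \<in> carrier D" "open W" for a W
    using openin_continuous_map_preimage[OF ev[OF that(1)], of W] that(2) by (simp add: tY)
  have gc: "continuous_map ?Y ?X g"
    unfolding boundary_topology_def continuous_map_in_subtopology
  proof (intro conjI)
    show "g \<in> topspace ?Y \<rightarrow> ?B" using g tY by auto
    \<comment> \<open>As the values are 0 or 1, membership is expressed as being different from 0
      and non-membership as being different from 1, which makes both of them open
      conditions.\<close>
    have mem: "g \<phi> \<in> cylinder k \<Lambda> \<mu> \<longleftrightarrow> \<phi> (proj \<mu>) \<noteq> 0" "g \<phi> \<notin> cylinder k \<Lambda> \<mu> \<longleftrightarrow> \<phi> (proj \<mu>) \<noteq> 1"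
      if f: "\<phi> \<in> spectrum D" and m: "\<mu> \<in> paths \<Lambda>" for \<phi> \<mu>
      using h(2)[OF g(1)[OF f] m] g(2)[OF f] B(1)[OF g(1)[OF f]] unfolding cylinder_eq
      by (auto split: if_splits)
    show "continuous_map ?Y (path_topology k \<Lambda>) g"
      unfolding path_topology_def
    proof (rule continuous_on_generated_topo)
      have "\<Union> {cylinder k \<Lambda> \<mu> - (\<Union>\<nu>\<in>G. cylinder k \<Lambda> (\<mu> \<cdot> \<nu>)) | \<mu> G.
          \<mu> \<in> paths \<Lambda> \<and> finite G \<and> G \<subseteq> paths_from \<Lambda> (src \<Lambda> \<mu>)} = path_space k \<Lambda>"
        using topspace_path_topology unfolding path_topology_def topology_generated_by_topspace .
      moreover have "g ` topspace ?Y \<subseteq> path_space k \<Lambda>"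
        unfolding tY by (rule image_subsetI) (rule B(1)[OF g(1)])
      ultimately show "g ` topspace ?Y \<subseteq> \<Union> {cylinder k \<Lambda> \<mu> - (\<Union>\<nu>\<in>G. cylinder k \<Lambda> (\<mu> \<cdot> \<nu>)) | \<mu> G.
          \<mu> \<in> paths \<Lambda> \<and> finite G \<and> G \<subseteq> paths_from \<Lambda> (src \<Lambda> \<mu>)}" by simp
      fix U assume "U \<in> {cylinder k \<Lambda> \<mu> - (\<Union>\<nu>\<in>G. cylinder k \<Lambda> (\<mu> \<cdot> \<nu>)) | \<mu> G.
          \<mu> \<in> paths \<Lambda> \<and> finite G \<and> G \<subseteq> paths_from \<Lambda> (src \<Lambda> \<mu>)}"
      then obtain \<mu> G where U: "U = cylinder k \<Lambda> \<mu> - (\<Union>\<nu>\<in>G. cylinder k \<Lambda> (\<mu> \<cdot> \<nu>))"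
        "\<mu> \<in> paths \<Lambda>" "finite G" "G \<subseteq> paths_from \<Lambda> (src \<Lambda> \<mu>)" by blast
      have mn: "\<mu> \<cdot> \<nu> \<in> paths \<Lambda>" if "\<nu> \<in> G" for \<nu>
        using comp_closed[OF U(2), of \<nu>] U(4) that unfolding paths_from_def by auto
      \<comment> \<open>Finiteness of G keeps the intersection open, and the factor
        \<open>topspace ?Y\<close> gives it the right value when G is empty.\<close>
      have "g -` U \<inter> topspace ?Y = {\<phi> \<in> spectrum D. \<phi> (proj \<mu>) \<in> - {0}} \<inter>
          ((\<Inter>\<nu>\<in>G. {\<phi> \<in> spectrum D. \<phi> (proj (\<mu> \<cdot> \<nu>)) \<in> - {1}}) \<inter> topspace ?Y)"
      proof (rule Set.set_eqI)
        fix \<phi>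
        show "\<phi> \<in> g -` U \<inter> topspace ?Y \<longleftrightarrow> \<phi> \<in> {\<phi> \<in> spectrum D. \<phi> (proj \<mu>) \<in> - {0}} \<inter>
            ((\<Inter>\<nu>\<in>G. {\<phi> \<in> spectrum D. \<phi> (proj (\<mu> \<cdot> \<nu>)) \<in> - {1}}) \<inter> topspace ?Y)"
          unfolding U(1) tY using mem(1)[OF _ U(2), of \<phi>] mem(2)[OF _ mn, of \<phi>]
          by (cases "\<phi> \<in> spectrum D") simp_all
      qed
      moreover have "openin ?Y ((\<Inter>\<nu>\<in>G. {\<phi> \<in> spectrum D. \<phi> (proj (\<mu> \<cdot> \<nu>)) \<in> - {1}}) \<inter> topspace ?Y)"
        by (rule openin_INT[OF U(3)], rule evopen) (use proj_D mn in auto)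
      moreover have "openin ?Y {\<phi> \<in> spectrum D. \<phi> (proj \<mu>) \<in> - {0}}"
        by (rule evopen[OF proj_D[OF U(2)]]) auto
      ultimately show "openin ?Y (g -` U \<inter> topspace ?Y)"
        using openin_Int by simp
    qed
  qed
  have "homeomorphic_maps ?X ?Y h g"
    unfolding homeomorphic_maps_def topspace_boundary_topology tY using hc gc gh g(2) by blast
  then show "homeomorphic_map ?X ?Y h" using homeomorphic_map_maps by blast
qed

end

theorem proposition7p5:
  fixes k :: nat and \<Lambda> :: "'a kgraph" and A :: "'b cstar" and s :: "'a \<Rightarrow> 'b"
  assumes kgraph: "k_graph k \<Lambda>"
    and aligned: "finitely_aligned \<Lambda>"
    and universal: "universal_ck_family A \<Lambda> s"
  shows "carrier (diagonal A \<Lambda> s) = closed_span A (range_projections A \<Lambda> s) \<and>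
    (\<forall>x\<in>boundary_paths k \<Lambda>. \<exists>!\<phi>. is_path_character k \<Lambda> A s x \<phi>) \<and>
    homeomorphic_map (boundary_topology k \<Lambda>) (spectrum_topology (diagonal A \<Lambda> s))
      (\<lambda>x. THE \<phi>. is_path_character k \<Lambda> A s x \<phi>)"
proof -
  have "ck_family A \<Lambda> s" using universal unfolding universal_ck_family_def by blast
  then interpret aligned_ck_family k \<Lambda> A s
    using kgraph aligned by (simp add: aligned_ck_family_def aligned_ck_family_axioms_def)
  show ?thesis
    using carrier_D path_character_homeomorphism[OF universal] by blast
qed

end
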